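(* Let $S \subset \mathbb{Z}$ be a finite set, let $M = M(S) := \max\{|z| : z \in S\}$, and let $0<\varepsilon<1$. There is a constant $c>0$, depending only on $\varepsilon$ and $M$, such that the following holds. Let $n \ge 0$, let $P \in \mathcal{P}_{2n}(S)$ be self-reciprocal, and put $T(t) := P(e^{it})e^{-int}$. If $|P(1)| > e^{e}$, then $$\mathrm{NZ}^*(T) \geq c\,(\log\log\log|P(1)|)^{1-\varepsilon} - 1 .$$
   Context: For $S \subset \mathbb{C}$ and $N \ge 0$, $\mathcal{P}_N(S)$ denotes the set of algebraic polynomials $P(z)=\sum_{j=0}^N a_j z^j$ with every $a_j \in S$. Saying "$P \in \mathcal{P}_N(S)$ is self-reciprocal" means that $P(z)=\sum_{j=0}^N a_j z^j$ with all $a_j \in S$ and $a_j = a_{N-j}$ for $j=0,1,\dots,N$; the actual degree of $P$ may be smaller than $N$. For self-reciprocal $P \in \mathcal{P}_{2n}(S)$ with $S \subset \mathbb{R}$, the function $T(t)=P(e^{it})e^{-int}$ is a real cosine polynomial. For a real-valued $2\pi$-periodic function $T$, $\mathrm{NZ}^*(T)$ denotes the number of sign changes of $T$ in a period of length $2\pi$. *)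

theory Defs
  imports "HOL-Analysis.Analysis" "HOL-Computational_Algebra.Polynomial"
begin

definition self_reciprocal_in :: "int set \<Rightarrow> nat \<Rightarrow> int poly \<Rightarrow> bool" where
  "self_reciprocal_in S N P \<longleftrightarrow> degree P \<le> N \<and> (\<forall>j\<le>N. coeff P j \<in> S)
     \<and> (\<forall>j\<le>N. coeff P j = coeff P (N - j))"

text \<open>T(t) = P(e^{it}) e^{-int}; real-valued for self-reciprocal P with real coefficients,
  so we take the real part.\<close>
definition assoc_cos_poly :: "int poly \<Rightarrow> nat \<Rightarrow> real \<Rightarrow> real" where
  "assoc_cos_poly P n t = Re (poly (map_poly of_int P) (cis t) * cis (- (real n * t)))"

definition NZ_star :: "(real \<Rightarrow> real) \<Rightarrow> nat" where
  "NZ_star T = Sup {k. \<exists>t :: nat \<Rightarrow> real.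
      (\<forall>j<k. t j < t (Suc j)) \<and> t k < t 0 + 2 * pi \<and>
      (\<forall>j<k. T (t j) * T (t (Suc j)) < 0)}"

end

(*
  Let k be the number of sign changes theta_1, ..., theta_k of T in (0, pi) and let
  Q(t) = prod (2 cos t - 2 cos theta_i), so that T Q >= 0 after fixing the sign. Then the L^1 mean of
  T Q is one of its Fourier coefficients, hence at most M 4^k.

  Windows of the coefficient sequence a of T at which the convolution with the coefficients of Q is
  tiny lie in a proper subspace (Siegel's pigeonhole argument), so they satisfy a common linear
  recurrence modulo a prime m > 4 M of order at most 2k. This yields one p <= m^(2k+1) such that
  a(x - p) - a(x) vanishes except near those x at which the coefficient of (e^(ipt) - 1) T Q is at
  least delta = exp(-O(k log k)). Since the L^1 mean of (e^(ipt) - 1) T Q is at most 2 M 4^k, a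
  Littlewood-type inequality bounds the number of these x by exp(exp(O(k log k))).

  Thus (e^(ipt) - 1) T is a sum of few exponentials with small integer coefficients. Pick a scale X
  such that no difference of two frequencies lies in (X, XH]. If |T(0)| were much larger than X, then
  on intervals of length about 1/X near 0 this sum would be dominated by well-separated frequencies,
  and so would change sign more than k times. As X is at most H^(N^2+N), with N the number of
  frequencies, |T(0)| is at most exp(exp(exp(O(k log k)))).
*)

theory Submission
  imports Defs "HOL-Complex_Analysis.Complex_Analysis"
begin

section \<open>Sign patterns\<close>

text \<open>Reduction modulo \<open>m\<close> keeps \<open>p\<close> under control: an integer
  recurrence of small order may have large coefficients and no period at all, whereas over the field
  of \<open>m\<close> elements at most \<open>m ^ d\<close> coefficient vectors occur, so a
  coincidence appears within \<open>m ^ d\<close> steps and is the same for all sequences. The bound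
  \<open>m > 4 * M\<close> turns congruences between differences of \<open>a\<close> back into
  equalities. The factor e^(ipt) - 1 vanishes at 0, so T(0) has to be read off from the derivative:
  the first moment of the coefficients of the product is p times T(0) = P(1). Centred at p/2, the
  factor becomes 2 i sin(pt/2), which is i times a function positive on the right of 0, so the sign
  pattern of T survives there. Of the three logarithms one undoes the power with exponent N^2 + N,
  one the exponential growth of N in the number of blocks, and one the size exp(O(k log k)) of all
  remaining parameters. Inverting k log k costs the exponent 1 - \<epsilon>.\<close>

definition alternates :: "(real \<Rightarrow> real) \<Rightarrow> real \<Rightarrow> real \<Rightarrow> real \<Rightarrow> nat \<Rightarrow> bool" where
  "alternates f \<sigma> l u k \<longleftrightarrow> (\<exists>t::nat \<Rightarrow> real. (\<forall>i<k. l < t i \<and> t i < u \<and> \<sigma> * (-1) ^ i * f (t i) > 0)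
      \<and> (\<forall>i. Suc i < k \<longrightarrow> t i < t (Suc i)))"

text \<open>\<open>alternates\<close> counts points, not changes of sign, and
  \<open>\<sigma>\<close> is the sign at the first of them. If the given pattern is empty,
  \<open>y\<close> is the new point; otherwise a point to the left of its first point is required,
  and the last assumption supplies one.\<close>

lemma alternates_Cons:
  assumes "alternates f (-\<sigma>) l' u k" and "l < y" "y < u" "\<sigma> * f y > 0" "l \<le> l'"
    and y: "\<And>t. l' < t \<Longrightarrow> t < u \<Longrightarrow> -\<sigma> * f t > 0 \<Longrightarrow> \<exists>y. l < y \<and> y < t \<and> \<sigma> * f y > 0"
  shows "alternates f \<sigma> l u (Suc k)"
proof -
  obtain t where t: "\<And>i. i < k \<Longrightarrow> l' < t i \<and> t i < u \<and> -\<sigma> * (-1) ^ i * f (t i) > 0"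
      "\<And>i. Suc i < k \<Longrightarrow> t i < t (Suc i)"
    using assms(1) unfolding alternates_def by blast
  obtain y0 where y0: "l < y0" "y0 < u" "\<sigma> * f y0 > 0" "k > 0 \<Longrightarrow> y0 < t 0"
  proof (cases "k = 0")
    case True then show ?thesis using that assms by auto
  next
    case False
    have "l' < t 0" "t 0 < u" "-\<sigma> * f (t 0) > 0" using t(1)[of 0] False by auto
    from y[OF this] obtain y1 where "l < y1" "y1 < t 0" "\<sigma> * f y1 > 0" by auto
    then show ?thesis using that[of y1] \<open>t 0 < u\<close> by auto
  qed
  define s where "s = (\<lambda>i. case i of 0 \<Rightarrow> y0 | Suc j \<Rightarrow> t j)"
  have "l < s i \<and> s i < u \<and> \<sigma> * (-1) ^ i * f (s i) > 0" if "i < Suc k" for i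
  proof (cases i)
    case 0 then show ?thesis using y0 by (simp add: s_def)
  next
    case (Suc j)
    then show ?thesis using t(1)[of j] that assms(5) by (auto simp: s_def)
  qed
  moreover have "s i < s (Suc i)" if "Suc i < Suc k" for i
    using that t(2) y0(4) by (cases i) (auto simp: s_def)
  ultimately show ?thesis unfolding alternates_def by blast
qed

text \<open>The first root is the infimum of the set where \<open>f\<close> has the wrong sign: to
  its left the sign is right, at it the product vanishes, and to its right induction applies with
  the sign reversed, since an alternation beyond the infimum can be prolonged by a point of the
  wrong sign arbitrarily close to it.\<close>

lemma sign_pattern:
  assumes "\<not> alternates f (-\<sigma>) l u (Suc r)"
  shows "\<exists>\<theta>s. length \<theta>s \<le> r \<and> set \<theta>s \<subseteq> {l..u} \<and>
     (\<forall>t. l < t \<longrightarrow> t < u \<longrightarrow> \<sigma> * f t * (\<Prod>\<theta>\<leftarrow>\<theta>s. \<theta> - t) \<ge> 0)"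
  using assms
proof (induction r arbitrary: \<sigma> l)
  case 0
  have "\<sigma> * f t \<ge> 0" if "l < t" "t < u" for t
  proof (rule ccontr)
    assume "\<not> \<sigma> * f t \<ge> 0"
    then have "alternates f (-\<sigma>) l u (Suc 0)"
      unfolding alternates_def using that by (intro exI[of _ "\<lambda>_. t"]) auto
    with 0 show False by blast
  qed
  then show ?case by (intro exI[of _ "[]"]) auto
next
  case (Suc r)
  define Z where "Z = {t. l < t \<and> t < u \<and> \<sigma> * f t < 0}"
  show ?case
  proof (cases "Z = {}")
    case True
    then show ?thesis by (intro exI[of _ "[]"]) (force simp: Z_def)
  next
    case False
    then obtain z where z: "z \<in> Z" by blast
    have bdd: "bdd_below Z" by (rule bdd_belowI[of _ l]) (auto simp: Z_def)
    define \<theta> where "\<theta> = Inf Z"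
    have l\<theta>: "l \<le> \<theta>" unfolding \<theta>_def using False by (intro cInf_greatest) (auto simp: Z_def)
    have \<theta>u: "\<theta> < u" using cInf_lower[OF z bdd] z by (auto simp: \<theta>_def Z_def)
    have "\<not> alternates f (- (-\<sigma>)) \<theta> u (Suc r)"
    proof
      assume a: "alternates f (- (-\<sigma>)) \<theta> u (Suc r)"
      have "alternates f (-\<sigma>) l u (Suc (Suc r))"
      proof (rule alternates_Cons[OF a])
        show "l < z" "z < u" "- \<sigma> * f z > 0" "l \<le> \<theta>" using z l\<theta> by (auto simp: Z_def)
        fix t assume "\<theta> < t"
        then obtain y where "y \<in> Z" "y < t" using cInf_lessD[OF False] unfolding \<theta>_def by auto
        then show "\<exists>y>l. y < t \<and> 0 < - \<sigma> * f y" by (auto simp: Z_def)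
      qed
      with Suc.prems show False by simp
    qed
    from Suc.IH[OF this] obtain \<theta>s where \<theta>s: "length \<theta>s \<le> r" "set \<theta>s \<subseteq> {\<theta>..u}"
      "\<And>t. \<theta> < t \<Longrightarrow> t < u \<Longrightarrow> -\<sigma> * f t * (\<Prod>\<theta>\<leftarrow>\<theta>s. \<theta> - t) \<ge> 0" by auto
    show ?thesis
    proof (intro exI[of _ "\<theta> # \<theta>s"] conjI allI impI)
      show "length (\<theta> # \<theta>s) \<le> Suc r" using \<theta>s by simp
      show "set (\<theta> # \<theta>s) \<subseteq> {l..u}" using \<theta>s l\<theta> \<theta>u by auto
      fix t assume t: "l < t" "t < u"
      consider "t < \<theta>" | "t = \<theta>" | "t > \<theta>" by linarith
      then show "0 \<le> \<sigma> * f t * (\<Prod>\<theta>\<leftarrow>\<theta> # \<theta>s. \<theta> - t)"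
      proof cases
        case 1
        have "t \<notin> Z" using 1 cInf_lower[OF _ bdd, of t] by (auto simp: \<theta>_def)
        then have "\<sigma> * f t \<ge> 0" using t by (auto simp: Z_def)
        moreover have "(\<Prod>\<theta>\<leftarrow>\<theta> # \<theta>s. \<theta> - t) \<ge> 0"
          by (rule prod_list_nonneg) (use 1 \<theta>s(2) in auto)
        ultimately show ?thesis by simp
      next
        case 2 then show ?thesis by simp
      next
        case 3
        have "\<sigma> * f t * (\<Prod>\<theta>\<leftarrow>\<theta> # \<theta>s. \<theta> - t) = (t - \<theta>) * (-\<sigma> * f t * (\<Prod>\<theta>\<leftarrow>\<theta>s. \<theta> - t))"
          by (simp add: algebra_simps)
        also have "\<dots> \<ge> 0" by (rule mult_nonneg_nonneg) (use 3 \<theta>s(3)[OF 3 t(2)] in \<open>auto\<close>)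
        finally show ?thesis .
      qed
    qed
  qed
qed

section \<open>Common periods\<close>

text \<open>Siegel's box argument. With X = (4 (d+1) N)^d there are (X+1)^(d+1) coefficient vectors
  with entries in {0..X}, while their images lie in a box with at most (4 (d+1) N X)^d = X^(d+1)
  points; two vectors with the same image are subtracted.\<close>

lemma integer_relation:
  fixes v :: "'a \<Rightarrow> nat \<Rightarrow> int" and N :: int
  assumes fin: "finite I" and card: "card I = Suc d" and N: "N \<ge> 1"
    and v: "\<And>i l. i \<in> I \<Longrightarrow> l < d \<Longrightarrow> \<bar>v i l\<bar> \<le> N"
  shows "\<exists>c. (\<exists>i\<in>I. c i \<noteq> 0) \<and> (\<forall>i\<in>I. \<bar>c i\<bar> \<le> (4 * int (Suc d) * N) ^ d)
           \<and> (\<forall>l<d. (\<Sum>i\<in>I. c i * v i l) = 0)"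
proof -
  define X where "X = (4 * int (Suc d) * N) ^ d"
  have X1: "X \<ge> 1" unfolding X_def using N mult_mono[of 1 "4 * int (Suc d)" 1 N] by (intro one_le_power) auto
  define D where "D = (I \<rightarrow>\<^sub>E {0..X})"
  define b where "b = int (Suc d) * N * X"
  have b0: "b \<ge> 0" unfolding b_def using N X1 by auto
  define T where "T = (({..<d} :: nat set) \<rightarrow>\<^sub>E {-b..b})"
  define g where "g c = restrict (\<lambda>l. \<Sum>i\<in>I. c i * v i l) {..<d}" for c
  have cD: "int (card D) = (X + 1) ^ Suc d"
    using X1 unfolding D_def by (simp add: card_PiE fin card)
  have cT: "int (card T) = (2 * b + 1) ^ d"
    using b0 unfolding T_def by (simp add: card_PiE)
  have finT: "finite T" unfolding T_def by (intro finite_PiE) auto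
  have gT: "g ` D \<subseteq> T"
  proof
    fix y assume "y \<in> g ` D"
    then obtain c where c: "c \<in> D" "y = g c" by auto
    have "\<bar>\<Sum>i\<in>I. c i * v i l\<bar> \<le> b" if l: "l < d" for l
    proof -
      have "\<bar>\<Sum>i\<in>I. c i * v i l\<bar> \<le> (\<Sum>i\<in>I. \<bar>c i * v i l\<bar>)" by (rule sum_abs)
      also have "\<dots> \<le> (\<Sum>i\<in>I. X * N)"
      proof (rule sum_mono)
        fix i assume i: "i \<in> I"
        have "0 \<le> c i" "c i \<le> X" using c(1) i by (auto simp: D_def dest!: PiE_mem)
        then show "\<bar>c i * v i l\<bar> \<le> X * N"
          unfolding abs_mult using v[OF i l] X1 by (intro mult_mono) auto
      qed
      also have "\<dots> = b" by (simp add: card b_def)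
      finally show ?thesis .
    qed
    then show "y \<in> T" by (force simp: c(2) g_def T_def abs_le_iff)
  qed
  have "(2 * b + 1) ^ d < (X + 1) ^ Suc d"
  proof -
    have "2 * b + 1 \<le> (4 * int (Suc d) * N) * X"
    proof -
      have "1 \<le> b" unfolding b_def using N X1 by (metis int_one_le_iff_zero_less less_le_trans mult_pos_pos of_nat_0_less_iff zero_less_Suc zero_less_one)
      then show ?thesis unfolding b_def by (simp add: algebra_simps)
    qed
    then have "(2 * b + 1) ^ d \<le> ((4 * int (Suc d) * N) * X) ^ d"
      using b0 by (intro power_mono) auto
    also have "\<dots> = X * X ^ d" by (simp add: power_mult_distrib X_def)
    also have "\<dots> < (X + 1) ^ Suc d" 
      using X1 power_strict_mono[of X "X + 1" "Suc d"] by simp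
    finally show ?thesis .
  qed
  then have "card T < card D" using cD cT by linarith
  then have "card (g ` D) < card D" using card_mono[OF finT gT] by linarith
  then have "\<not> inj_on g D" by (rule pigeonhole)
  then obtain c c' where c: "c \<in> D" "c' \<in> D" "g c = g c'" "c \<noteq> c'"
    by (auto simp: inj_on_def)
  show ?thesis
  proof (intro exI[of _ "\<lambda>i. c i - c' i"] conjI ballI allI impI)
    show "\<exists>i\<in>I. c i - c' i \<noteq> 0"
      using c PiE_ext[of c I "\<lambda>_. {0..X}" c'] unfolding D_def by force
    fix i assume i: "i \<in> I"
    have "c i \<in> {0..X}" "c' i \<in> {0..X}" using c i by (auto simp: D_def dest!: PiE_mem)
    then show "\<bar>c i - c' i\<bar> \<le> (4 * int (Suc d) * N) ^ d" unfolding X_def[symmetric] by auto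
  next
    fix l assume l: "l < d"
    have "g c l = g c' l" using c by simp
    then show "(\<Sum>i\<in>I. (c i - c' i) * v i l) = 0"
      using l by (simp add: g_def left_diff_distrib sum_subtractf)
  qed
qed

text \<open>If the windows \<open>w\<close> with \<open>\<bar>q \<cdot> w\<bar> < \<delta>\<close> spanned the whole space, a small integer
  relation would express a multiple of the unit vector \<open>e\<^sub>0\<close> through them and force \<open>\<bar>q 0\<bar> < 1\<close>.\<close>

lemma exists_annihilator_mod:
  fixes q :: "nat \<Rightarrow> real" and m N :: int
  assumes m: "prime m" and N: "N \<ge> 1" and q: "\<bar>q 0\<bar> \<ge> 1" and d: "d \<ge> 1"
    and \<delta>: "real d * (4 * real (Suc d) * N) ^ d * \<delta> < 1" "\<delta> > 0"
  shows "\<exists>u::nat \<Rightarrow> int. (\<exists>l<d. \<not> m dvd u l) \<and>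
     (\<forall>w::nat \<Rightarrow> int. (\<forall>l<d. \<bar>w l\<bar> \<le> N) \<and> \<bar>\<Sum>l<d. q l * w l\<bar> < \<delta> \<longrightarrow> m dvd (\<Sum>l<d. u l * w l))"
proof -
  define W where "W = {w \<in> {..<d} \<rightarrow>\<^sub>E {-N..N}. \<bar>\<Sum>l<d. q l * w l\<bar> < \<delta>}"
  have finW: "finite W" unfolding W_def by (rule finite_subset[OF _ finite_PiE[of "{..<d}" "\<lambda>_. {-N..N}"]]) auto
  \<comment> \<open>Linear independence over the field of \<open>m\<close> elements of the first
    \<open>d\<close> coordinates of integer vectors.\<close>
  define indep where "indep B \<longleftrightarrow> (\<forall>c::(nat \<Rightarrow> int) \<Rightarrow> int. (\<forall>l<d. m dvd (\<Sum>w\<in>B. c w * w l)) \<longrightarrow> (\<forall>w\<in>B. m dvd c w))" for B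
  have m1: "m > 1" using m by (simp add: prime_gt_1_int)
  \<comment> \<open>Descent: independence makes every coefficient of an integer relation divisible
    by \<open>m\<close>, the quotients satisfy the same relation, and so every power of
    \<open>m\<close> divides every coefficient. A nonzero coefficient cannot allow that.\<close>
  have smul: "\<exists>w\<in>B. c w \<noteq> 0 \<Longrightarrow> \<forall>l<d. (\<Sum>w\<in>B. c w * w l) = 0 \<Longrightarrow> \<not> indep B" if "finite B" for B c
  proof
    assume 1: "\<exists>w\<in>B. c w \<noteq> 0" "\<forall>l<d. (\<Sum>w\<in>B. c w * w l) = 0" and 2: "indep B"
    have "m ^ n dvd c w" if "w \<in> B" for n w
      using that
    proof (induction n arbitrary: w)
      case (Suc n)
      define c' where "c' w = c w div m ^ n" for w
      have c: "c w = m ^ n * c' w" if "w \<in> B" for w using Suc.IH[OF that] by (simp add: c'_def)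
      have "(\<Sum>w\<in>B. c' w * w l) = 0" if "l < d" for l
      proof -
        have "m ^ n * (\<Sum>w\<in>B. c' w * w l) = (\<Sum>w\<in>B. c w * w l)"
          by (simp add: sum_distrib_left c mult.assoc)
        then show ?thesis using 1 that m1 by simp
      qed
      then have "m dvd c' w" using 2 Suc.prems unfolding indep_def by simp
      then show ?case using c[OF Suc.prems] by (simp add: mult.commute)
    qed simp
    moreover obtain w where w: "w \<in> B" "c w \<noteq> 0" using 1 by blast
    ultimately have "m ^ nat (\<bar>c w\<bar>) dvd c w" by blast
    then have "m ^ nat (\<bar>c w\<bar>) \<le> \<bar>c w\<bar>" using w(2)
      by (metis abs_of_nonneg dvd_imp_le_int m1 less_imp_le zero_le_power order.strict_trans zero_less_one abs_ge_zero)
    moreover have "int (nat \<bar>c w\<bar>) < 2 ^ nat \<bar>c w\<bar>" using of_nat_less_two_power by blast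
    moreover have "(2::int) ^ nat \<bar>c w\<bar> \<le> m ^ nat \<bar>c w\<bar>" using m1 by (intro power_mono) auto
    ultimately show False by linarith
  qed
  have sub: "indep B" if "indep C" "B \<subseteq> C" "finite C" for B C
    unfolding indep_def
  proof (intro allI impI)
    fix c :: "(nat \<Rightarrow> int) \<Rightarrow> int" assume h: "\<forall>l<d. m dvd (\<Sum>w\<in>B. c w * w l)"
    define c' where "c' w = (if w \<in> B then c w else 0)" for w
    have "(\<Sum>w\<in>C. c' w * w l) = (\<Sum>w\<in>B. c w * w l)" for l
      by (rule sum.mono_neutral_cong_right) (use that in \<open>auto simp: c'_def\<close>)
    then have "\<forall>w\<in>C. m dvd c' w" using that(1) h unfolding indep_def by presburger
    then have "m dvd c w" if "w \<in> B" for w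
      using bspec[of C "\<lambda>w. m dvd c' w" w] that \<open>B \<subseteq> C\<close> by (simp add: c'_def subsetD)
    then show "\<forall>w\<in>B. m dvd c w" by blast
  qed
  have small: "card B < d" if B: "B \<subseteq> W" "indep B" for B
  proof (rule ccontr)
    assume "\<not> card B < d"
    then obtain B' where B': "B' \<subseteq> B" "card B' = d" "finite B'"
      by (metis not_less obtain_subset_with_card_n)
    have ind: "indep B'" using sub[OF B(2) B'(1)] B(1) finW by (simp add: finite_subset)
    define e :: "nat \<Rightarrow> int" where "e = (\<lambda>l. if l = 0 then 1 else 0)"
    \<comment> \<open>Indexing by options keeps the unit vector apart from the windows, one of which
      may be equal to it, so that there are exactly \<open>Suc d\<close> vectors.\<close>
    define v where "v i = (case i of None \<Rightarrow> e | Some w \<Rightarrow> w)" for i :: "(nat \<Rightarrow> int) option"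
    define I where "I = insert None (Some ` B')"
    have BW: "\<bar>w l\<bar> \<le> N" if "w \<in> B'" "l < d" for w l
    proof -
      have "w \<in> W" using that(1) B'(1) B(1) by blast
      then have "w \<in> {..<d} \<rightarrow>\<^sub>E {-N..N}" unfolding W_def by simp
      then have "w l \<in> {-N..N}" by (rule PiE_mem) (use that in simp)
      then show ?thesis by auto
    qed
    have fI: "finite I" "card I = Suc d" using B' by (auto simp: I_def card_insert_if card_image)
    have vb: "\<bar>v i l\<bar> \<le> N" if "i \<in> I" "l < d" for i l
      using that(1) BW[OF _ that(2)] N unfolding I_def v_def e_def by (cases i) auto
    have rel: "\<exists>c. (\<exists>i\<in>I. c i \<noteq> 0) \<and> (\<forall>i\<in>I. \<bar>c i\<bar> \<le> (4 * int (Suc d) * N) ^ d)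
           \<and> (\<forall>l<d. (\<Sum>i\<in>I. c i * v i l) = 0)"
      by (rule integer_relation[OF fI N vb])
    obtain c where c: "\<exists>i\<in>I. c i \<noteq> 0" "\<forall>i\<in>I. \<bar>c i\<bar> \<le> (4 * int (Suc d) * N) ^ d"
        "\<forall>l<d. (\<Sum>i\<in>I. c i * v i l) = 0"
      using rel by (elim exE conjE) (rule that)
    have spl: "(\<Sum>i\<in>I. c i * v i l) = c None * e l + (\<Sum>w\<in>B'. c (Some w) * w l)" for l
      unfolding I_def using B'(3) by (simp add: sum.reindex v_def)
    show False
    proof (cases "c None = 0")
      case True
      have "\<exists>w\<in>B'. c (Some w) \<noteq> 0" using c(1) True by (auto simp: I_def)
      moreover have "\<forall>l<d. (\<Sum>w\<in>B'. c (Some w) * w l) = 0" using c(3) spl True by auto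
      ultimately show False using smul[OF B'(3), of "\<lambda>w. c (Some w)"] ind by blast
    next
      case False
      have "c None * e l = - (\<Sum>w\<in>B'. c (Some w) * w l)" if "l < d" for l
        using c(3) spl[of l] that by fastforce
      then have *: "of_int (c None * e l) = - (\<Sum>w\<in>B'. of_int (c (Some w) * w l)::real)" if "l < d" for l
        using that by (metis of_int_minus of_int_sum)
      have "of_int (c None) * q 0 = (\<Sum>l<d. q l * of_int (c None * e l))"
      proof -
        have "(\<Sum>l<d. q l * of_int (c None * e l)) = (\<Sum>l<d. if l = 0 then q 0 * of_int (c None) else 0)"
          by (intro sum.cong) (auto simp: e_def)
        then show ?thesis using d by simp
      qed
      also have "\<dots> = (\<Sum>l<d. - (\<Sum>w\<in>B'. of_int (c (Some w)) * (q l * of_int (w l))))"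
      proof (rule sum.cong[OF refl])
        fix l assume "l \<in> {..<d}"
        then have "l < d" by simp
        show "q l * of_int (c None * e l) = - (\<Sum>w\<in>B'. of_int (c (Some w)) * (q l * of_int (w l)))"
          unfolding *[OF \<open>l < d\<close>] by (simp add: sum_distrib_left mult_ac)
      qed
      also have "\<dots> = - (\<Sum>l<d. \<Sum>w\<in>B'. of_int (c (Some w)) * (q l * of_int (w l)))"
        by (rule sum_negf)
      also have "\<dots> = - (\<Sum>w\<in>B'. of_int (c (Some w)) * (\<Sum>l<d. q l * of_int (w l)))"
        by (subst sum.swap) (simp add: sum_distrib_left)
      finally have eq: "of_int (c None) * q 0 = - (\<Sum>w\<in>B'. of_int (c (Some w)) * (\<Sum>l<d. q l * of_int (w l)))" .
      have "1 \<le> \<bar>real_of_int (c None)\<bar> * \<bar>q 0\<bar>"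
      proof -
        have "1 \<le> \<bar>real_of_int (c None)\<bar>" using False by linarith
        then show ?thesis using q mult_mono[of 1 "\<bar>real_of_int (c None)\<bar>" 1 "\<bar>q 0\<bar>"] by simp
      qed
      also have "\<dots> = \<bar>\<Sum>w\<in>B'. of_int (c (Some w)) * (\<Sum>l<d. q l * of_int (w l))\<bar>"
        by (simp only: abs_mult[symmetric] eq abs_minus_cancel)
      also have "\<dots> \<le> (\<Sum>w\<in>B'. \<bar>of_int (c (Some w)) * (\<Sum>l<d. q l * of_int (w l))\<bar>)" by (rule sum_abs)
      also have "\<dots> \<le> (\<Sum>w\<in>B'. (4 * real (Suc d) * N) ^ d * \<delta>)"
      proof (rule sum_mono)
        fix w assume w: "w \<in> B'"
        have "\<bar>c (Some w)\<bar> \<le> (4 * int (Suc d) * N) ^ d" using c(2) w by (auto simp: I_def)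
        then have "real_of_int \<bar>c (Some w)\<bar> \<le> real_of_int ((4 * int (Suc d) * N) ^ d)" by (simp only: of_int_le_iff)
        then have 1: "\<bar>real_of_int (c (Some w))\<bar> \<le> (4 * real (Suc d) * N) ^ d" by simp
        have "\<bar>\<Sum>l<d. q l * of_int (w l)\<bar> \<le> \<delta>" using w B' B by (force simp: W_def)
        then show "\<bar>of_int (c (Some w)) * (\<Sum>l<d. q l * of_int (w l))\<bar> \<le> (4 * real (Suc d) * N) ^ d * \<delta>"
          unfolding abs_mult using 1 N by (intro mult_mono) auto
      qed
      also have "\<dots> = real d * (4 * real (Suc d) * N) ^ d * \<delta>" by (simp add: B')
      finally show False using \<delta> by linarith
    qed
  qed
  have ex: "\<exists>B. B \<subseteq> W \<and> indep B" by (intro exI[of _ "{}"]) (auto simp: indep_def)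
  obtain B where B: "B \<subseteq> W" "indep B" "\<And>C. C \<subseteq> W \<Longrightarrow> indep C \<Longrightarrow> card C \<le> card B"
    using ex_has_greatest_nat[of "\<lambda>B. B \<subseteq> W \<and> indep B" _ card d] ex small less_imp_le by (metis (lifting))
  have finB: "finite B" using B finW finite_subset by blast
  \<comment> \<open>There are \<open>m ^ d\<close> residue vectors but only
    \<open>m ^ card B\<close> possible value tuples on \<open>B\<close>, and
    \<open>card B < d\<close>; the difference of two vectors with the same tuple annihilates
    \<open>B\<close> and is nonzero modulo \<open>m\<close>.\<close>
  define D where "D = ({..<d} \<rightarrow>\<^sub>E {0..<m})"
  define g where "g u = restrict (\<lambda>w. (\<Sum>l<d. u l * w l) mod m) B" for u
  have "g ` D \<subseteq> B \<rightarrow>\<^sub>E {0..<m}" unfolding g_def using m1 by auto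
  then have "card (g ` D) \<le> card (B \<rightarrow>\<^sub>E {0..<m})" by (intro card_mono finite_PiE finB) auto
  also have "\<dots> = nat m ^ card B" by (simp add: card_PiE finB)
  also have "\<dots> < nat m ^ d" using small[OF B(1,2)] m1 by (intro power_strict_increasing) auto
  also have "\<dots> = card D" by (simp add: D_def card_PiE)
  finally have "\<not> inj_on g D" by (rule pigeonhole)
  then obtain u u' where u: "u \<in> D" "u' \<in> D" "g u = g u'" "u \<noteq> u'" by (auto simp: inj_on_def)
  define z where "z l = u l - u' l" for l
  have zB: "m dvd (\<Sum>l<d. z l * w l)" if "w \<in> B" for w
  proof -
    have "g u w = g u' w" using u by simp
    then have "(\<Sum>l<d. u l * w l) mod m = (\<Sum>l<d. u' l * w l) mod m" using that by (simp add: g_def)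
    then have "m dvd (\<Sum>l<d. u l * w l) - (\<Sum>l<d. u' l * w l)" by (simp add: mod_eq_dvd_iff)
    then show ?thesis by (simp add: z_def left_diff_distrib sum_subtractf)
  qed
  have zW: "m dvd (\<Sum>l<d. z l * w l)" if w: "w \<in> W" for w
  proof (cases "w \<in> B")
    case True then show ?thesis using zB by blast
  next
    case False
    \<comment> \<open>As \<open>B\<close> has maximal size, \<open>w\<close> depends on
      \<open>B\<close> modulo \<open>m\<close>. Its own coefficient in the relation is not divisible
      by \<open>m\<close>, because \<open>B\<close> is independent, so what annihilates
      \<open>B\<close> also annihilates \<open>w\<close>.\<close>
    have "\<not> indep (insert w B)"
    proof
      assume "indep (insert w B)"
      then have "card (insert w B) \<le> card B" using B w by blast
      then show False using False finB by simp
    qed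
    then obtain c x where c: "\<And>l. l < d \<Longrightarrow> m dvd (\<Sum>w\<in>insert w B. c w * w l)"
        and x: "x \<in> insert w B" "\<not> m dvd c x"
      unfolding indep_def by blast
    have c': "m dvd (c w * w l + (\<Sum>w\<in>B. c w * w l))" if "l < d" for l
      using c[OF that] False finB by simp
    have "\<not> m dvd c w"
    proof
      assume a: "m dvd c w"
      have "m dvd (\<Sum>w\<in>B. c w * w l)" if "l < d" for l
        using c'[OF that] a by (simp add: dvd_add_right_iff)
      then have "\<forall>w\<in>B. m dvd c w" using B(2) unfolding indep_def by blast
      then show False using x a by auto
    qed
    moreover have "m dvd c w * (\<Sum>l<d. z l * w l)"
    proof -
      have "m dvd (\<Sum>l<d. z l * (c w * w l + (\<Sum>w\<in>B. c w * w l)))"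
        by (intro dvd_sum dvd_mult c') auto
      also have "(\<Sum>l<d. z l * (c w * w l + (\<Sum>w\<in>B. c w * w l)))
          = c w * (\<Sum>l<d. z l * w l) + (\<Sum>l<d. \<Sum>w\<in>B. c w * (z l * w l))"
        by (simp add: distrib_left sum.distrib sum_distrib_left mult_ac)
      also have "(\<Sum>l<d. \<Sum>w\<in>B. c w * (z l * w l)) = (\<Sum>w\<in>B. c w * (\<Sum>l<d. z l * w l))"
        by (subst sum.swap) (simp add: sum_distrib_left)
      finally have "m dvd c w * (\<Sum>l<d. z l * w l) + (\<Sum>w\<in>B. c w * (\<Sum>l<d. z l * w l))" .
      moreover have "m dvd (\<Sum>w\<in>B. c w * (\<Sum>l<d. z l * w l))"
        by (intro dvd_sum dvd_mult zB)
      ultimately show ?thesis by (simp add: dvd_add_left_iff)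
    qed
    ultimately show ?thesis using m prime_dvd_mult_iff by blast
  qed
  show ?thesis
  proof (intro exI[of _ z] conjI allI impI)
    have "\<exists>l<d. u l \<noteq> u' l" using u PiE_ext[of u "{..<d}" "\<lambda>_. {0..<m}" u'] unfolding D_def by force
    then obtain l where l: "l < d" "u l \<noteq> u' l" by blast
    have "u l \<in> {0..<m}" "u' l \<in> {0..<m}" using u(1,2) l(1) unfolding D_def by (auto dest!: PiE_mem)
    then have "\<not> m dvd z l" using l(2) unfolding z_def
      by (metis atLeastLessThan_iff mod_eq_dvd_iff mod_pos_pos_trivial)
    then show "\<exists>l<d. \<not> m dvd z l" using l by blast
  next
    fix w :: "nat \<Rightarrow> int" assume w: "(\<forall>l<d. \<bar>w l\<bar> \<le> N) \<and> \<bar>\<Sum>l<d. q l * w l\<bar> < \<delta>"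
    have "restrict w {..<d} \<in> W" using w by (force simp: W_def abs_le_iff)
    from zW[OF this] show "m dvd (\<Sum>l<d. z l * w l)" by simp
  qed
qed

text \<open>The recurrence expresses \<open>s n\<close> modulo \<open>m\<close> through the first \<open>h\<close> terms, with a coefficient vector that
  depends on \<open>n\<close> and \<open>u\<close> only; there are at most \<open>m ^ d\<close> such vectors.\<close>

lemma recurrence_common_period:
  fixes m :: int and u :: "nat \<Rightarrow> int"
  assumes m: "prime m" and u: "\<exists>l<d. \<not> m dvd u l"
  shows "\<exists>i p. p \<ge> 1 \<and> i + p \<le> nat m ^ d \<and>
     (\<forall>s::nat \<Rightarrow> int. (\<forall>n\<le>nat m ^ d. m dvd (\<Sum>l<d. u l * s (n + l))) \<longrightarrow> m dvd s (i + p) - s i)"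
proof -
  \<comment> \<open>The last index at which \<open>u\<close> survives modulo \<open>m\<close>: its
    coefficient is invertible, so the relation can be solved for \<open>s (n + h)\<close>, and all
    later coefficients may be dropped.\<close>
  define h where "h = (GREATEST l. l < d \<and> \<not> m dvd u l)"
  have "h < d \<and> \<not> m dvd u h" unfolding h_def
    by (rule GreatestI_ex_nat[where b = d]) (use u in auto)
  then have h: "h < d" "\<not> m dvd u h" by auto
  have hmax: "m dvd u l" if "l < d" "h < l" for l
    using that Greatest_le_nat[of "\<lambda>l. l < d \<and> \<not> m dvd u l" l d] unfolding h_def[symmetric] by fastforce
  have m1: "m > 1" using m by (simp add: prime_gt_1_int)
  have "coprime (u h) m" using h(2) m prime_imp_coprime coprime_commute by blast
  then obtain v v' where "v * u h + v' * m = 1" using bezout_int[of "u h" m] by auto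
  then have "u h * v - 1 = m * (- v')" by (simp add: algebra_simps)
  then have v: "m dvd u h * v - 1" by (rule dvdI)
  define good where "good s \<longleftrightarrow> (\<forall>n\<le>nat m ^ d. m dvd (\<Sum>l<d. u l * s (n + l)))" for s :: "nat \<Rightarrow> int"
  have rec: "m dvd s (n + h) - (\<Sum>l<h. (- v * u l) * s (n + l))" if "good s" "n \<le> nat m ^ d" for s n
  proof -
    have "(\<Sum>l<d. u l * s (n + l)) = (\<Sum>l<Suc h. u l * s (n + l)) + (\<Sum>l\<in>{Suc h..<d}. u l * s (n + l))"
      unfolding lessThan_atLeast0 by (rule sum.atLeastLessThan_concat[symmetric]) (use h(1) in simp_all)
    moreover have "m dvd (\<Sum>l<d. u l * s (n + l))" using that unfolding good_def by blast
    moreover have "m dvd (\<Sum>l\<in>{Suc h..<d}. u l * s (n + l))"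
      by (intro dvd_sum dvd_mult2 hmax) auto
    ultimately have "m dvd (\<Sum>l<Suc h. u l * s (n + l))" by (simp add: dvd_add_left_iff del: sum.lessThan_Suc)
    then have "m dvd (\<Sum>l<h. u l * s (n + l)) + u h * s (n + h)" by simp
    then have 1: "m dvd v * ((\<Sum>l<h. u l * s (n + l)) + u h * s (n + h))" by (rule dvd_mult)
    have 2: "m dvd (u h * v - 1) * s (n + h)" using v by (rule dvd_mult2)
    have "m dvd v * ((\<Sum>l<h. u l * s (n + l)) + u h * s (n + h)) - (u h * v - 1) * s (n + h)"
      using 1 2 by (rule dvd_diff)
    also have "\<dots> = s (n + h) - (\<Sum>l<h. (- v * u l) * s (n + l))"
      by (simp add: algebra_simps sum_distrib_left sum_negf)
    finally show ?thesis .
  qed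
  have "\<exists>\<rho>. \<rho> \<in> {..<h} \<rightarrow>\<^sub>E {0..<m} \<and> (\<forall>s. good s \<longrightarrow> m dvd s n - (\<Sum>l<h. \<rho> l * s l))"
    if "n \<le> nat m ^ d" for n
    using that
  proof (induction n rule: less_induct)
    case (less n)
    show ?case
    proof (cases "n < h")
      case True
      define \<rho> :: "nat \<Rightarrow> int" where "\<rho> = restrict (\<lambda>l. if l = n then 1 else 0) {..<h}"
      have "(\<Sum>l<h. \<rho> l * s l) = s n" for s :: "nat \<Rightarrow> int"
      proof -
        have "(\<Sum>l<h. \<rho> l * s l) = (\<Sum>l<h. if l = n then s n else 0)"
          by (intro sum.cong) (auto simp: \<rho>_def)
        then show ?thesis using True by simp
      qed
      moreover have "\<rho> \<in> {..<h} \<rightarrow>\<^sub>E {0..<m}" using m1 by (simp add: \<rho>_def restrict_PiE_iff)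
      ultimately show ?thesis by (intro exI[of _ \<rho>]) auto
    next
      case False
      define n' where "n' = n - h"
      have n': "n = n' + h" "n' \<le> nat m ^ d" using False less.prems by (auto simp: n'_def)
      have "\<forall>l\<in>{..<h}. \<exists>\<rho>. (\<forall>s. good s \<longrightarrow> m dvd s (n' + l) - (\<Sum>j<h. \<rho> j * s j))"
        using less.IH less.prems n' by (metis add_less_cancel_left lessThan_iff less_imp_le order_trans)
      then obtain R where R: "\<And>l s. l < h \<Longrightarrow> good s \<Longrightarrow> m dvd s (n' + l) - (\<Sum>j<h. R l j * s j)"
        by (metis lessThan_iff bchoice)
      define \<rho> where "\<rho> = restrict (\<lambda>j. (\<Sum>l<h. (- v * u l) * R l j) mod m) {..<h}"
      have "m dvd s n - (\<Sum>l<h. \<rho> l * s l)" if s: "good s" for s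
      proof -
        have 1: "m dvd s n - (\<Sum>l<h. (- v * u l) * s (n' + l))" using rec[OF s n'(2)] n'(1) by simp
        have 2: "m dvd (\<Sum>l<h. (- v * u l) * (s (n' + l) - (\<Sum>j<h. R l j * s j)))"
          by (intro dvd_sum dvd_mult R s) auto
        have 3: "m dvd (\<Sum>j<h. ((\<Sum>l<h. (- v * u l) * R l j) - \<rho> j) * s j)"
          by (intro dvd_sum dvd_mult2) (simp add: \<rho>_def dvd_minus_mod)
        have "(\<Sum>l<h. (- v * u l) * (\<Sum>j<h. R l j * s j)) = (\<Sum>j<h. (\<Sum>l<h. (- v * u l) * R l j) * s j)"
          unfolding sum_distrib_left sum_distrib_right by (subst sum.swap) (simp add: mult_ac)
        then have "s n - (\<Sum>l<h. \<rho> l * s l) = (s n - (\<Sum>l<h. (- v * u l) * s (n' + l)))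
            + (\<Sum>l<h. (- v * u l) * (s (n' + l) - (\<Sum>j<h. R l j * s j)))
            + (\<Sum>j<h. ((\<Sum>l<h. (- v * u l) * R l j) - \<rho> j) * s j)"
          by (simp only: right_diff_distrib left_diff_distrib sum_subtractf)
        then show ?thesis using 1 2 3 by (simp only: dvd_add)
      qed
      moreover have "\<rho> \<in> {..<h} \<rightarrow>\<^sub>E {0..<m}" using m1 by (simp add: \<rho>_def restrict_PiE_iff)
      ultimately show ?thesis by blast
    qed
  qed
  then obtain \<rho> where \<rho>: "\<And>n. n \<le> nat m ^ d \<Longrightarrow> \<rho> n \<in> {..<h} \<rightarrow>\<^sub>E {0..<m}"
     "\<And>n s. n \<le> nat m ^ d \<Longrightarrow> good s \<Longrightarrow> m dvd s n - (\<Sum>l<h. \<rho> n l * s l)"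
    by metis
  have "\<rho> ` {..nat m ^ d} \<subseteq> {..<h} \<rightarrow>\<^sub>E {0..<m}" using \<rho>(1) by auto
  then have "card (\<rho> ` {..nat m ^ d}) \<le> card (({..<h} :: nat set) \<rightarrow>\<^sub>E {0..<m})"
    by (intro card_mono finite_PiE) auto
  also have "\<dots> = nat m ^ h" by (simp add: card_PiE)
  also have "\<dots> \<le> nat m ^ d" using h m1 by (intro power_increasing) auto
  also have "\<dots> < card {..nat m ^ d}" by simp
  finally have "\<not> inj_on \<rho> {..nat m ^ d}" by (rule pigeonhole)
  then obtain a b where ab: "a < b" "b \<le> nat m ^ d" "\<rho> a = \<rho> b"
    unfolding inj_on_def by (metis (full_types) atMost_iff linorder_neqE_nat)
  show ?thesis
  proof (rule exI[of _ a], rule exI[of _ "b - a"], intro conjI allI impI)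
    show "1 \<le> b - a" "a + (b - a) \<le> nat m ^ d" using ab by auto
    fix s :: "nat \<Rightarrow> int" assume "\<forall>n\<le>nat m ^ d. m dvd (\<Sum>l<d. u l * s (n + l))"
    then have s: "good s" by (simp add: good_def)
    have "m dvd (s b - (\<Sum>l<h. \<rho> b l * s l)) - (s a - (\<Sum>l<h. \<rho> a l * s l))"
      by (rule dvd_diff; rule \<rho>(2)[OF _ s]; use ab in simp)
    then show "m dvd s (a + (b - a)) - s a" using ab by simp
  qed
qed

text \<open>Since \<open>a\<close> and its differences are small compared to \<open>m\<close>, congruences modulo \<open>m\<close> are equalities. If the
  difference sequence itself were \<open>p\<close>-periodic and nonzero on a long stretch, \<open>a\<close> would grow linearly.\<close>

lemma uniform_period:
  fixes q :: "nat \<Rightarrow> real" and m M :: int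
  assumes m: "prime m" "m > 4 * M" and M: "M \<ge> 1" and q: "\<bar>q 0\<bar> \<ge> 1" and d: "d \<ge> 1"
    and \<delta>: "real d * (8 * real (Suc d) * M) ^ d * \<delta> < 1" "\<delta> > 0"
  shows "\<exists>p. 1 \<le> p \<and> p \<le> m ^ d \<and> (\<forall>a::int \<Rightarrow> int. (\<forall>x. \<bar>a x\<bar> \<le> M) \<longrightarrow>
     (\<forall>x. a (x - p) \<noteq> a x \<longrightarrow> (\<exists>j. \<bar>j - x\<bar> \<le> (2 * M + 1) * m ^ d \<and>
        \<bar>\<Sum>l<d. q l * of_int (a (j - int l - p) - a (j - int l))\<bar> \<ge> \<delta>)))"
proof -
  \<comment> \<open>The windows are those of the difference sequence, with entries up to
    \<open>2 * M\<close>; hence the 8 in the assumption on \<open>\<delta>\<close>.\<close>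
  have "real d * (4 * real (Suc d) * real_of_int (2 * M)) ^ d * \<delta> < 1" using \<delta>(1) by (simp add: mult_ac)
  from exists_annihilator_mod[where N = "2 * M" and q = q and m = m, OF m(1) _ q d this \<delta>(2)] M obtain u :: "nat \<Rightarrow> int" where
    u: "\<exists>l<d. \<not> m dvd u l"
    and uW: "\<And>w. (\<forall>l<d. \<bar>w l\<bar> \<le> 2 * M) \<Longrightarrow> \<bar>\<Sum>l<d. q l * of_int (w l)\<bar> < \<delta> \<Longrightarrow> m dvd (\<Sum>l<d. u l * w l)"
    by auto
  from recurrence_common_period[OF m(1) u] obtain i p where ip: "p \<ge> 1" "i + p \<le> nat m ^ d"
    and per: "\<And>s::nat \<Rightarrow> int. (\<And>n. n \<le> nat m ^ d \<Longrightarrow> m dvd (\<Sum>l<d. u l * s (n + l))) \<Longrightarrow> m dvd s (i + p) - s i"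
    by auto
  have m0: "m > 0" using m by (simp add: prime_gt_0_int)
  define K where "K = m ^ d"
  have K: "int (nat m ^ d) = K" using m0 by (simp add: K_def)
  have ipK: "int i + int p \<le> K" using ip(2) K by linarith
  show ?thesis
  proof (rule exI[of _ "int p"], intro conjI allI impI)
    show "1 \<le> int p" "int p \<le> m ^ d" using ip ipK by (auto simp: K_def)
  next
    fix a :: "int \<Rightarrow> int" and x
    assume a: "\<forall>x. \<bar>a x\<bar> \<le> M" and x: "a (x - int p) \<noteq> a x"
    define A where "A y = a (y - int p) - a y" for y
    have A: "\<bar>A y\<bar> \<le> 2 * M" for y
    proof -
      have "\<bar>a (y - int p)\<bar> \<le> M" "\<bar>a y\<bar> \<le> M" using a by blast+
      then show ?thesis unfolding A_def by linarith
    qed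
    show "\<exists>j. \<bar>j - x\<bar> \<le> (2 * M + 1) * m ^ d \<and>
        \<bar>\<Sum>l<d. q l * of_int (a (j - int l - int p) - a (j - int l))\<bar> \<ge> \<delta>"
    proof (rule ccontr)
      assume "\<not> ?thesis"
      then have sm: "\<bar>\<Sum>l<d. q l * of_int (A (j - int l))\<bar> < \<delta>" if "\<bar>j - x\<bar> \<le> (2 * M + 1) * K" for j
        using that unfolding A_def K_def by (meson not_le)
      have step: "A (y - int p) = A y" if y: "x - 2 * M * int p \<le> y" "y \<le> x" for y
      proof -
        \<comment> \<open>Read downwards from \<open>y + i\<close>, the sequence \<open>A\<close>
          has \<open>A y\<close> at position \<open>i\<close> and \<open>A (y - p)\<close> at
          position \<open>i + p\<close>.\<close>
        define x0 where "x0 = y + int i"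
        define s where "s n = A (x0 - int n)" for n
        have "m dvd (\<Sum>l<d. u l * s (n + l))" if n: "n \<le> nat m ^ d" for n
        proof -
          have "int n \<le> K" using n K by linarith
          have "2 * M * int p \<le> 2 * M * K" using ipK M by (intro mult_left_mono) auto
          moreover have "0 \<le> 2 * M * int p" "(2 * M + 1) * K = 2 * M * K + K" using M by (auto simp: algebra_simps)
          ultimately have "\<bar>x0 - int n - x\<bar> \<le> (2 * M + 1) * K"
            using \<open>int n \<le> K\<close> y ipK unfolding x0_def by linarith
          from sm[OF this] have "m dvd (\<Sum>l<d. u l * A (x0 - int n - int l))"
            by (intro uW) (use A in auto)
          then show ?thesis by (simp add: s_def algebra_simps)
        qed
        from per[OF this] have "m dvd s (i + p) - s i" by blast
        moreover have "s (i + p) = A (y - int p)" "s i = A y" by (simp_all add: s_def x0_def)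
        ultimately have "m dvd A (y - int p) - A y" by simp
        moreover have "\<bar>A (y - int p) - A y\<bar> < m" using A[of y] A[of "y - int p"] m by linarith
        ultimately show ?thesis using dvd_imp_le_int[of "A (y - int p) - A y" m] by linarith
      qed
      have const: "A (x - int c * int p) = A x" if "int c \<le> 2 * M + 1" for c
        using that
      proof (induction c)
        case (Suc c)
        have "int c * int p \<le> 2 * M * int p" using Suc.prems by (intro mult_right_mono) auto
        then have "A (x - int c * int p - int p) = A (x - int c * int p)"
          by (intro step) auto
        then show ?case using Suc by (simp add: algebra_simps)
      qed simp
      \<comment> \<open>With constant difference, \<open>2 * M + 1\<close> steps move
        \<open>a\<close> by more than \<open>2 * M\<close>, the largest change that the bound on
        \<open>a\<close> permits. This is the origin of the factor \<open>2 * M + 1\<close> in the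
        radius.\<close>
      have tel: "a (x - int c * int p) - a x = int c * A x" if "int c \<le> 2 * M + 1" for c
        using that
      proof (induction c)
        case (Suc c)
        have "A (x - int c * int p) = a (x - int c * int p - int p) - a (x - int c * int p)" by (simp add: A_def)
        then show ?case using Suc const[of c] by (simp add: algebra_simps)
      qed simp
      have "(2 * M + 1) * 1 \<le> (2 * M + 1) * \<bar>A x\<bar>"
        by (rule mult_left_mono) (use M x in \<open>auto simp: A_def\<close>)
      also have "\<dots> = \<bar>a (x - (2 * M + 1) * int p) - a x\<bar>"
        using tel[of "nat (2 * M + 1)"] M by (simp add: abs_mult)
      also have "\<dots> \<le> 2 * M"
      proof -
        have "\<bar>a (x - (2 * M + 1) * int p)\<bar> \<le> M" "\<bar>a x\<bar> \<le> M" using a by blast+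
        then show ?thesis by linarith
      qed
      finally show False by simp
    qed
  qed
qed

section \<open>A Littlewood-type inequality\<close>

definition circle_mean :: "(real \<Rightarrow> 'a::euclidean_space) \<Rightarrow> 'a" where
  "circle_mean f = integral {0..2*pi} f /\<^sub>R (2 * pi)"

lemma circle_mean_add:
  assumes "continuous_on UNIV f" "continuous_on UNIV g"
  shows "circle_mean (\<lambda>t. f t + g t) = circle_mean f + circle_mean g"
proof -
  have "f integrable_on {0..2*pi}" "g integrable_on {0..2*pi}"
    using assms by (auto intro!: integrable_continuous_interval intro: continuous_on_subset)
  then show ?thesis by (simp add: circle_mean_def integral_add scaleR_add_right)
qed

lemma circle_mean_diff:
  assumes "continuous_on UNIV f" "continuous_on UNIV g"
  shows "circle_mean (\<lambda>t. f t - g t) = circle_mean f - circle_mean g"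
proof -
  have "f integrable_on {0..2*pi}" "g integrable_on {0..2*pi}"
    using assms by (auto intro!: integrable_continuous_interval intro: continuous_on_subset)
  then show ?thesis by (simp add: circle_mean_def integral_diff scaleR_diff_right)
qed

lemma circle_mean_linear:
  assumes "bounded_linear h" "continuous_on UNIV f"
  shows "circle_mean (\<lambda>t. h (f t)) = h (circle_mean f)"
proof -
  have "f integrable_on {0..2*pi}"
    using assms by (auto intro!: integrable_continuous_interval intro: continuous_on_subset)
  then have "integral {0..2*pi} (h \<circ> f) = h (integral {0..2*pi} f)"
    using integral_linear assms(1) by blast
  then show ?thesis by (simp add: circle_mean_def o_def linear_scale bounded_linear.linear[OF assms(1)])
qed

lemma circle_mean_cmult:
  fixes f :: "real \<Rightarrow> 'a::{euclidean_space, real_normed_algebra}"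
  assumes "continuous_on UNIV f"
  shows "circle_mean (\<lambda>t. c * f t) = c * circle_mean f"
  by (rule circle_mean_linear[OF bounded_linear_mult_right assms])

lemma circle_mean_const [simp]: "circle_mean (\<lambda>_. c) = c"
  by (simp add: circle_mean_def)

lemma circle_mean_sum:
  assumes "finite I" "\<And>i. i \<in> I \<Longrightarrow> continuous_on UNIV (f i)"
  shows "circle_mean (\<lambda>t. \<Sum>i\<in>I. f i t) = (\<Sum>i\<in>I. circle_mean (f i))"
  using assms
proof (induction I rule: finite_induct)
  case (insert i I)
  then show ?case by (simp add: circle_mean_add continuous_on_sum)
qed simp

lemma circle_mean_mono:
  fixes f g :: "real \<Rightarrow> real"
  assumes "continuous_on UNIV f" "continuous_on UNIV g" "\<And>t. f t \<le> g t"
  shows "circle_mean f \<le> circle_mean g"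
proof -
  have "f integrable_on {0..2*pi}" "g integrable_on {0..2*pi}"
    using assms by (auto intro!: integrable_continuous_interval intro: continuous_on_subset)
  then have "integral {0..2*pi} f \<le> integral {0..2*pi} g" using assms(3) by (intro integral_le) auto
  then show ?thesis by (simp add: circle_mean_def divide_right_mono)
qed

lemma norm_circle_mean_le:
  assumes "continuous_on UNIV f"
  shows "norm (circle_mean f) \<le> circle_mean (\<lambda>t. norm (f t))"
proof -
  have "f integrable_on {0..2*pi}" "(\<lambda>t. norm (f t)) integrable_on {0..2*pi}"
    using assms by (auto intro!: integrable_continuous_interval continuous_on_norm intro: continuous_on_subset)
  then have "norm (integral {0..2*pi} f) \<le> integral {0..2*pi} (\<lambda>t. norm (f t))"
    by (intro integral_norm_bound_integral) auto
  then show ?thesis by (simp add: circle_mean_def divide_right_mono)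
qed

text \<open>Cauchy's integral formula at the centre. It is how nonnegative spectrum is exploited
  below: the mean of a product of functions analytic in \<open>cis t\<close> is the product of their
  values at 0.\<close>

lemma circle_mean_holomorphic:
  assumes "g holomorphic_on UNIV"
  shows "circle_mean (\<lambda>t. g (cis t)) = g 0"
proof -
  have "((\<lambda>u. g u / (u - 0)) has_contour_integral (2 * of_real pi * \<i> * g 0)) (circlepath 0 1)"
    by (rule Cauchy_integral_circlepath_simple) (auto intro: holomorphic_on_subset[OF assms])
  then have "((\<lambda>t. g (0 + 1 * exp (\<i> * of_real t)) / (0 + 1 * exp (\<i> * of_real t) - 0) * 1 * \<i> * exp (\<i> * of_real t))
      has_integral (2 * of_real pi * \<i> * g 0)) {0..2*pi}"
    unfolding circlepath_def by (subst (asm) has_contour_integral_part_circlepath_iff) (auto simp: mult_ac cis_conv_exp)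
  then have "((\<lambda>t. \<i> * g (cis t)) has_integral (\<i> * (2 * of_real pi * g 0))) {0..2*pi}"
    by (simp add: cis_conv_exp[symmetric] mult_ac)
  then have "((\<lambda>t. -\<i> * (\<i> * g (cis t))) has_integral (-\<i> * (\<i> * (2 * of_real pi * g 0)))) {0..2*pi}"
    by (rule has_integral_mult_right)
  then have "((\<lambda>t. g (cis t)) has_integral (2 * of_real pi * g 0)) {0..2*pi}"
    by (simp add: mult.assoc[symmetric])
  then show ?thesis by (simp add: circle_mean_def integral_unique scaleR_conv_of_real field_simps)
qed

lemma circle_mean_cis_int:
  "circle_mean (\<lambda>t. cis (of_int k * t)) = (if k = 0 then 1 else 0)"
proof -
  have pos: "circle_mean (\<lambda>t. cis (real n * t)) = 0" if "n > 0" for n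
  proof -
    have "circle_mean (\<lambda>t. cis t ^ n) = 0 ^ n"
      by (rule circle_mean_holomorphic) (intro holomorphic_intros)
    then show ?thesis using that unfolding Complex.DeMoivre by (simp add: zero_power)
  qed
  consider "k = 0" | "k > 0" | "k < 0" by linarith
  then show ?thesis
  proof cases
    case 2
    then show ?thesis using pos[of "nat k"] by simp
  next
    case 3
    have "circle_mean (\<lambda>t. cnj (cis (of_int (-k) * t))) = cnj (circle_mean (\<lambda>t. cis (of_int (-k) * t)))"
      by (rule circle_mean_linear[OF bounded_linear_cnj]) (intro continuous_intros)
    then show ?thesis using pos[of "nat (-k)"] 3 by (simp add: cis_cnj)
  qed (simp)
qed

text \<open>The mean of \<open>g\<^sup>2\<close> is \<open>(g 0)\<^sup>2 \<ge> 0\<close>, so the imaginary part of \<open>g\<close> is dominated by the real part in mean square.\<close>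

lemma circle_mean_norm2_holomorphic:
  assumes g: "g holomorphic_on UNIV" and g0: "g 0 \<in> \<real>" and u: "\<And>t. Re (g (cis t)) = u t"
  shows "circle_mean (\<lambda>t. (norm (g (cis t)))\<^sup>2) \<le> 2 * circle_mean (\<lambda>t. (u t)\<^sup>2)"
proof -
  have cg: "continuous_on UNIV (\<lambda>t. g (cis t))"
    by (rule continuous_on_compose2[OF holomorphic_on_imp_continuous_on[OF g]]) (auto intro: continuous_intros)
  have cu: "continuous_on UNIV u" unfolding u[symmetric] by (intro continuous_intros cg)
  have eq: "(norm (g (cis t)))\<^sup>2 = 2 * (u t)\<^sup>2 - Re ((g (cis t))\<^sup>2)" for t
    by (simp only: u[symmetric] cmod_power2) (simp add: power2_eq_square)
  have "circle_mean (\<lambda>t. (norm (g (cis t)))\<^sup>2) = 2 * circle_mean (\<lambda>t. (u t)\<^sup>2) - circle_mean (\<lambda>t. Re ((g (cis t))\<^sup>2))"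
    unfolding eq by (subst circle_mean_diff) (auto intro!: continuous_intros cg cu circle_mean_cmult)
  also have "circle_mean (\<lambda>t. Re ((g (cis t))\<^sup>2)) = Re (circle_mean (\<lambda>t. (g (cis t))\<^sup>2))"
    by (rule circle_mean_linear[OF bounded_linear_Re]) (intro continuous_intros cg)
  also have "circle_mean (\<lambda>t. (g (cis t))\<^sup>2) = (g 0)\<^sup>2"
    by (rule circle_mean_holomorphic[of "\<lambda>z. (g z)\<^sup>2"]) (intro holomorphic_intros g)
  also have "Re ((g 0)\<^sup>2) = (Re (g 0))\<^sup>2" using g0 by (auto elim!: Reals_cases)
  finally show ?thesis by simp
qed

lemma continuous_on_holomorphic_cis:
  assumes "g holomorphic_on UNIV"
  shows "continuous_on UNIV (\<lambda>t. g (cis t))"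
  by (rule continuous_on_compose2[OF holomorphic_on_imp_continuous_on[OF assms]]) (auto intro: continuous_intros)

lemma cmod_square_eq_Re: "(norm z)\<^sup>2 = Re (z * cnj z)" for z :: complex
  by (simp add: complex_norm_square[symmetric] del: of_real_power)

section \<open>Ingredients of the test function\<close>

lemma norm_exp_minus_one_le:
  fixes z :: complex
  assumes "Re z \<ge> 0"
  shows "norm (exp (-z) - 1) \<le> norm z"
proof -
  have "norm (exp (-z) - exp (-0)) \<le> 1 * norm (z - 0)"
  proof (rule field_differentiable_bound[where S = "{z. Re z \<ge> 0}" and f' = "\<lambda>z. - exp (-z)"])
    show "convex {z. Re z \<ge> 0}" by (rule convex_halfspace_Re_ge)
    show "((\<lambda>z. exp (-z)) has_field_derivative - exp (-w)) (at w within {z. 0 \<le> Re z})" for w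
      by (auto intro!: derivative_eq_intros)
  qed (use assms in auto)
  then show ?thesis by simp
qed

lemma exp_minus_le: "exp (-s) \<le> 1 - s / 2" if "0 \<le> s" "s \<le> 1" for s :: real
proof -
  have "exp (-s) = inverse (exp s)" by (rule exp_minus)
  also have "\<dots> \<le> inverse (1 + s)" using that by (intro le_imp_inverse_le) auto
  also have "\<dots> \<le> 1 - s / 2"
  proof -
    have "s * s \<le> s" using that mult_left_le by blast
    then have "1 \<le> (1 - s / 2) * (1 + s)" by (simp add: algebra_simps)
    then show ?thesis using that by (simp add: inverse_eq_divide pos_divide_le_eq)
  qed
  finally show ?thesis .
qed

text \<open>If C bounds the current value and x is the norm of the new term, the damping gains about
  C \<eta> x^2 / 2, and x is at most C \<eta> x^2 / 2 + 1 / (2 \<eta> C) by completing a square. So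
  a step raises the bound by at most 1 / (2 \<eta> C) instead of x. The starting value
  \<open>D\<close> is free and serves to balance the two summands.\<close>

lemma damped_recursion_bound:
  fixes \<phi> f e :: "nat \<Rightarrow> complex"
  assumes "\<phi> 0 = 0" and "\<And>j. j < J \<Longrightarrow> \<phi> (Suc j) = \<phi> j * e j + f j"
    and e: "\<And>j. j < J \<Longrightarrow> norm (e j) = exp (- \<eta> * (norm (f j))\<^sup>2)"
    and f: "\<And>j. j < J \<Longrightarrow> norm (f j) \<le> 1"
    and \<eta>: "0 < \<eta>" "\<eta> \<le> 1" and D: "D > 0" and "j \<le> J"
  shows "norm (\<phi> j) \<le> D + real j / (2 * \<eta> * D)"
  using \<open>j \<le> J\<close>
proof (induction j)
  case (Suc j)
  define C where "C = D + real j / (2 * \<eta> * D)"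
  define x where "x = norm (f j)"
  have x: "0 \<le> x" "x \<le> 1" using f Suc.prems by (auto simp: x_def)
  have C: "C \<ge> D" "C > 0" using D \<eta> by (auto simp: C_def intro!: add_pos_nonneg)
  have \<eta>x: "0 \<le> \<eta> * x\<^sup>2" "\<eta> * x\<^sup>2 \<le> 1"
    using \<eta> x by (auto intro!: mult_le_one power_le_one)
  have "norm (\<phi> (Suc j)) \<le> norm (\<phi> j) * exp (- \<eta> * x\<^sup>2) + x"
    using assms(2)[of j] e[of j] Suc.prems norm_triangle_ineq[of "\<phi> j * e j" "f j"] by (simp add: norm_mult x_def)
  also have "\<dots> \<le> C * (1 - \<eta> * x\<^sup>2 / 2) + x"
    using Suc C exp_minus_le[OF \<eta>x] \<eta>x unfolding C_def[symmetric] by (intro add_right_mono mult_mono) auto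
  finally have 1: "norm (\<phi> (Suc j)) \<le> C * (1 - \<eta> * x\<^sup>2 / 2) + x" .
  have 2: "x \<le> C * (\<eta> * x\<^sup>2 / 2) + 1 / (2 * \<eta> * C)"
  proof -
    have "0 \<le> (C * \<eta> * x - 1)\<^sup>2 / (2 * \<eta> * C)" using C \<eta> by auto
    also have "\<dots> = C * (\<eta> * x\<^sup>2 / 2) + 1 / (2 * \<eta> * C) - x" using C(2) \<eta>(1)
      by (simp add: power2_eq_square field_simps)
    finally show ?thesis by simp
  qed
  have 3: "1 / (2 * \<eta> * C) \<le> 1 / (2 * \<eta> * D)"
    using C D \<eta> by (intro divide_left_mono mult_left_mono) auto
  have "norm (\<phi> (Suc j)) \<le> C + 1 / (2 * \<eta> * D)" using 1 2 3 unfolding right_diff_distrib by linarith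
  then show ?case by (simp add: C_def add_divide_distrib)
qed (use assms D in auto)

text \<open>In the expansion of the squared norm the pairs with y < y' and their mirror images have
  conjugate terms. Keeping twice the half with positive frequencies therefore preserves the real
  part and yields a polynomial in \<open>cis t\<close>; the diagonal gives \<open>H 0\<close>, the
  mean of the squared norm of \<open>F\<close>.\<close>

lemma square_as_real_part:
  fixes Y :: "int set" and s :: "int \<Rightarrow> real"
  assumes Y: "finite Y" "card Y = c" "c > 0" and s: "\<And>y. y \<in> Y \<Longrightarrow> s y * s y = 1"
  defines "F \<equiv> \<lambda>t. (\<Sum>y\<in>Y. of_real (s y) * cis (- of_int y * t)) / of_nat c"
  obtains H where "H holomorphic_on UNIV" "H 0 = 1 / of_nat c" "\<And>t. Re (H (cis t)) = (norm (F t))\<^sup>2"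
proof -
  define P where "P = {(y, y'). y \<in> Y \<and> y' \<in> Y \<and> y < y'}"
  have finP: "finite P" by (rule finite_subset[of _ "Y \<times> Y"]) (auto simp: P_def Y)
  define H where "H w = (of_nat c + 2 * (\<Sum>(y,y')\<in>P. of_real (s y * s y') * w ^ nat (y' - y))) / (of_nat c)\<^sup>2" for w :: complex
  show ?thesis
  proof
    show "H holomorphic_on UNIV" unfolding H_def case_prod_unfold using Y(3) by (intro holomorphic_intros) auto
    have "(\<Sum>(y,y')\<in>P. of_real (s y * s y') * (0::complex) ^ nat (y' - y)) = 0"
      by (intro sum.neutral) (auto simp: P_def zero_power)
    then show "H 0 = 1 / of_nat c" unfolding H_def using Y(3) by (simp add: power2_eq_square)
    fix t
    define k where "k = (\<lambda>(y, y'). s y * s y' * cos (of_int (y' - y) * t))"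
    have "(real c)\<^sup>2 * (norm (F t))\<^sup>2 = (norm (\<Sum>y\<in>Y. of_real (s y) * cis (- of_int y * t)))\<^sup>2"
      using Y(3) by (simp add: F_def norm_divide power_divide)
    also have "\<dots> = Re ((\<Sum>y\<in>Y. of_real (s y) * cis (- of_int y * t)) * cnj (\<Sum>y\<in>Y. of_real (s y) * cis (- of_int y * t)))"
      by (rule cmod_square_eq_Re)
    also have "\<dots> = (\<Sum>(y,y')\<in>Y \<times> Y. s y * s y' * cos (of_int (y' - y) * t))"
    proof -
      have "(\<Sum>y\<in>Y. of_real (s y) * cis (- of_int y * t)) * cnj (\<Sum>y\<in>Y. of_real (s y) * cis (- of_int y * t))
        = (\<Sum>(y,y')\<in>Y \<times> Y. of_real (s y * s y') * cis (of_int (y' - y) * t))"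
      proof -
        have "cis (of_int (y' - y) * t) = cis (- of_int y * t) * cis (of_int y' * t)" for y y'
          by (simp add: cis_mult algebra_simps)
        then show ?thesis by (simp add: cis_cnj sum_product sum.cartesian_product[symmetric] mult_ac)
            (subst sum.swap, simp add: mult_ac)
      qed
      then show ?thesis by (simp add: case_prod_unfold)
    qed
    also have "\<dots> = sum k (Y \<times> Y)" by (simp add: k_def)
    also have "Y \<times> Y = (\<lambda>y. (y, y)) ` Y \<union> (P \<union> prod.swap ` P)"
      by (auto simp: P_def image_iff)
    also have "sum k \<dots> = sum k ((\<lambda>y. (y, y)) ` Y) + (sum k P + sum k (prod.swap ` P))"
    proof -
      have "sum k (P \<union> prod.swap ` P) = sum k P + sum k (prod.swap ` P)"
        by (rule sum.union_disjoint) (use finP in \<open>auto simp: P_def\<close>)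
      moreover have "sum k ((\<lambda>y. (y, y)) ` Y \<union> (P \<union> prod.swap ` P)) = sum k ((\<lambda>y. (y, y)) ` Y) + sum k (P \<union> prod.swap ` P)"
        by (rule sum.union_disjoint) (use Y finP in \<open>auto simp: P_def\<close>)
      ultimately show ?thesis by simp
    qed
    also have "sum k ((\<lambda>y. (y, y)) ` Y) = real c"
      using Y s by (subst sum.reindex) (auto simp: inj_on_def k_def)
    also have "sum k (prod.swap ` P) = sum k P"
    proof (subst sum.reindex)
      have "cos ((real_of_int y - real_of_int y') * t) = cos ((real_of_int y' - real_of_int y) * t)" for y y'
        by (metis cos_minus minus_diff_eq minus_mult_left)
      then show "sum (k \<circ> prod.swap) P = sum k P"
        by (intro sum.cong) (auto simp: k_def mult_ac)
    qed auto
    also have "sum k P = (\<Sum>(y,y')\<in>P. Re (of_real (s y * s y') * cis t ^ nat (y' - y)))"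
      by (intro sum.cong) (auto simp: k_def P_def Complex.DeMoivre)
    also have "\<dots> = Re (\<Sum>(y,y')\<in>P. of_real (s y * s y') * cis t ^ nat (y' - y))"
      by (simp add: case_prod_unfold)
    finally have "(real c)\<^sup>2 * (norm (F t))\<^sup>2 = real c + 2 * Re (\<Sum>(y,y')\<in>P. of_real (s y * s y') * cis t ^ nat (y' - y))"
      by simp
    moreover have "Re (H (cis t)) = (real c + 2 * Re (\<Sum>(y,y')\<in>P. of_real (s y * s y') * cis t ^ nat (y' - y))) / (real c)\<^sup>2"
    proof -
      have "(of_nat c :: complex)\<^sup>2 = of_real ((real c)\<^sup>2)" by simp
      then show ?thesis unfolding H_def by (simp only: Re_divide_of_real) simp
    qed
    ultimately have "Re (H (cis t)) = ((real c)\<^sup>2 * (norm (F t))\<^sup>2) / (real c)\<^sup>2" by (simp only:)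
    then show "Re (H (cis t)) = (norm (F t))\<^sup>2" using Y(3) by simp
  qed
qed

text \<open>Parseval's identity for finite sums.\<close>

lemma circle_mean_norm2_trig_sum:
  assumes "finite \<Lambda>"
  shows "circle_mean (\<lambda>t. (norm (\<Sum>x\<in>\<Lambda>. of_real (\<beta> x) * cis (of_int x * t)))\<^sup>2) = (\<Sum>x\<in>\<Lambda>. (\<beta> x)\<^sup>2)"
proof -
  define g where "g t = (\<Sum>x\<in>\<Lambda>. \<Sum>y\<in>\<Lambda>. of_real (\<beta> x * \<beta> y) * cis (of_int (x - y) * t))" for t
  have cg: "continuous_on UNIV g" unfolding g_def by (intro continuous_intros)
  have eq: "(norm (\<Sum>x\<in>\<Lambda>. of_real (\<beta> x) * cis (of_int x * t)))\<^sup>2 = Re (g t)" for t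
  proof -
    have "(norm (\<Sum>x\<in>\<Lambda>. of_real (\<beta> x) * cis (of_int x * t)))\<^sup>2
      = Re ((\<Sum>x\<in>\<Lambda>. of_real (\<beta> x) * cis (of_int x * t)) * cnj (\<Sum>x\<in>\<Lambda>. of_real (\<beta> x) * cis (of_int x * t)))"
      by (rule cmod_square_eq_Re)
    also have "(\<Sum>x\<in>\<Lambda>. of_real (\<beta> x) * cis (of_int x * t)) * cnj (\<Sum>x\<in>\<Lambda>. of_real (\<beta> x) * cis (of_int x * t)) = g t"
    proof -
      have "cis (of_int (x - y) * t) = cis (of_int x * t) * cis (- (of_int y * t))" for x y
        by (simp add: cis_mult algebra_simps)
      then show ?thesis unfolding g_def by (simp add: cis_cnj sum_product mult_ac)
    qed
    finally show ?thesis .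
  qed
  have "circle_mean g = (\<Sum>x\<in>\<Lambda>. \<Sum>y\<in>\<Lambda>. of_real (\<beta> x * \<beta> y) * (if x - y = 0 then 1 else 0))"
    unfolding g_def
  proof (subst circle_mean_sum)
    show "(\<Sum>i\<in>\<Lambda>. circle_mean (\<lambda>t. \<Sum>y\<in>\<Lambda>. complex_of_real (\<beta> i * \<beta> y) * cis (real_of_int (i - y) * t))) =
      (\<Sum>x\<in>\<Lambda>. \<Sum>y\<in>\<Lambda>. complex_of_real (\<beta> x * \<beta> y) * (if x - y = 0 then 1 else 0))"
    proof (rule sum.cong[OF refl], subst circle_mean_sum)
      fix x show "(\<Sum>y\<in>\<Lambda>. circle_mean (\<lambda>t. complex_of_real (\<beta> x * \<beta> y) * cis (real_of_int (x - y) * t))) =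
         (\<Sum>y\<in>\<Lambda>. complex_of_real (\<beta> x * \<beta> y) * (if x - y = 0 then 1 else 0))"
        by (intro sum.cong refl, subst circle_mean_cmult) (auto intro!: continuous_intros simp only: circle_mean_cis_int)
    qed (auto intro!: continuous_intros assms)
  qed (auto intro!: continuous_intros assms)
  also have "\<dots> = of_real (\<Sum>x\<in>\<Lambda>. (\<beta> x)\<^sup>2)"
    by (simp add: assms power2_eq_square if_distrib[of "\<lambda>z. _ * z"] cong: if_cong)
  finally have "circle_mean g = of_real (\<Sum>x\<in>\<Lambda>. (\<beta> x)\<^sup>2)" .
  moreover have "circle_mean (\<lambda>t. Re (g t)) = Re (circle_mean g)"
    by (rule circle_mean_linear[OF bounded_linear_Re cg])
  ultimately show ?thesis unfolding eq by simp
qed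

lemma sum_inverse_power4_le: "(\<Sum>k\<in>{Suc i..<n}. 1 / 4 ^ k) \<le> (1 / 4 ^ i) / (2::real)"
proof (cases "Suc i \<le> n")
  case True
  have "(\<Sum>k\<in>{Suc i..<n}. 1 / 4 ^ k) = (1 / 4 ^ i) / 3 - 4 / (3 * 4 ^ n :: real)"
    using True
  proof (induction n rule: dec_induct)
    case (step n)
    then have "(\<Sum>k\<in>{Suc i..<Suc n}. 1 / 4 ^ k) = (1 / 4 ^ i) / 3 - 4 / (3 * 4 ^ n) + 1 / (4 ^ n :: real)"
      by simp
    then show ?case by simp
  qed simp
  also have "\<dots> \<le> (1 / 4 ^ i) / 3 - 0" by (intro diff_left_mono) simp
  also have "\<dots> \<le> (1 / 4 ^ i) / 2" by (simp add: field_simps)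
  finally show ?thesis .
qed simp

text \<open>The test function of McGehee, Pigno and Smith, with \<open>\<bar>f\<bar>\<^sup>2\<close> in place of \<open>\<bar>f\<bar>\<close>: then \<open>H\<close> below is a polynomial
  and no Hilbert transform is needed, at the price of a power of \<open>J\<close>. The factor \<open>exp (- \<eta> H)\<close> keeps the
  sum of the \<open>F i\<close> bounded by a multiple of \<open>sqrt (J / \<eta>)\<close>; as \<open>F i\<close> has spectrum \<open>- Y i\<close> and \<open>H\<close> has nonnegative spectrum,
  it disturbs only the pairing with frequencies in \<open>\<Lambda>' i\<close>.\<close>

lemma block_count_bound:
  fixes \<beta> :: "int \<Rightarrow> real" and \<Lambda> :: "int set" and Y \<Lambda>' :: "nat \<Rightarrow> int set"
  defines "G \<equiv> \<lambda>t. \<Sum>x\<in>\<Lambda>. of_real (\<beta> x) * cis (of_int x * t)"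
  assumes fin: "finite \<Lambda>" and \<delta>: "\<delta> > 0"
    and Y: "\<And>i. i < J \<Longrightarrow> Y i \<subseteq> \<Lambda>" "\<And>i. i < J \<Longrightarrow> card (Y i) = 4 ^ i"
           "\<And>i y. i < J \<Longrightarrow> y \<in> Y i \<Longrightarrow> \<bar>\<beta> y\<bar> \<ge> \<delta>"
    and \<Lambda>': "\<And>i. i < J \<Longrightarrow> \<Lambda>' i \<subseteq> \<Lambda>" "\<And>i. i < J \<Longrightarrow> real (card (\<Lambda>' i)) \<le> \<Theta> * 4 ^ i"
            "\<And>i x y. i < J \<Longrightarrow> x \<in> \<Lambda> - \<Lambda>' i \<Longrightarrow> y \<in> Y i \<Longrightarrow> y < x"
    and \<Theta>: "\<Theta> \<ge> 1" and B: "circle_mean (\<lambda>t. norm (G t)) \<le> B"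
  shows "real J \<le> 1024 * B ^ 6 * \<Theta> / \<delta> ^ 6"
proof (cases "J = 0")
  case True
  have cG: "continuous_on UNIV G" unfolding G_def by (intro continuous_intros)
  have "0 \<le> B" using B circle_mean_mono[of "\<lambda>_. 0" "\<lambda>t. norm (G t)"] cG by (simp add: continuous_on_norm)
  then show ?thesis using True \<Theta> \<delta> by simp
next
  case False
  have cG: "continuous_on UNIV G" unfolding G_def by (intro continuous_intros)
  have \<beta>B: "\<bar>\<beta> x\<bar> \<le> B" if "x \<in> \<Lambda>" for x
  proof -
    have "circle_mean (\<lambda>t. G t * cis (of_int (-x) * t)) = (\<Sum>x'\<in>\<Lambda>. of_real (\<beta> x') * (if x' - x = 0 then 1 else 0))"
    proof -
      have "circle_mean (\<lambda>t. G t * cis (of_int (-x) * t)) = circle_mean (\<lambda>t. \<Sum>x'\<in>\<Lambda>. of_real (\<beta> x') * cis (of_int (x' - x) * t))"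
      proof -
        have "cis (of_int (x' - x) * t) = cis (of_int x' * t) * cis (of_int (-x) * t)" for x' t
          by (simp add: cis_mult algebra_simps)
        then show ?thesis unfolding G_def by (simp only: sum_distrib_right mult.assoc)
      qed
      also have "\<dots> = (\<Sum>x'\<in>\<Lambda>. circle_mean (\<lambda>t. of_real (\<beta> x') * cis (of_int (x' - x) * t)))"
        by (intro circle_mean_sum fin continuous_intros)
      also have "\<dots> = (\<Sum>x'\<in>\<Lambda>. of_real (\<beta> x') * (if x' - x = 0 then 1 else 0))"
        by (intro sum.cong refl, subst circle_mean_cmult) (auto intro!: continuous_intros simp only: circle_mean_cis_int)
      finally show ?thesis .
    qed
    also have "\<dots> = of_real (\<beta> x)" using fin that by (simp add: if_distrib[of "\<lambda>z. _ * z"] cong: if_cong)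
    finally have "\<bar>\<beta> x\<bar> = norm (circle_mean (\<lambda>t. G t * cis (of_int (-x) * t)))" by simp
    also have "\<dots> \<le> circle_mean (\<lambda>t. norm (G t * cis (of_int (-x) * t)))"
      by (intro norm_circle_mean_le continuous_intros cG)
    also have "\<dots> \<le> B" using B by (simp add: norm_mult)
    finally show ?thesis .
  qed
  \<comment> \<open>With these signs the pairing of \<open>G\<close> with block \<open>i\<close> is
    the average of \<open>\<bar>\<beta> y\<bar>\<close> over the block, hence at least
    \<open>\<delta>\<close>.\<close>
  define s where "s y = sgn (\<beta> y)" for y
  have s1: "s y * s y = 1" if "i < J" "y \<in> Y i" for i y
    using Y(3)[OF that] \<delta> by (auto simp: s_def sgn_real_def)
  have finY: "finite (Y i)" if "i < J" for i using Y(1)[OF that] fin finite_subset by blast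
  define F where "F i t = (\<Sum>y\<in>Y i. of_real (s y) * cis (- of_int y * t)) / of_nat (4 ^ i)" for i :: nat and t
  have "\<exists>H. H holomorphic_on UNIV \<and> H 0 = 1 / of_nat (4 ^ i) \<and> (\<forall>t. Re (H (cis t)) = (norm (F i t))\<^sup>2)"
    if i: "i < J" for i
  proof (rule square_as_real_part[of "Y i" "4 ^ i" s])
    show "finite (Y i)" "card (Y i) = 4 ^ i" "(0::nat) < 4 ^ i" using finY[OF i] Y(2)[OF i] by simp_all
    show "s y * s y = 1" if "y \<in> Y i" for y by (rule s1[OF i that])
    fix H assume "H holomorphic_on UNIV" "H 0 = 1 / of_nat (4 ^ i)"
      "\<And>t. Re (H (cis t)) = (cmod ((\<Sum>y\<in>Y i. complex_of_real (s y) * cis (- real_of_int y * t)) / of_nat (4 ^ i)))\<^sup>2"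
    then show ?thesis unfolding F_def by blast
  qed
  then obtain H where H: "\<And>i. i < J \<Longrightarrow> H i holomorphic_on UNIV" "\<And>i. i < J \<Longrightarrow> H i 0 = 1 / of_nat (4 ^ i)"
     "\<And>i t. i < J \<Longrightarrow> Re (H i (cis t)) = (norm (F i t))\<^sup>2" by metis
  have cF: "continuous_on UNIV (F i)" for i unfolding F_def by (intro continuous_intros) auto
  have F1: "norm (F i t) \<le> 1" if i: "i < J" for i t
  proof -
    have "norm (\<Sum>y\<in>Y i. of_real (s y) * cis (- of_int y * t)) \<le> (\<Sum>y\<in>Y i. 1)"
      by (rule sum_norm_le) (simp add: norm_mult s_def sgn_real_def)
    then show ?thesis using Y(2)[OF i] by (simp add: F_def norm_divide norm_power)
  qed
  have B0: "B \<ge> \<delta>"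
  proof -
    have "Y 0 \<noteq> {}" using Y(2)[of 0] False by auto
    then obtain y where "y \<in> Y 0" by blast
    then show ?thesis using Y(1,3)[of 0] \<beta>B[of y] False by fastforce
  qed
  \<comment> \<open>Chosen so that the error \<eta> B sqrt(J \<Theta>) caused by the damping is
    \<delta>/2, half of what each block contributes without it.\<close>
  define \<eta> where "\<eta> = \<delta> / (2 * B * sqrt (J * \<Theta>))"
  have J1: "real J \<ge> 1" using False by simp
  have J\<Theta>: "1 \<le> real J * \<Theta>" using mult_mono[OF J1 \<Theta>] by simp
  then have sq: "sqrt (J * \<Theta>) \<ge> 1" by simp
  have \<eta>: "\<eta> > 0" "\<eta> \<le> 1"
  proof -
    show "\<eta> > 0" unfolding \<eta>_def using \<delta> B0 sq by auto
    have "B * 1 \<le> B * sqrt (J * \<Theta>)" using B0 \<delta> sq by (intro mult_left_mono) auto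
    then have "\<delta> \<le> 2 * B * sqrt (J * \<Theta>)" using B0 \<delta> by linarith
    then show "\<eta> \<le> 1" unfolding \<eta>_def using B0 \<delta> sq by (simp add: divide_le_eq_1)
  qed
  \<comment> \<open>Block \<open>i\<close> is damped by the later blocks only. Adding block
    \<open>j\<close> multiplies all earlier terms by the same factor exp(-\<eta> H j), which gives
    the partial sums a one-step recursion.\<close>
  define T where "T i j w = (\<Sum>k\<in>{Suc i..<j}. H k w)" for i j w
  define \<Psi> where "\<Psi> i w = exp (- (of_real \<eta> * T i J w))" for i w
  have holT: "T i J holomorphic_on UNIV" for i
    unfolding T_def by (intro holomorphic_intros H) auto
  have hol\<Psi>: "\<Psi> i holomorphic_on UNIV" for i
    unfolding \<Psi>_def by (intro holomorphic_intros holT)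
  note cont = continuous_on_holomorphic_cis[OF hol\<Psi>] continuous_on_holomorphic_cis[OF holT]
  have ReT: "Re (T i J (cis t)) = (\<Sum>k\<in>{Suc i..<J}. (norm (F k t))\<^sup>2)" for i t
    unfolding T_def by (simp add: H)
  define \<phi> where "\<phi> j t = (\<Sum>i<j. F i t * exp (- (of_real \<eta> * T i j (cis t))))" for j t
  have \<phi>J: "\<phi> J t = (\<Sum>i<J. F i t * \<Psi> i (cis t))" for t by (simp add: \<phi>_def \<Psi>_def)
  have \<phi>bound: "norm (\<phi> J t) \<le> 2 * sqrt (J / \<eta>)" for t
  proof -
    \<comment> \<open>This value makes J / (2 \<eta> D) equal to D / 2, so that both summands of the
      bound have the same order.\<close>
    define D where "D = sqrt (J / \<eta>)"
    have D: "D > 0" "D * D = J / \<eta>" using J1 \<eta> by (auto simp: D_def)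
    have "norm (\<phi> J t) \<le> D + real J / (2 * \<eta> * D)"
    proof (rule damped_recursion_bound[where \<phi> = "\<lambda>j. \<phi> j t" and J = J and f = "\<lambda>i. F i t" and e = "\<lambda>j. exp (- (of_real \<eta> * H j (cis t)))"])
      show "\<phi> 0 t = 0" by (simp add: \<phi>_def)
      fix j assume j: "j < J"
      have "T i (Suc j) (cis t) = T i j (cis t) + H j (cis t)" if "i < j" for i
        using that by (simp add: T_def)
      then have "(\<Sum>i<j. F i t * exp (- (of_real \<eta> * T i (Suc j) (cis t)))) = \<phi> j t * exp (- (of_real \<eta> * H j (cis t)))"
        unfolding \<phi>_def sum_distrib_right by (intro sum.cong) (auto simp: exp_add[symmetric] algebra_simps)
      then show "\<phi> (Suc j) t = \<phi> j t * exp (- (of_real \<eta> * H j (cis t))) + F j t"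
        by (simp add: \<phi>_def[of "Suc j"] T_def)
      show "norm (exp (- (of_real \<eta> * H j (cis t)))) = exp (- \<eta> * (norm (F j t))\<^sup>2)"
        using H(3)[OF j, of t] by simp
    qed (use F1 \<eta> D in auto)
    also have "real J / (2 * \<eta> * D) = D / 2" using D \<eta> J1 by (simp add: field_simps)
    finally have "norm (\<phi> J t) \<le> 2 * D" using D(1) by linarith
    then show ?thesis by (simp only: D_def)
  qed
  define B' where "B' i = (\<lambda>t. \<Sum>x\<in>\<Lambda>' i. of_real (\<beta> x) * cis (of_int x * t))" for i
  have cB': "continuous_on UNIV (B' i)" for i unfolding B'_def by (intro continuous_intros)
  have main: "Re (circle_mean (\<lambda>t. G t * (F i t * \<Psi> i (cis t)))) \<ge> \<delta> / 2" if i: "i < J" for i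
  proof -
    have "circle_mean (\<lambda>t. G t * F i t) = of_real (\<Sum>y\<in>Y i. \<bar>\<beta> y\<bar>) / of_nat (4 ^ i)"
    proof -
      have "circle_mean (\<lambda>t. G t * F i t) = circle_mean (\<lambda>t. \<Sum>x\<in>\<Lambda>. \<Sum>y\<in>Y i. (of_real (\<beta> x * s y) / of_nat (4 ^ i)) * cis (of_int (x - y) * t))"
      proof -
        have "cis (of_int (x - y) * t) = cis (of_int x * t) * cis (- of_int y * t)" for x y t
          by (simp add: cis_mult algebra_simps)
        then show ?thesis unfolding G_def F_def by (simp add: sum_divide_distrib sum_product mult_ac)
      qed
      also have "\<dots> = (\<Sum>x\<in>\<Lambda>. circle_mean (\<lambda>t. \<Sum>y\<in>Y i. (of_real (\<beta> x * s y) / of_nat (4 ^ i)) * cis (of_int (x - y) * t)))"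
        by (intro circle_mean_sum fin continuous_intros)
      also have "\<dots> = (\<Sum>x\<in>\<Lambda>. \<Sum>y\<in>Y i. circle_mean (\<lambda>t. (of_real (\<beta> x * s y) / of_nat (4 ^ i)) * cis (of_int (x - y) * t)))"
        by (intro sum.cong refl circle_mean_sum finY[OF i] continuous_intros)
      also have "\<dots> = (\<Sum>x\<in>\<Lambda>. \<Sum>y\<in>Y i. (of_real (\<beta> x * s y) / of_nat (4 ^ i)) * (if x - y = 0 then 1 else 0))"
        by (intro sum.cong refl, subst circle_mean_cmult) (auto intro!: continuous_intros simp only: circle_mean_cis_int)
      also have "\<dots> = (\<Sum>y\<in>Y i. \<Sum>x\<in>\<Lambda>. if x = y then of_real (\<bar>\<beta> y\<bar>) / of_nat (4 ^ i) else 0)"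
        by (subst sum.swap) (intro sum.cong refl, auto simp: s_def mult_sgn_abs abs_sgn)
      also have "\<dots> = (\<Sum>y\<in>Y i. of_real (\<bar>\<beta> y\<bar>) / of_nat (4 ^ i))"
        using fin Y(1)[OF i] by (intro sum.cong) auto
      finally show ?thesis by (simp add: sum_divide_distrib)
    qed
    then have "Re (circle_mean (\<lambda>t. G t * F i t)) = (\<Sum>y\<in>Y i. \<bar>\<beta> y\<bar>) / 4 ^ i"
      by (metis Re_complex_of_real of_nat_numeral of_nat_power of_real_divide of_real_of_nat_eq)
    moreover have "(\<Sum>y\<in>Y i. \<bar>\<beta> y\<bar>) \<ge> 4 ^ i * \<delta>"
      using sum_bounded_below[of "Y i" \<delta> "\<lambda>y. \<bar>\<beta> y\<bar>"] Y(2,3)[OF i] by simp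
    ultimately have M1: "Re (circle_mean (\<lambda>t. G t * F i t)) \<ge> \<delta>" by (simp add: pos_le_divide_eq mult.commute)
    define E where "E t = F i t * (\<Psi> i (cis t) - 1)" for t
    have cE: "continuous_on UNIV E" unfolding E_def by (intro continuous_intros cF cont)
    \<comment> \<open>For x to the right of the whole block all exponents x - y are positive and
      \<open>\<Psi> i\<close> is analytic, so the product is a function of \<open>cis t\<close> that
      vanishes at 0. Hence only frequencies in \<open>\<Lambda>' i\<close> feel the damping.\<close>
    have van: "circle_mean (\<lambda>t. cis (of_int x * t) * E t) = 0" if x: "x \<in> \<Lambda> - \<Lambda>' i" for x
    proof -
      define g where "g w = (\<Sum>y\<in>Y i. of_real (s y) * w ^ nat (x - y)) / of_nat (4 ^ i) * (\<Psi> i w - 1)" for w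
      have "cis (of_int x * t) * E t = g (cis t)" for t
      proof -
        have "cis (of_int x * t) * cis (- of_int y * t) = cis t ^ nat (x - y)" if "y \<in> Y i" for y
          using \<Lambda>'(3)[OF i x that] by (simp add: Complex.DeMoivre cis_mult algebra_simps)
        then have "cis (of_int x * t) * (\<Sum>y\<in>Y i. of_real (s y) * cis (- of_int y * t)) = (\<Sum>y\<in>Y i. of_real (s y) * cis t ^ nat (x - y))"
          unfolding sum_distrib_left mult.left_commute[of "cis (of_int x * t)"] by (intro sum.cong refl) simp
        then have "cis (of_int x * t) * F i t = (\<Sum>y\<in>Y i. of_real (s y) * cis t ^ nat (x - y)) / of_nat (4 ^ i)"
          unfolding F_def by (simp only: times_divide_eq_right)
        then show ?thesis unfolding E_def g_def by (simp only: mult.assoc[symmetric])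
      qed
      moreover have "circle_mean (\<lambda>t. g (cis t)) = g 0"
        by (rule circle_mean_holomorphic) (unfold g_def, intro holomorphic_intros hol\<Psi>, simp)
      moreover have "g 0 = 0"
        unfolding g_def using \<Lambda>'(3)[OF i x] by (simp add: zero_power)
      ultimately show ?thesis by simp
    qed
    have finL': "finite (\<Lambda>' i)" using \<Lambda>'(1)[OF i] fin finite_subset by blast
    have "circle_mean (\<lambda>t. G t * E t) = (\<Sum>x\<in>\<Lambda>. of_real (\<beta> x) * circle_mean (\<lambda>t. cis (of_int x * t) * E t))"
    proof -
      have "circle_mean (\<lambda>t. G t * E t) = circle_mean (\<lambda>t. \<Sum>x\<in>\<Lambda>. of_real (\<beta> x) * (cis (of_int x * t) * E t))"
        unfolding G_def by (simp add: sum_distrib_right mult.assoc)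
      also have "\<dots> = (\<Sum>x\<in>\<Lambda>. circle_mean (\<lambda>t. of_real (\<beta> x) * (cis (of_int x * t) * E t)))"
        by (intro circle_mean_sum fin continuous_intros cE)
      also have "\<dots> = (\<Sum>x\<in>\<Lambda>. of_real (\<beta> x) * circle_mean (\<lambda>t. cis (of_int x * t) * E t))"
        by (intro sum.cong refl circle_mean_cmult continuous_intros cE)
      finally show ?thesis .
    qed
    also have "\<dots> = (\<Sum>x\<in>\<Lambda>' i. of_real (\<beta> x) * circle_mean (\<lambda>t. cis (of_int x * t) * E t))"
      by (rule sum.mono_neutral_right) (use fin \<Lambda>'(1)[OF i] van in auto)
    also have "\<dots> = (\<Sum>x\<in>\<Lambda>' i. circle_mean (\<lambda>t. of_real (\<beta> x) * (cis (of_int x * t) * E t)))"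
      by (intro sum.cong refl circle_mean_cmult[symmetric] continuous_intros cE)
    also have "\<dots> = circle_mean (\<lambda>t. \<Sum>x\<in>\<Lambda>' i. of_real (\<beta> x) * (cis (of_int x * t) * E t))"
      by (intro circle_mean_sum[symmetric] finL' continuous_intros cE)
    also have "\<dots> = circle_mean (\<lambda>t. B' i t * E t)"
      unfolding B'_def by (simp add: sum_distrib_right mult.assoc)
    finally have GE: "circle_mean (\<lambda>t. G t * E t) = circle_mean (\<lambda>t. B' i t * E t)" .
    \<comment> \<open>The weight that equalises the two terms of the inequality between products and
      squares applied to \<open>B' i\<close> and \<open>\<Psi> i - 1\<close>.\<close>
    define \<sigma> where "\<sigma> = \<eta> * sqrt J / (B * sqrt \<Theta> * 4 ^ i)"
    have \<sigma>: "\<sigma> > 0" unfolding \<sigma>_def using \<eta> J1 B0 \<delta> \<Theta> by auto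
    have b1: "circle_mean (\<lambda>t. (norm (B' i t))\<^sup>2) \<le> \<Theta> * 4 ^ i * B\<^sup>2"
    proof -
      have "circle_mean (\<lambda>t. (norm (B' i t))\<^sup>2) = (\<Sum>x\<in>\<Lambda>' i. (\<beta> x)\<^sup>2)"
        unfolding B'_def by (rule circle_mean_norm2_trig_sum[OF finL'])
      also have "\<dots> \<le> (\<Sum>x\<in>\<Lambda>' i. B\<^sup>2)"
        using \<beta>B \<Lambda>'(1)[OF i] B0 \<delta> by (intro sum_mono abs_le_square_iff[THEN iffD1]) force
      also have "\<dots> = real (card (\<Lambda>' i)) * B\<^sup>2" by simp
      also have "\<dots> \<le> \<Theta> * 4 ^ i * B\<^sup>2" by (intro mult_right_mono \<Lambda>'(2) i) auto
      finally show ?thesis .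
    qed
    have meanF: "circle_mean (\<lambda>t. (norm (F k t))\<^sup>2) = 1 / 4 ^ k" if k: "k < J" for k
    proof -
      have "circle_mean (\<lambda>t. Re (H k (cis t))) = Re (circle_mean (\<lambda>t. H k (cis t)))"
        by (intro circle_mean_linear bounded_linear_Re continuous_on_holomorphic_cis H k)
      also have "circle_mean (\<lambda>t. H k (cis t)) = of_real (1 / 4 ^ k)"
        using circle_mean_holomorphic[OF H(1)[OF k]] H(2)[OF k] by simp
      finally show ?thesis by (simp only: H(3)[OF k] Re_complex_of_real)
    qed
    \<comment> \<open>The later blocks have mean squares 1/4^k with k > i, whose sum is at most half
      of 1/4^i; this offsets the \<Theta> 4^i frequencies in \<open>\<Lambda>' i\<close>. The square
      of the tail sum is estimated by J times the sum itself, which is where a factor J is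
      lost.\<close>
    have b2: "circle_mean (\<lambda>t. (norm (\<Psi> i (cis t) - 1))\<^sup>2) \<le> \<eta>\<^sup>2 * J / 4 ^ i"
    proof -
      have "circle_mean (\<lambda>t. (norm (\<Psi> i (cis t) - 1))\<^sup>2) \<le> circle_mean (\<lambda>t. \<eta>\<^sup>2 * (norm (T i J (cis t)))\<^sup>2)"
      proof (intro circle_mean_mono continuous_intros cont)
        fix t
        have "norm (\<Psi> i (cis t) - 1) \<le> norm (of_real \<eta> * T i J (cis t))"
          unfolding \<Psi>_def by (rule norm_exp_minus_one_le) (use \<eta> ReT in \<open>simp add: sum_nonneg\<close>)
        also have "\<dots> = \<eta> * norm (T i J (cis t))" using \<eta> by (simp add: norm_mult)
        finally show "(norm (\<Psi> i (cis t) - 1))\<^sup>2 \<le> \<eta>\<^sup>2 * (norm (T i J (cis t)))\<^sup>2"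
          unfolding power_mult_distrib[symmetric] by (intro power_mono) auto
      qed
      also have "\<dots> = \<eta>\<^sup>2 * circle_mean (\<lambda>t. (norm (T i J (cis t)))\<^sup>2)"
        by (intro circle_mean_cmult continuous_intros cont)
      also have "circle_mean (\<lambda>t. (norm (T i J (cis t)))\<^sup>2) \<le> 2 * circle_mean (\<lambda>t. (\<Sum>k\<in>{Suc i..<J}. (norm (F k t))\<^sup>2)\<^sup>2)"
      proof (rule circle_mean_norm2_holomorphic[OF holT _ ReT])
        have "T i J 0 = of_real (\<Sum>k\<in>{Suc i..<J}. 1 / 4 ^ k)" by (simp add: T_def H)
        then show "T i J 0 \<in> \<real>" by (metis Reals_of_real)
      qed
      also have "circle_mean (\<lambda>t. (\<Sum>k\<in>{Suc i..<J}. (norm (F k t))\<^sup>2)\<^sup>2)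
           \<le> circle_mean (\<lambda>t. J * (\<Sum>k\<in>{Suc i..<J}. (norm (F k t))\<^sup>2))"
      proof (intro circle_mean_mono continuous_intros cF)
        fix t
        let ?S = "\<Sum>k\<in>{Suc i..<J}. (norm (F k t))\<^sup>2"
        have "?S \<le> (\<Sum>k\<in>{Suc i..<J}. 1)" using F1 by (intro sum_mono) (auto simp: power_le_one)
        also have "\<dots> \<le> real J" by simp
        finally show "?S\<^sup>2 \<le> J * ?S"
          unfolding power2_eq_square by (intro mult_right_mono) (auto intro: sum_nonneg)
      qed
      also have "circle_mean (\<lambda>t. J * (\<Sum>k\<in>{Suc i..<J}. (norm (F k t))\<^sup>2)) = J * (\<Sum>k\<in>{Suc i..<J}. 1 / 4 ^ k)"
      proof -
        have "circle_mean (\<lambda>t. J * (\<Sum>k\<in>{Suc i..<J}. (norm (F k t))\<^sup>2)) = J * circle_mean (\<lambda>t. (\<Sum>k\<in>{Suc i..<J}. (norm (F k t))\<^sup>2))"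
          by (intro circle_mean_cmult continuous_intros cF)
        also have "circle_mean (\<lambda>t. (\<Sum>k\<in>{Suc i..<J}. (norm (F k t))\<^sup>2)) = (\<Sum>k\<in>{Suc i..<J}. circle_mean (\<lambda>t. (norm (F k t))\<^sup>2))"
          by (intro circle_mean_sum continuous_intros cF) auto
        also have "\<dots> = (\<Sum>k\<in>{Suc i..<J}. 1 / 4 ^ k)" by (intro sum.cong) (auto simp: meanF)
        finally show ?thesis .
      qed
      also have "(\<Sum>k\<in>{Suc i..<J}. 1 / 4 ^ k) \<le> (1 / 4 ^ i) / (2::real)"
        by (rule sum_inverse_power4_le)
      finally show ?thesis using \<eta> J1 by (simp add: field_simps mult_left_mono)
    qed
    have "norm (circle_mean (\<lambda>t. B' i t * E t)) \<le> circle_mean (\<lambda>t. norm (B' i t * E t))"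
      by (intro norm_circle_mean_le continuous_intros cB' cE)
    also have "\<dots> \<le> circle_mean (\<lambda>t. \<sigma> / 2 * (norm (B' i t))\<^sup>2 + 1 / (2 * \<sigma>) * (norm (\<Psi> i (cis t) - 1))\<^sup>2)"
    proof (intro circle_mean_mono continuous_intros cB' cE cont)
      fix t
      let ?a = "norm (B' i t)" and ?b = "norm (\<Psi> i (cis t) - 1)"
      have "norm (B' i t * E t) \<le> ?a * ?b"
        unfolding E_def norm_mult using F1[OF i, of t] by (intro mult_left_mono) (auto simp: mult_left_le_one_le)
      also have "\<dots> \<le> \<sigma> / 2 * ?a\<^sup>2 + 1 / (2 * \<sigma>) * ?b\<^sup>2"
      proof -
        have "0 \<le> (\<sigma> * ?a - ?b)\<^sup>2 / (2 * \<sigma>)" using \<sigma> by simp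
        also have "\<dots> = \<sigma> / 2 * ?a\<^sup>2 + 1 / (2 * \<sigma>) * ?b\<^sup>2 - ?a * ?b"
          using \<sigma> by (simp add: power2_eq_square field_simps)
        finally show ?thesis by simp
      qed
      finally show "norm (B' i t * E t) \<le> \<sigma> / 2 * ?a\<^sup>2 + 1 / (2 * \<sigma>) * ?b\<^sup>2" .
    qed
    also have "\<dots> = circle_mean (\<lambda>t. \<sigma> / 2 * (norm (B' i t))\<^sup>2) + circle_mean (\<lambda>t. 1 / (2 * \<sigma>) * (norm (\<Psi> i (cis t) - 1))\<^sup>2)"
      by (intro circle_mean_add continuous_intros cB' cE cont)
    also have "\<dots> = \<sigma> / 2 * circle_mean (\<lambda>t. (norm (B' i t))\<^sup>2) + 1 / (2 * \<sigma>) * circle_mean (\<lambda>t. (norm (\<Psi> i (cis t) - 1))\<^sup>2)"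
      by (intro arg_cong2[where f = "(+)"] circle_mean_cmult continuous_intros cB' cE cont)
    also have "\<dots> \<le> \<sigma> / 2 * (\<Theta> * 4 ^ i * B\<^sup>2) + 1 / (2 * \<sigma>) * (\<eta>\<^sup>2 * J / 4 ^ i)"
      using \<sigma> by (intro add_mono mult_left_mono b1 b2) auto
    also have "\<dots> = \<delta> / 2"
    proof -
      define u where "u = sqrt J" define v where "v = sqrt \<Theta>"
      have uv: "u > 0" "v > 0" "real J = u * u" "\<Theta> = v * v" using J1 \<Theta> by (auto simp: u_def v_def)
      have "\<sigma> = \<eta> * u / (B * v * 4 ^ i)" by (simp add: \<sigma>_def u_def v_def)
      moreover have "\<eta> = \<delta> / (2 * B * (u * v))" by (simp add: \<eta>_def u_def v_def real_sqrt_mult)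
      moreover have "\<eta> * u / (B * v * 4 ^ i) / 2 * (v * v * 4 ^ i * B\<^sup>2) + 1 / (2 * (\<eta> * u / (B * v * 4 ^ i))) * (\<eta>\<^sup>2 * (u * u) / 4 ^ i) = \<eta> * (B * (u * v))"
        using uv(1,2) \<eta> B0 \<delta> by (simp add: field_simps power2_eq_square)
      ultimately show ?thesis using uv B0 \<delta> by simp
    qed
    finally have M2: "norm (circle_mean (\<lambda>t. G t * E t)) \<le> \<delta> / 2" unfolding GE .
    have "circle_mean (\<lambda>t. G t * (F i t * \<Psi> i (cis t))) = circle_mean (\<lambda>t. G t * F i t + G t * E t)"
      by (simp add: E_def algebra_simps)
    also have "\<dots> = circle_mean (\<lambda>t. G t * F i t) + circle_mean (\<lambda>t. G t * E t)"
      by (intro circle_mean_add continuous_intros cG cF cE)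
    finally show ?thesis using M1 M2 abs_Re_le_cmod[of "circle_mean (\<lambda>t. G t * E t)"] by simp
  qed
  have c\<phi>: "continuous_on UNIV (\<phi> J)" unfolding \<phi>J by (intro continuous_intros cF cont)
  have "circle_mean (\<lambda>t. G t * \<phi> J t) = circle_mean (\<lambda>t. \<Sum>i<J. G t * (F i t * \<Psi> i (cis t)))"
    by (simp add: \<phi>J sum_distrib_left)
  also have "\<dots> = (\<Sum>i<J. circle_mean (\<lambda>t. G t * (F i t * \<Psi> i (cis t))))"
    by (intro circle_mean_sum continuous_intros cG cF cont) auto
  finally have "Re (circle_mean (\<lambda>t. G t * \<phi> J t)) = (\<Sum>i<J. Re (circle_mean (\<lambda>t. G t * (F i t * \<Psi> i (cis t)))))"
    by simp
  also have "\<dots> \<ge> (\<Sum>i<J. \<delta> / 2)" by (intro sum_mono main) auto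
  finally have "J * \<delta> / 2 \<le> Re (circle_mean (\<lambda>t. G t * \<phi> J t))" by simp
  also have "\<dots> \<le> norm (circle_mean (\<lambda>t. G t * \<phi> J t))" by (rule complex_Re_le_cmod)
  also have "\<dots> \<le> circle_mean (\<lambda>t. norm (G t * \<phi> J t))"
    by (intro norm_circle_mean_le continuous_intros cG c\<phi>)
  also have "\<dots> \<le> circle_mean (\<lambda>t. 2 * sqrt (J / \<eta>) * norm (G t))"
    by (intro circle_mean_mono continuous_intros cG c\<phi>)
       (metis \<phi>bound mult.commute mult_right_mono norm_ge_zero norm_mult)
  also have "\<dots> = 2 * sqrt (J / \<eta>) * circle_mean (\<lambda>t. norm (G t))"
    by (intro circle_mean_cmult continuous_intros cG)
  also have "\<dots> \<le> 2 * sqrt (J / \<eta>) * B"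
    using J1 \<eta> by (intro mult_left_mono B) auto
  finally have fin: "J * \<delta> / 2 \<le> 2 * sqrt (J / \<eta>) * B" .
  \<comment> \<open>One squaring removes the root of J/\<eta>; inserting \<eta> leaves sqrt(J
    \<Theta>), and the second squaring produces the sixth powers.\<close>
  have "(J * \<delta> / 2)\<^sup>2 \<le> (2 * sqrt (J / \<eta>) * B)\<^sup>2" using fin \<delta> by (intro power_mono) auto
  also have "\<dots> = 4 * (J / \<eta>) * B\<^sup>2" using J1 \<eta> by (simp add: power_mult_distrib)
  finally have "J * \<delta>\<^sup>2 * \<eta> \<le> 16 * B\<^sup>2" using J1 \<eta> by (simp add: power2_eq_square field_simps)
  then have "J * \<delta> ^ 3 \<le> 32 * B ^ 3 * sqrt (J * \<Theta>)"
    using sq B0 \<delta> unfolding \<eta>_def by (simp add: field_simps power2_eq_square power3_eq_cube)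
  then have "(J * \<delta> ^ 3)\<^sup>2 \<le> (32 * B ^ 3 * sqrt (J * \<Theta>))\<^sup>2" using \<delta> by (intro power_mono) auto
  also have "\<dots> = 1024 * B ^ 6 * (J * \<Theta>)" using J\<Theta> by (simp add: power_mult_distrib flip: power_mult)
  finally have "J * (J * \<delta> ^ 6) \<le> J * (1024 * B ^ 6 * \<Theta>)"
    by (simp add: power_mult_distrib power2_eq_square mult_ac flip: power_mult power_add)
  then show ?thesis using J1 \<delta> by (simp add: pos_le_divide_eq)
qed

text \<open>Block i consists of the elements of \<open>Y\<close> with ranks from 4^i to 2 * 4^i - 1.
  Frequencies not to the right of the whole block lie within \<open>L\<close> of one of the first 2
  * 4^i elements of \<open>Y\<close>, so \<Theta> = 2 (2 L + 1) is admissible.\<close>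

lemma large_coefficients_bound:
  fixes \<beta> :: "int \<Rightarrow> real" and \<Lambda> Y :: "int set" and L :: nat
  assumes fin: "finite \<Lambda>" and Y: "Y \<subseteq> \<Lambda>" and \<delta>: "\<delta> > 0" "\<And>y. y \<in> Y \<Longrightarrow> \<bar>\<beta> y\<bar> \<ge> \<delta>"
    and L: "\<And>x. x \<in> \<Lambda> \<Longrightarrow> \<exists>y\<in>Y. \<bar>x - y\<bar> \<le> int L"
    and B: "circle_mean (\<lambda>t. norm (\<Sum>x\<in>\<Lambda>. of_real (\<beta> x) * cis (of_int x * t))) \<le> B"
    and J: "4 ^ J \<le> card Y"
  shows "real J \<le> 1024 * B ^ 6 * (2 * (2 * L + 1)) / \<delta> ^ 6"
proof -
  have finY: "finite Y" using Y fin finite_subset by blast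
  define e where "e k = sorted_list_of_set Y ! k" for k
  have len: "length (sorted_list_of_set Y) = card Y" by simp
  have e_mono: "e k < e l" if "k < l" "l < card Y" for k l
    using that strict_sorted_list_of_set[of Y] unfolding e_def
    by (simp add: sorted_wrt_iff_nth_less)
  have eY: "e k \<in> Y" if "k < card Y" for k
    using that finY len unfolding e_def by (metis nth_mem set_sorted_list_of_set)
  have Ye: "\<exists>k<card Y. y = e k" if "y \<in> Y" for y
    using that finY len unfolding e_def by (metis in_set_conv_nth set_sorted_list_of_set)
  have inj: "inj_on e {..<card Y}"
    by (rule linorder_inj_onI) (use e_mono in \<open>force+\<close>)
  have bnd: "2 * 4 ^ i \<le> card Y" if "i < J" for i
  proof -
    have "2 * 4 ^ i \<le> (4::nat) ^ Suc i" by simp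
    also have "\<dots> \<le> 4 ^ J" using that by (intro power_increasing) auto
    finally show ?thesis using J by linarith
  qed
  show ?thesis
  proof (rule block_count_bound[where \<Lambda> = \<Lambda> and \<beta> = \<beta> and Y = "\<lambda>i. e ` {4 ^ i..<2 * 4 ^ i}"
        and \<Lambda>' = "\<lambda>i. {x \<in> \<Lambda>. \<exists>y\<in>e ` {4 ^ i..<2 * 4 ^ i}. x \<le> y}", OF fin \<delta>(1) _ _ _ _ _ _ _ B])
    fix i assume i: "i < J"
    have sub: "e ` {4 ^ i..<2 * 4 ^ i} \<subseteq> Y" using bnd[OF i] eY by auto
    then show "e ` {4 ^ i..<2 * 4 ^ i} \<subseteq> \<Lambda>" using Y by blast
    show "card (e ` {4 ^ i..<2 * 4 ^ i}) = 4 ^ i"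
      using bnd[OF i] by (subst card_image) (auto intro: inj_on_subset[OF inj])
    show "\<delta> \<le> \<bar>\<beta> y\<bar>" if "y \<in> e ` {4 ^ i..<2 * 4 ^ i}" for y using that sub \<delta>(2) by blast
    have "{x \<in> \<Lambda>. \<exists>y\<in>e ` {4 ^ i..<2 * 4 ^ i}. x \<le> y} \<subseteq> (\<Union>k<2 * 4 ^ i. {e k - int L..e k + int L})"
    proof
      fix x assume "x \<in> {x \<in> \<Lambda>. \<exists>y\<in>e ` {4 ^ i..<2 * 4 ^ i}. x \<le> y}"
      then obtain k0 where x: "x \<in> \<Lambda>" "k0 < 2 * 4 ^ i" "x \<le> e k0" by auto
      obtain k where k: "k < card Y" "\<bar>x - e k\<bar> \<le> int L" using L[OF x(1)] Ye by blast
      show "x \<in> (\<Union>k<2 * 4 ^ i. {e k - int L..e k + int L})"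
      proof (cases "k < 2 * 4 ^ i")
        case True
        then show ?thesis using k by (intro UN_I[of k]) auto
      next
        case False
        \<comment> \<open>The close element \<open>e k\<close> lies beyond the block, so
          \<open>e k0\<close> is between \<open>x\<close> and \<open>e k\<close> and is at least as
          close to \<open>x\<close>.\<close>
        then have "e k0 < e k" using x k by (intro e_mono) auto
        then show ?thesis using x k by (intro UN_I[of k0]) auto
      qed
    qed
    then have "card {x \<in> \<Lambda>. \<exists>y\<in>e ` {4 ^ i..<2 * 4 ^ i}. x \<le> y} \<le> card (\<Union>k<2 * 4 ^ i. {e k - int L..e k + int L})"
      by (intro card_mono) auto
    also have "\<dots> \<le> (\<Sum>k<(2 * 4 ^ i :: nat). card {e k - int L..e k + int L})" by (intro card_UN_le) auto
    also have "\<dots> = 2 * 4 ^ i * (2 * L + 1)"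
    proof -
      have "nat (2 * int L + 1) = 2 * L + 1" by linarith
      then show ?thesis by simp
    qed
    finally have "real (card {x \<in> \<Lambda>. \<exists>y\<in>e ` {4 ^ i..<2 * 4 ^ i}. x \<le> y}) \<le> real (2 * 4 ^ i * (2 * L + 1))"
      by (simp only: of_nat_le_iff)
    then show "real (card {x \<in> \<Lambda>. \<exists>y\<in>e ` {4 ^ i..<2 * 4 ^ i}. x \<le> y}) \<le> real (2 * (2 * L + 1)) * 4 ^ i"
      by (simp add: algebra_simps)
    show "y < x" if "x \<in> \<Lambda> - {x \<in> \<Lambda>. \<exists>y\<in>e ` {4 ^ i..<2 * 4 ^ i}. x \<le> y}" "y \<in> e ` {4 ^ i..<2 * 4 ^ i}" for x y
      using that by force
  qed auto
qed

section \<open>Sparse sine sums\<close>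

text \<open>The \<open>card D + 1\<close> windows are disjoint, so \<open>D\<close> cannot meet all
  of them.\<close>

lemma free_scale:
  fixes D :: "real set"
  assumes D: "finite D" and "X > 0" "H > 1"
  shows "\<exists>s\<le>card D. \<forall>d\<in>D. \<not> (X * H ^ s < d \<and> d \<le> X * H ^ Suc s)"
proof (rule ccontr)
  assume "\<not> ?thesis"
  then obtain d where d: "\<And>s. s \<le> card D \<Longrightarrow> d s \<in> D \<and> X * H ^ s < d s \<and> d s \<le> X * H ^ Suc s" by metis
  have lt: "d s < d t" if "s < t" "t \<le> card D" for s t
  proof -
    have "d s \<le> X * H ^ Suc s" using d that by simp
    also have "\<dots> \<le> X * H ^ t" using that assms by (intro mult_left_mono power_increasing) auto
    also have "\<dots> < d t" using d that by simp
    finally show ?thesis .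
  qed
  have "inj_on d {..card D}" by (rule linorder_inj_onI) (use lt in \<open>force+\<close>)
  then have "card {..card D} \<le> card D" by (rule card_inj_on_le[OF _ _ D]) (use d in auto)
  then show False by simp
qed

lemma free_subinterval:
  fixes \<theta>s :: "real list" and l :: real
  assumes "length \<theta>s \<le> r" "l > 0"
  shows "\<exists>k\<le>r. \<forall>\<theta>\<in>set \<theta>s. \<not> (real k * l < \<theta> \<and> \<theta> < real (Suc k) * l)"
proof (rule ccontr)
  assume "\<not> ?thesis"
  then obtain d where d: "\<And>k. k \<le> r \<Longrightarrow> d k \<in> set \<theta>s \<and> real k * l < d k \<and> d k < real (Suc k) * l" by metis
  have lt: "d s < d t" if "s < t" "t \<le> r" for s t
  proof -
    have "d s < real (Suc s) * l" using d that by simp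
    also have "\<dots> \<le> real t * l" using that assms by (intro mult_right_mono) auto
    also have "\<dots> < d t" using d that by simp
    finally show ?thesis .
  qed
  have "inj_on d {..r}" by (rule linorder_inj_onI) (use lt in \<open>force+\<close>)
  then have "card {..r} \<le> card (set \<theta>s)" by (rule card_inj_on_le) (use d in auto)
  also have "\<dots> \<le> r" using assms(1) card_length order_trans by blast
  finally show False by simp
qed

lemma norm_integral_cis_le:
  assumes "\<alpha> \<le> \<beta>" "\<theta> \<noteq> 0"
  shows "norm (integral {\<alpha>..\<beta>} (\<lambda>t. cis (\<theta> * t))) \<le> 2 / \<bar>\<theta>\<bar>"
proof -
  define F where "F t = cis (\<theta> * t) / (\<i> * of_real \<theta>)" for t
  have deriv: "(F has_vector_derivative cis (\<theta> * t)) (at t within {\<alpha>..\<beta>})" for t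
  proof -
    have "((\<lambda>z. exp (\<i> * (of_real \<theta> * z)) / (\<i> * of_real \<theta>)) has_field_derivative exp (\<i> * (of_real \<theta> * of_real t))) (at (of_real t))"
      using assms(2) by (auto intro!: derivative_eq_intros simp: mult_ac)
    then have "((\<lambda>x. exp (\<i> * (of_real \<theta> * of_real x)) / (\<i> * of_real \<theta>)) has_vector_derivative exp (\<i> * (of_real \<theta> * of_real t))) (at t within {\<alpha>..\<beta>})"
      by (rule has_vector_derivative_real_field)
    then show ?thesis by (simp add: F_def[abs_def] cis_conv_exp)
  qed
  have "((\<lambda>t. cis (\<theta> * t)) has_integral (F \<beta> - F \<alpha>)) {\<alpha>..\<beta>}"
    by (intro fundamental_theorem_of_calculus assms deriv)
  then have "integral {\<alpha>..\<beta>} (\<lambda>t. cis (\<theta> * t)) = F \<beta> - F \<alpha>" by (rule integral_unique)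
  moreover have "norm (F t) = 1 / \<bar>\<theta>\<bar>" for t unfolding F_def by (simp add: norm_divide norm_mult)
  ultimately show ?thesis using norm_triangle_ineq4[of "F \<beta>" "F \<alpha>"] by simp
qed

lemma norm_cis_minus_one_le: "norm (cis x - 1) \<le> \<bar>x\<bar>"
proof -
  have "((\<lambda>z. exp (\<i> * z)) has_field_derivative \<i> * exp (\<i> * z)) (at z)" for z
    by (auto intro!: derivative_eq_intros)
  then have deriv: "((\<lambda>x. exp (\<i> * of_real x)) has_vector_derivative \<i> * exp (\<i> * of_real x)) (at x within UNIV)" for x
    by (rule has_vector_derivative_real_field)
  have "norm (exp (\<i> * of_real x) - exp (\<i> * of_real 0)) \<le> 1 * norm (x - 0)"
    by (rule differentiable_bound[of UNIV "\<lambda>x. exp (\<i> * of_real x)" "\<lambda>x h. h *\<^sub>R (\<i> * exp (\<i> * of_real x))"])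
       (use deriv in \<open>auto intro!: onorm_le simp: norm_mult has_vector_derivative_def\<close>)
  then show ?thesis by (simp add: cis_conv_exp)
qed

lemma integral_cis_close:
  assumes "0 \<le> \<alpha>" "\<alpha> \<le> \<beta>"
  shows "norm (integral {\<alpha>..\<beta>} (\<lambda>t. cis (\<theta> * t)) - of_real (\<beta> - \<alpha>)) \<le> (\<beta> - \<alpha>) * (\<bar>\<theta>\<bar> * \<beta>)"
proof -
  have int: "(\<lambda>t. cis (\<theta> * t)) integrable_on {\<alpha>..\<beta>}" by (intro integrable_continuous_interval continuous_intros)
  have "integral {\<alpha>..\<beta>} (\<lambda>t. cis (\<theta> * t) - 1) = integral {\<alpha>..\<beta>} (\<lambda>t. cis (\<theta> * t)) - of_real (\<beta> - \<alpha>)"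
    using assms by (subst integral_diff[OF int]) (auto simp: scaleR_conv_of_real)
  moreover have "norm (integral {\<alpha>..\<beta>} (\<lambda>t. cis (\<theta> * t) - 1)) \<le> integral {\<alpha>..\<beta>} (\<lambda>t. \<bar>\<theta>\<bar> * \<beta>)"
  proof (rule integral_norm_bound_integral)
    show "(\<lambda>t. cis (\<theta> * t) - 1) integrable_on {\<alpha>..\<beta>}" by (intro integrable_continuous_interval continuous_intros)
    fix t assume t: "t \<in> {\<alpha>..\<beta>}"
    have "norm (cis (\<theta> * t) - 1) \<le> \<bar>\<theta>\<bar> * \<bar>t\<bar>" using norm_cis_minus_one_le[of "\<theta> * t"] by (simp add: abs_mult)
    also have "\<dots> \<le> \<bar>\<theta>\<bar> * \<beta>" using t assms by (intro mult_left_mono) auto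
    finally show "norm (cis (\<theta> * t) - 1) \<le> \<bar>\<theta>\<bar> * \<beta>" .
  qed auto
  ultimately show ?thesis using assms by (simp add: mult_ac)
qed

text \<open>The sets \<open>C y\<close> are the classes of an equivalence relation. As
  \<open>A\<close> sums to zero over each class, \<open>w\<close> may be replaced by its deviation
  from the value at a representative, which is at most \<open>X\<close>.\<close>

lemma abs_sum_le_of_clusters:
  fixes C :: "'a \<Rightarrow> 'a set" and A w :: "'a \<Rightarrow> real"
  assumes fin: "finite S" and refl: "\<And>y. y \<in> S \<Longrightarrow> y \<in> C y" and C: "\<And>y. y \<in> S \<Longrightarrow> C y \<subseteq> S"
    and eq: "\<And>y y'. y \<in> S \<Longrightarrow> y' \<in> C y \<Longrightarrow> C y' = C y"
    and zero: "\<And>y. y \<in> S \<Longrightarrow> (\<Sum>y'\<in>C y. A y') = 0"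
    and close: "\<And>y y'. y \<in> S \<Longrightarrow> y' \<in> C y \<Longrightarrow> \<bar>w y - w y'\<bar> \<le> X" and A: "\<And>y. y \<in> S \<Longrightarrow> \<bar>A y\<bar> \<le> a" and "0 \<le> a"
  shows "\<bar>\<Sum>y\<in>S. A y * w y\<bar> \<le> a * real (card S) * X"
proof -
  \<comment> \<open>The choice depends on the set \<open>C y\<close> alone, so all members of a
    class get the same representative.\<close>
  define c where "c y = (SOME y'. y' \<in> C y)" for y
  have c: "c y \<in> C y" if "y \<in> S" for y unfolding c_def using refl[OF that] by (rule someI)
  have c_eq: "c y' = c y" if "y \<in> S" "y' \<in> C y" for y y' using eq[OF that] by (simp add: c_def)
  have fib: "{x \<in> S. c x = c y} = C y" if "y \<in> S" for y
  proof
    show "C y \<subseteq> {x \<in> S. c x = c y}" using C c_eq that by blast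
    show "{x \<in> S. c x = c y} \<subseteq> C y"
    proof
      fix x assume "x \<in> {x \<in> S. c x = c y}"
      then have x: "x \<in> S" "c x = c y" by auto
      have "C (c x) = C x" by (rule eq[OF x(1) c[OF x(1)]])
      moreover have "C (c y) = C y" by (rule eq[OF that c[OF that]])
      ultimately have "C x = C y" using x(2) by simp
      then show "x \<in> C y" using refl[OF x(1)] by blast
    qed
  qed
  have "(\<Sum>y\<in>S. A y * w (c y)) = (\<Sum>z\<in>c ` S. \<Sum>y\<in>{x \<in> S. c x = z}. A y * w (c y))"
    by (rule sum.group[symmetric]) (use fin in auto)
  also have "\<dots> = (\<Sum>z\<in>c ` S. 0)"
  proof (rule sum.cong[OF HOL.refl])
    fix z assume "z \<in> c ` S"
    then obtain y where y: "y \<in> S" "z = c y" by auto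
    have "(\<Sum>x\<in>{x \<in> S. c x = z}. A x * w (c x)) = (\<Sum>x\<in>{x \<in> S. c x = z}. A x) * w z"
      unfolding sum_distrib_right by (intro sum.cong) auto
    then show "(\<Sum>x\<in>{x \<in> S. c x = z}. A x * w (c x)) = 0" using fib[OF y(1)] zero[OF y(1)] y by simp
  qed
  finally have "(\<Sum>y\<in>S. A y * w y) = (\<Sum>y\<in>S. A y * (w y - w (c y)))"
    by (simp add: right_diff_distrib sum_subtractf)
  also have "\<bar>\<dots>\<bar> \<le> (\<Sum>y\<in>S. \<bar>A y * (w y - w (c y))\<bar>)" by (rule sum_abs)
  also have "\<dots> \<le> (\<Sum>y\<in>S. a * X)"
    unfolding abs_mult using A c close \<open>0 \<le> a\<close> by (intro sum_mono mult_mono) auto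
  finally show ?thesis by (simp add: mult_ac)
qed

text \<open>On a sign-free interval \<open>I\<close> of length \<open>l\<close> the integrals of \<open>G\<close> and of \<open>\<bar>G\<bar>\<close> agree up to sign. All frequencies
  being either at most \<open>X\<close> or more than \<open>X H\<close>, the former is small, while testing against a frequency of
  a cluster with nonzero coefficient sum shows that the latter is about \<open>l\<close>.\<close>

lemma sparse_sine_sum_bound:
  fixes S :: "int set" and A :: "int \<Rightarrow> int" and p a :: real and \<theta>s :: "real list" and G :: "real \<Rightarrow> real"
  defines "fr \<equiv> \<lambda>y. of_int y - p / 2"
  assumes fin: "finite S" "S \<noteq> {}" and A: "\<And>y. y \<in> S \<Longrightarrow> \<bar>real_of_int (A y)\<bar> \<le> a" and a: "a \<ge> 1"
    and p: "p \<ge> 1" and \<theta>s: "length \<theta>s \<le> r"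
    and G: "\<And>t. (\<Sum>y\<in>S. of_int (A y) * cis (fr y * t)) = \<i> * of_real (G t)"
    and sgn: "\<And>t. 0 < t \<Longrightarrow> t < 1 / p \<Longrightarrow> \<sigma> * G t * (\<Prod>\<theta>\<leftarrow>\<theta>s. \<theta> - t) \<ge> 0" and \<sigma>: "\<sigma> \<noteq> 0"
    and N: "N = real (card S)" and H: "H = 128 * a\<^sup>2 * N\<^sup>2 * real (r + 1)"
  shows "\<bar>\<Sum>y\<in>S. of_int (A y) * fr y\<bar> \<le> a * N * p * H ^ (card S * card S + card S)"
proof -
  have N1: "N \<ge> 1" using fin N by (simp add: Suc_le_eq card_gt_0_iff)
  have H1: "H \<ge> 128"
  proof -
    have "1 \<le> a\<^sup>2 * N\<^sup>2 * real (r + 1)"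
      using a N1 by (intro mult_ge1_I one_le_power) auto
    then show ?thesis by (simp add: H mult_ac)
  qed
  \<comment> \<open>The differences matter when \<open>G\<close> is tested against one of its
    frequencies, the frequencies themselves for the plain integral of \<open>G\<close>. Together
    they take at most N^2 + N values, whence the exponent of \<open>H\<close>.\<close>
  define D where "D = (\<lambda>(y, y'). \<bar>real_of_int (y - y')\<bar>) ` (S \<times> S) \<union> (\<lambda>y. \<bar>fr y\<bar>) ` S"
  have "card D \<le> card ((\<lambda>(y, y'). \<bar>real_of_int (y - y')\<bar>) ` (S \<times> S)) + card ((\<lambda>y. \<bar>fr y\<bar>) ` S)"
    unfolding D_def by (rule card_Un_le)
  also have "\<dots> \<le> card (S \<times> S) + card S" using fin by (intro add_mono card_image_le) auto
  finally have cD: "card D \<le> card S * card S + card S" by (simp add: card_cartesian_product)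
  have "finite D" using fin by (simp add: D_def)
  then obtain s where s: "s \<le> card D" "\<And>d. d \<in> D \<Longrightarrow> \<not> (p * H ^ s < d \<and> d \<le> p * H ^ Suc s)"
    using free_scale[of D p H] p H1 by auto
  define X where "X = p * H ^ s"
  have gap: "d \<le> X \<or> d > X * H" if "d \<in> D" for d using s(2)[OF that] by (auto simp: X_def mult_ac)
  have X1: "X \<ge> p" "X \<ge> 1"
  proof -
    have "1 \<le> H ^ s" using H1 by (intro one_le_power) auto
    then have "p * 1 \<le> p * H ^ s" using p by (intro mult_left_mono) auto
    then show "X \<ge> p" by (simp add: X_def)
    then show "X \<ge> 1" using p by simp
  qed
  have Xle: "X \<le> p * H ^ (card S * card S + card S)"
    unfolding X_def using s(1) cD H1 p by (intro mult_left_mono power_increasing) auto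
  have gapS: "\<bar>real_of_int (y - y')\<bar> \<le> X \<or> \<bar>real_of_int (y - y')\<bar> > X * H" if "y \<in> S" "y' \<in> S" for y y'
    using that by (intro gap) (force simp: D_def)
  have gap0: "\<bar>fr y\<bar> \<le> X \<or> \<bar>fr y\<bar> > X * H" if "y \<in> S" for y
    using that by (intro gap) (auto simp: D_def)
  have XH: "2 * X < X * H" "X * H > 0" using X1 H1 by auto
  define hi where "hi = {y \<in> S. \<bar>fr y\<bar> > X}"
  define C where "C y = {y' \<in> S. \<bar>real_of_int (y - y')\<bar> \<le> X}" for y
  have A0: "\<bar>real_of_int (A y)\<bar> \<le> a" if "y \<in> S" for y using A that by blast
  have zero: "(\<Sum>y'\<in>C ys. A y') = 0" if ys: "ys \<in> hi" for ys
  proof (rule ccontr)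
    assume nz: "(\<Sum>y'\<in>C ys. A y') \<noteq> 0"
    define \<rho> where "\<rho> = 8 * a * N"
    have \<rho>: "\<rho> \<ge> 8" unfolding \<rho>_def using mult_ge1_I[OF a N1] by simp
    \<comment> \<open>The \<open>r + 1\<close> adjacent intervals of this length fill (0, 1/(X
      \<rho>)). That range lies inside (0, 1/p) because X is at least p, and on it the phase of a
      frequency of size at most X moves by at most 1/\<rho>.\<close>
    define l where "l = 1 / (X * \<rho> * real (r + 1))"
    have l: "l > 0" unfolding l_def using X1 \<rho> by auto
    obtain k where k: "k \<le> r" "\<And>\<theta>. \<theta> \<in> set \<theta>s \<Longrightarrow> \<not> (real k * l < \<theta> \<and> \<theta> < real (Suc k) * l)"
      using free_subinterval[OF \<theta>s l] by blast
    define \<alpha> where "\<alpha> = real k * l"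
    define \<beta> where "\<beta> = real (Suc k) * l"
    have ab: "0 \<le> \<alpha>" "\<alpha> < \<beta>" "\<beta> - \<alpha> = l" using l by (auto simp: \<alpha>_def \<beta>_def algebra_simps)
    have \<beta>\<tau>: "X * \<beta> \<le> 1 / \<rho>"
    proof -
      have "\<beta> \<le> real (r + 1) * l" unfolding \<beta>_def using k l by (intro mult_right_mono) auto
      also have "\<dots> = 1 / (X * \<rho>)" by (simp add: l_def del: of_nat_add)
      finally have "X * \<beta> \<le> X * (1 / (X * \<rho>))" using X1 by (intro mult_left_mono) auto
      then show ?thesis using X1 by simp
    qed
    have \<beta>p: "\<beta> < 1 / p"
    proof -
      have "p * \<beta> \<le> X * \<beta>" using X1 ab by (intro mult_right_mono) auto
      also have "\<dots> \<le> 1 / \<rho>" by (rule \<beta>\<tau>)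
      also have "\<dots> < 1" using \<rho> by simp
      finally show ?thesis using p by (simp add: field_simps)
    qed
    define I where "I f = integral {\<alpha>..\<beta>} f" for f :: "real \<Rightarrow> complex"
    have Gc: "continuous_on UNIV G"
    proof -
      have "G t = Im (\<Sum>y\<in>S. of_int (A y) * cis (fr y * t))" for t unfolding G by simp
      then have "G = (\<lambda>t. Im (\<Sum>y\<in>S. of_int (A y) * cis (fr y * t)))" by auto
      then show ?thesis by (simp only:) (intro continuous_intros)
    qed
    have Gi: "G integrable_on {\<alpha>..\<beta>}" "(\<lambda>t. \<bar>G t\<bar>) integrable_on {\<alpha>..\<beta>}"
      by (intro integrable_continuous_interval continuous_intros continuous_on_subset[OF Gc]; simp)+
    have absG: "integral {\<alpha>..\<beta>} (\<lambda>t. \<bar>G t\<bar>) = \<bar>integral {\<alpha>..\<beta>} G\<bar>"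
    proof -
      have "\<exists>\<tau>. \<bar>\<tau>\<bar> = 1 \<and> (\<forall>t. \<alpha> < t \<longrightarrow> t < \<beta> \<longrightarrow> \<tau> * (\<Prod>\<theta>\<leftarrow>\<theta>s'. \<theta> - t) > (0::real))"
        if "\<And>\<theta>. \<theta> \<in> set \<theta>s' \<Longrightarrow> \<theta> \<in> set \<theta>s" for \<theta>s'
        using that
      proof (induction \<theta>s')
        case Nil then show ?case by (intro exI[of _ 1]) auto
      next
        case (Cons \<theta> \<theta>s')
        then obtain \<tau> where \<tau>: "\<bar>\<tau>\<bar> = 1" "\<And>t. \<alpha> < t \<Longrightarrow> t < \<beta> \<Longrightarrow> \<tau> * (\<Prod>\<theta>\<leftarrow>\<theta>s'. \<theta> - t) > 0" by auto
        have "\<theta> \<le> \<alpha> \<or> \<theta> \<ge> \<beta>" using k(2)[of \<theta>] Cons.prems[of \<theta>] unfolding \<alpha>_def \<beta>_def by force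
        then show ?case
        proof
          assume *: "\<theta> \<le> \<alpha>"
          have "(- \<tau>) * ((\<theta> - t) * (\<Prod>\<theta>\<leftarrow>\<theta>s'. \<theta> - t)) > 0" if "\<alpha> < t" "t < \<beta>" for t
          proof -
            have "0 < (t - \<theta>) * (\<tau> * (\<Prod>\<theta>\<leftarrow>\<theta>s'. \<theta> - t))" by (rule mult_pos_pos) (use * that \<tau>(2)[OF that] in auto)
            then show ?thesis by (simp add: algebra_simps)
          qed
          then show ?thesis using \<tau>(1) by (intro exI[of _ "- \<tau>"]) auto
        next
          assume *: "\<theta> \<ge> \<beta>"
          have "\<tau> * ((\<theta> - t) * (\<Prod>\<theta>\<leftarrow>\<theta>s'. \<theta> - t)) > 0" if "\<alpha> < t" "t < \<beta>" for t
          proof -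
            have "0 < (\<theta> - t) * (\<tau> * (\<Prod>\<theta>\<leftarrow>\<theta>s'. \<theta> - t))" by (rule mult_pos_pos) (use * that \<tau>(2)[OF that] in auto)
            then show ?thesis by (simp add: algebra_simps)
          qed
          then show ?thesis using \<tau>(1) by (intro exI[of _ "\<tau>"]) auto
        qed
      qed
      from this[of \<theta>s] obtain \<tau> where \<tau>: "\<bar>\<tau>\<bar> = 1" "\<And>t. \<alpha> < t \<Longrightarrow> t < \<beta> \<Longrightarrow> \<tau> * (\<Prod>\<theta>\<leftarrow>\<theta>s. \<theta> - t) > 0" by auto
      define \<kappa> where "\<kappa> = sgn \<sigma> * \<tau>"
      have \<kappa>: "\<bar>\<kappa>\<bar> = 1" using \<sigma> \<tau>(1) by (simp add: \<kappa>_def abs_mult)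
      have pos: "\<kappa> * G t \<ge> 0" if t: "\<alpha> < t" "t < \<beta>" for t
      proof -
        have "\<sigma> * G t * (\<Prod>\<theta>\<leftarrow>\<theta>s. \<theta> - t) \<ge> 0" using t ab \<beta>p by (intro sgn) auto
        then have "(\<sigma> * G t * (\<Prod>\<theta>\<leftarrow>\<theta>s. \<theta> - t)) * (\<tau> * (\<Prod>\<theta>\<leftarrow>\<theta>s. \<theta> - t)) \<ge> 0"
          using \<tau>(2)[OF t] by simp
        then have "(\<bar>\<sigma>\<bar> * (\<Prod>\<theta>\<leftarrow>\<theta>s. \<theta> - t)\<^sup>2) * (\<kappa> * G t) \<ge> 0"
          unfolding \<kappa>_def by (simp add: power2_eq_square abs_sgn mult_ac)
        moreover have "\<bar>\<sigma>\<bar> * (\<Prod>\<theta>\<leftarrow>\<theta>s. \<theta> - t)\<^sup>2 > 0" by (rule mult_pos_pos) (use \<sigma> \<tau>(2)[OF t] in auto)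
        ultimately show ?thesis by (simp add: zero_le_mult_iff)
      qed
      have "integral {\<alpha>..\<beta>} (\<lambda>t. \<bar>G t\<bar>) = integral {\<alpha>..\<beta>} (\<lambda>t. \<kappa> * G t)"
      proof (rule integral_spike[of "{\<alpha>, \<beta>}"])
        fix t assume "t \<in> {\<alpha>..\<beta>} - {\<alpha>, \<beta>}"
        then have "\<kappa> * G t \<ge> 0" by (intro pos) auto
        moreover have "\<bar>\<kappa> * G t\<bar> = \<bar>G t\<bar>" using \<kappa> by (simp add: abs_mult)
        ultimately show "\<kappa> * G t = \<bar>G t\<bar>" by linarith
      qed auto
      also have "\<dots> = \<kappa> * integral {\<alpha>..\<beta>} G" by simp
      finally have "\<bar>integral {\<alpha>..\<beta>} (\<lambda>t. \<bar>G t\<bar>)\<bar> = \<bar>integral {\<alpha>..\<beta>} G\<bar>" using \<kappa> by (simp add: abs_mult)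
      moreover have "integral {\<alpha>..\<beta>} (\<lambda>t. \<bar>G t\<bar>) \<ge> 0" by (intro integral_nonneg Gi) auto
      ultimately show ?thesis by simp
    qed
    have ysS: "ys \<in> S" "\<bar>fr ys\<bar> > X" using ys by (auto simp: hi_def)
    define e where "e = l / \<rho> + 2 / (X * H)"
    have small: "norm (I (\<lambda>t. cis (\<theta> * t)) - of_real l) \<le> e" if "\<bar>\<theta>\<bar> \<le> X" for \<theta>
    proof -
      have "norm (I (\<lambda>t. cis (\<theta> * t)) - of_real l) \<le> l * (\<bar>\<theta>\<bar> * \<beta>)"
        using integral_cis_close[of \<alpha> \<beta> \<theta>] ab by (simp add: I_def)
      also have "\<dots> \<le> l * (1 / \<rho>)"
      proof -
        have "\<bar>\<theta>\<bar> * \<beta> \<le> X * \<beta>" using that ab by (intro mult_right_mono) auto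
        then show ?thesis using \<beta>\<tau> l by (intro mult_left_mono) auto
      qed
      also have "\<dots> \<le> e" using XH by (simp add: e_def)
      finally show ?thesis .
    qed
    have large: "norm (I (\<lambda>t. cis (\<theta> * t))) \<le> e" if "\<bar>\<theta>\<bar> > X * H" for \<theta>
    proof -
      have "norm (I (\<lambda>t. cis (\<theta> * t))) \<le> 2 / \<bar>\<theta>\<bar>"
        unfolding I_def using that XH ab by (intro norm_integral_cis_le) auto
      also have "\<dots> \<le> 2 / (X * H)" using that XH by (intro divide_left_mono) auto
      also have "\<dots> \<le> e" using l \<rho> by (simp add: e_def)
      finally show ?thesis .
    qed
    have e0: "e \<ge> 0" unfolding e_def using l \<rho> XH by auto
    have main: "a * N * e \<ge> norm (I (\<lambda>t. \<i> * of_real (G t) * cis (- fr ys * t)) - of_int (\<Sum>y'\<in>C ys. A y') * of_real l)"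
    proof -
      have int: "(\<lambda>t. of_int (A y) * cis (real_of_int (y - ys) * t)) integrable_on {\<alpha>..\<beta>}" for y
        by (intro integrable_continuous_interval continuous_intros)
      have "\<i> * of_real (G t) * cis (- fr ys * t) = (\<Sum>y\<in>S. of_int (A y) * cis (real_of_int (y - ys) * t))" for t
      proof -
        have "cis (fr y * t) * cis (- fr ys * t) = cis (real_of_int (y - ys) * t)" for y
          by (simp add: cis_mult fr_def algebra_simps)
        then show ?thesis unfolding G[symmetric] sum_distrib_right by (simp only: mult.assoc)
      qed
      then have "I (\<lambda>t. \<i> * of_real (G t) * cis (- fr ys * t)) = (\<Sum>y\<in>S. of_int (A y) * I (\<lambda>t. cis (real_of_int (y - ys) * t)))"
        unfolding I_def by (simp only:) (subst integral_sum, use fin int in \<open>auto simp del: of_int_diff\<close>)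
      moreover have "of_int (\<Sum>y'\<in>C ys. A y') * complex_of_real l = (\<Sum>y\<in>S. of_int (A y) * (if y \<in> C ys then of_real l else 0))"
      proof -
        have "(\<Sum>y\<in>S. of_int (A y) * (if y \<in> C ys then complex_of_real l else 0)) = (\<Sum>y\<in>C ys. of_int (A y) * complex_of_real l)"
          by (rule sum.mono_neutral_cong_right) (use fin in \<open>auto simp: C_def\<close>)
        then show ?thesis by (simp add: sum_distrib_right)
      qed
      ultimately have "I (\<lambda>t. \<i> * of_real (G t) * cis (- fr ys * t)) - of_int (\<Sum>y'\<in>C ys. A y') * of_real l
         = (\<Sum>y\<in>S. of_int (A y) * (I (\<lambda>t. cis (real_of_int (y - ys) * t)) - (if y \<in> C ys then of_real l else 0)))"
        by (simp only: right_diff_distrib sum_subtractf)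
      also have "norm \<dots> \<le> (\<Sum>y\<in>S. a * e)"
      proof (rule sum_norm_le)
        fix y assume y: "y \<in> S"
        have "norm (I (\<lambda>t. cis (real_of_int (y - ys) * t)) - (if y \<in> C ys then of_real l else 0)) \<le> e"
        proof (cases "y \<in> C ys")
          case True
          then have "\<bar>real_of_int (y - ys)\<bar> \<le> X" by (auto simp: C_def abs_minus_commute)
          then show ?thesis using True by (simp only: if_True small)
        next
          case False
          then have "\<bar>real_of_int (y - ys)\<bar> > X * H" using y gapS[OF y ysS(1)] by (auto simp: C_def abs_minus_commute)
          then show ?thesis using False by (simp only: if_False large diff_zero)
        qed
        then show "norm (of_int (A y) * (I (\<lambda>t. cis (real_of_int (y - ys) * t)) - (if y \<in> C ys then of_real l else 0))) \<le> a * e"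
          unfolding norm_mult using A0[OF y] a by (intro mult_mono) auto
      qed
      also have "\<dots> = a * N * e" by (simp add: N)
      finally show ?thesis .
    qed
    have "l \<le> norm (of_int (\<Sum>y'\<in>C ys. A y') * complex_of_real l)"
    proof -
      have "1 \<le> \<bar>real_of_int (\<Sum>y'\<in>C ys. A y')\<bar>" using nz by linarith
      then have "1 * l \<le> \<bar>real_of_int (\<Sum>y'\<in>C ys. A y')\<bar> * l" using l by (intro mult_right_mono) auto
      then show ?thesis using l by (simp add: norm_mult del: of_int_sum)
    qed
    then have low: "l - a * N * e \<le> norm (I (\<lambda>t. \<i> * of_real (G t) * cis (- fr ys * t)))"
      using main norm_triangle_ineq2[of "of_int (\<Sum>y'\<in>C ys. A y') * complex_of_real l" "I (\<lambda>t. \<i> * of_real (G t) * cis (- fr ys * t))"]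
      by (simp only: norm_minus_commute)
    also have "norm (I (\<lambda>t. \<i> * of_real (G t) * cis (- fr ys * t))) \<le> integral {\<alpha>..\<beta>} (\<lambda>t. \<bar>G t\<bar>)"
      unfolding I_def
    proof (rule integral_norm_bound_integral)
      show "(\<lambda>t. \<i> * of_real (G t) * cis (- fr ys * t)) integrable_on {\<alpha>..\<beta>}"
        by (intro integrable_continuous_interval continuous_intros continuous_on_subset[OF Gc]) auto
    qed (use Gi in \<open>auto simp: norm_mult\<close>)
    also have "\<dots> = \<bar>integral {\<alpha>..\<beta>} G\<bar>" by (rule absG)
    also have "\<dots> \<le> a * N * e"
    proof -
      have "I (\<lambda>t. \<i> * of_real (G t)) = (\<Sum>y\<in>S. of_int (A y) * I (\<lambda>t. cis (fr y * t)))"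
      proof -
        have "(\<lambda>t. of_int (A y) * cis (fr y * t)) integrable_on {\<alpha>..\<beta>}" for y
          by (intro integrable_continuous_interval continuous_intros)
        then show ?thesis unfolding G[symmetric] I_def by (subst integral_sum) (use fin in auto)
      qed
      moreover have "I (\<lambda>t. \<i> * of_real (G t)) = \<i> * of_real (integral {\<alpha>..\<beta>} G)"
      proof -
        have "((\<lambda>t. of_real (G t)) has_integral (of_real (integral {\<alpha>..\<beta>} G) :: complex)) {\<alpha>..\<beta>}"
          using has_integral_linear[OF integrable_integral[OF Gi(1)] bounded_linear_of_real] by (simp add: o_def)
        then have "((\<lambda>t. \<i> * of_real (G t)) has_integral (\<i> * of_real (integral {\<alpha>..\<beta>} G))) {\<alpha>..\<beta>}"
          by (rule has_integral_mult_right)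
        then show ?thesis unfolding I_def by (rule integral_unique)
      qed
      \<comment> \<open>A low frequency contributes nearly \<open>A y * l\<close>, which is not
        small but real. The sum is purely imaginary, so taking imaginary parts discards these
        contributions.\<close>
      ultimately have "integral {\<alpha>..\<beta>} G = Im (\<Sum>y\<in>S. of_int (A y) * I (\<lambda>t. cis (fr y * t)))"
        by (metis Im_i_times Re_complex_of_real)
      also have "\<dots> = (\<Sum>y\<in>S. of_int (A y) * Im (I (\<lambda>t. cis (fr y * t))))" by simp
      also have "\<bar>\<dots>\<bar> \<le> (\<Sum>y\<in>S. \<bar>of_int (A y) * Im (I (\<lambda>t. cis (fr y * t)))\<bar>)" by (rule sum_abs)
      also have "\<dots> \<le> (\<Sum>y\<in>S. a * e)"
      proof (rule sum_mono)
        fix y assume y: "y \<in> S"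
        have "\<bar>Im (I (\<lambda>t. cis (fr y * t)))\<bar> \<le> e"
        proof (cases "\<bar>fr y\<bar> \<le> X")
          case True
          have "\<bar>Im (I (\<lambda>t. cis (fr y * t)))\<bar> = \<bar>Im (I (\<lambda>t. cis (fr y * t)) - of_real l)\<bar>" by simp
          also have "\<dots> \<le> norm (I (\<lambda>t. cis (fr y * t)) - of_real l)" by (rule abs_Im_le_cmod)
          also have "\<dots> \<le> e" by (rule small[OF True])
          finally show ?thesis .
        next
          case False
          have "\<bar>Im (I (\<lambda>t. cis (fr y * t)))\<bar> \<le> norm (I (\<lambda>t. cis (fr y * t)))" by (rule abs_Im_le_cmod)
          also have "\<dots> \<le> e" using False gap0[OF y] by (intro large) auto
          finally show ?thesis .
        qed
        then show "\<bar>of_int (A y) * Im (I (\<lambda>t. cis (fr y * t)))\<bar> \<le> a * e"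
          unfolding abs_mult using A0[OF y] a by (intro mult_mono) auto
      qed
      also have "\<dots> = a * N * e" by (simp add: N)
      finally show ?thesis .
    qed
    finally have "l \<le> 2 * (a * N) * e" by (simp add: mult_ac)
    \<comment> \<open>The values of \<rho> and \<open>H\<close> are chosen for this line: \<rho> = 8
      a N makes the low-frequency error l/4, and \<open>H\<close> makes the high-frequency error l/4
      as well.\<close>
    also have "\<dots> = l / 4 + 4 * (a * N) / (X * H)"
      using a N1 XH by (simp add: e_def \<rho>_def field_simps)
    also have "4 * (a * N) / (X * H) = l / 4"
    proof -
      have "4 * (a * N) / (X * (128 * a\<^sup>2 * N\<^sup>2 * R)) = 1 / (X * (8 * a * N) * R) / 4" if "R > 0" for R :: real
        using a N1 X1 that by (simp add: field_simps power2_eq_square)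
      from this[of "real (r + 1)"] show ?thesis unfolding l_def \<rho>_def H by simp
    qed
    finally show False using l by simp
  qed
  have hiS: "hi \<subseteq> S" by (auto simp: hi_def)
  have finhi: "finite hi" using hiS fin finite_subset by blast
  have Chi: "y' \<in> hi" "\<bar>real_of_int (y - y')\<bar> \<le> X" if "y \<in> hi" "y' \<in> C y" for y y'
  proof -
    show *: "\<bar>real_of_int (y - y')\<bar> \<le> X" using that by (auto simp: C_def)
    have "\<bar>fr y\<bar> > X * H" using gap0[of y] that by (auto simp: hi_def)
    then have "\<bar>fr y'\<bar> > X" using * XH by (auto simp: fr_def)
    then show "y' \<in> hi" using that by (auto simp: hi_def C_def)
  qed
  have "\<bar>\<Sum>y\<in>hi. of_int (A y) * fr y\<bar> \<le> a * real (card hi) * X"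
  proof (rule abs_sum_le_of_clusters[where C = C])
    show "y \<in> C y" if "y \<in> hi" for y using that X1 hiS by (auto simp: C_def)
    show "C y \<subseteq> hi" if "y \<in> hi" for y using Chi that by blast
    show "(\<Sum>y'\<in>C y. real_of_int (A y')) = 0" if "y \<in> hi" for y
      using zero[OF that] by (metis of_int_0 of_int_sum)
    show "\<bar>fr y - fr y'\<bar> \<le> X" if "y \<in> hi" "y' \<in> C y" for y y'
      using Chi(2)[OF that] by (simp add: fr_def)
    show "C y' = C y" if y: "y \<in> hi" "y' \<in> C y" for y y'
    proof -
      \<comment> \<open>Closeness is transitive: two distances of at most X add up to at most 2X <
        XH, and no difference lies between X and XH.\<close>
      have "\<bar>real_of_int (y' - z)\<bar> \<le> X \<longleftrightarrow> \<bar>real_of_int (y - z)\<bar> \<le> X" if "z \<in> S" for z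
      proof -
        have "y \<in> S" "y' \<in> S" using y Chi hiS by blast+
        then have "\<bar>real_of_int (y - z)\<bar> \<le> X \<or> \<bar>real_of_int (y - z)\<bar> > X * H"
          "\<bar>real_of_int (y' - z)\<bar> \<le> X \<or> \<bar>real_of_int (y' - z)\<bar> > X * H"
          using gapS that by blast+
        then show ?thesis
          by (elim disjE; intro iffI; use Chi(2)[OF y] XH(1) in \<open>unfold of_int_diff, linarith\<close>)
      qed
      then show ?thesis by (auto simp: C_def)
    qed
  qed (use finhi A0 hiS a in auto)
  moreover have "\<bar>\<Sum>y\<in>S - hi. of_int (A y) * fr y\<bar> \<le> a * real (card (S - hi)) * X"
  proof -
    have "\<bar>\<Sum>y\<in>S - hi. of_int (A y) * fr y\<bar> \<le> (\<Sum>y\<in>S - hi. \<bar>of_int (A y) * fr y\<bar>)" by (rule sum_abs)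
    also have "\<dots> \<le> (\<Sum>y\<in>S - hi. a * X)"
      unfolding abs_mult using A0 a by (intro sum_mono mult_mono) (auto simp: hi_def)
    finally show ?thesis by (simp add: mult_ac)
  qed
  moreover have "(\<Sum>y\<in>S. of_int (A y) * fr y) = (\<Sum>y\<in>S - hi. of_int (A y) * fr y) + (\<Sum>y\<in>hi. of_int (A y) * fr y)"
    by (rule sum.subset_diff) (use hiS fin in auto)
  moreover have "a * real (card (S - hi)) * X + a * real (card hi) * X = a * N * X"
  proof -
    have "real (card (S - hi)) + real (card hi) = N"
      using card_Diff_subset[OF finhi hiS] card_mono[OF fin(1) hiS] N by simp
    then show ?thesis by (simp only: distrib_left[symmetric] distrib_right[symmetric])
  qed
  ultimately have "\<bar>\<Sum>y\<in>S. of_int (A y) * fr y\<bar> \<le> a * N * X" by linarith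
  also have "\<dots> \<le> a * N * (p * H ^ (card S * card S + card S))"
    using Xle a N1 by (intro mult_left_mono) auto
  finally show ?thesis by (simp only: mult.assoc)
qed

section \<open>Cosine polynomials\<close>

text \<open>With z = \<open>cis t\<close>, each factor times z is 1 - 2 cos \<theta> z + z^2, whose
  coefficients have absolute sum at most 4. The shift by \<open>cis (k t)\<close> makes the spectrum
  start at 0 with \<open>q 0 = 1\<close>, the normalisation on which the annihilator argument
  rests.\<close>

lemma cosine_product_coefficients:
  fixes \<theta>s :: "real list"
  defines "k \<equiv> length \<theta>s"
  shows "\<exists>q :: nat \<Rightarrow> real. q 0 = 1 \<and> (\<Sum>l<2 * k + 1. \<bar>q l\<bar>) \<le> 4 ^ k \<and> (\<forall>l\<ge>2 * k + 1. q l = 0) \<and>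
     (\<forall>t. (\<Sum>l<2 * k + 1. of_real (q l) * cis (real l * t)) = cis (real k * t) * of_real (\<Prod>\<theta>\<leftarrow>\<theta>s. 2 * cos t - 2 * cos \<theta>))"
  unfolding k_def
proof (induction \<theta>s)
  case Nil
  show ?case by (intro exI[of _ "\<lambda>l. if l = 0 then 1 else 0"]) auto
next
  case (Cons \<theta> \<theta>s)
  define k where "k = length \<theta>s"
  obtain q :: "nat \<Rightarrow> real" where q: "q 0 = 1" "(\<Sum>l<2 * k + 1. \<bar>q l\<bar>) \<le> 4 ^ k" "\<And>l. l \<ge> 2 * k + 1 \<Longrightarrow> q l = 0"
    "\<And>t. (\<Sum>l<2 * k + 1. of_real (q l) * cis (real l * t)) = cis (real k * t) * of_real (\<Prod>\<theta>\<leftarrow>\<theta>s. 2 * cos t - 2 * cos \<theta>)"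
    using Cons.IH unfolding k_def by blast
  \<comment> \<open>\<open>q1\<close> and \<open>q2\<close> are the coefficients after
    multiplication by z and by z^2.\<close>
  define q1 where "q1 l = (case l of 0 \<Rightarrow> 0 | Suc l \<Rightarrow> q l)" for l
  define q2 where "q2 l = (case l of 0 \<Rightarrow> 0 | Suc l \<Rightarrow> q1 l)" for l
  define q' where "q' l = q l - 2 * cos \<theta> * q1 l + q2 l" for l
  have S0: "(\<Sum>l<2 * k + 3. f (q l) l) = (\<Sum>l<2 * k + 1. f (q l) l)" if "\<And>l. f 0 l = 0" for f :: "real \<Rightarrow> nat \<Rightarrow> 'a::comm_monoid_add"
    using that q(3) by (simp add: numeral_3_eq_3)
  have S1: "(\<Sum>l<2 * k + 3. f (q1 l) l) = (\<Sum>l<2 * k + 1. f (q l) (Suc l))" if "\<And>l. f 0 l = 0" for f :: "real \<Rightarrow> nat \<Rightarrow> 'a::comm_monoid_add"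
  proof -
    have "(\<Sum>l<Suc (2 * k + 2). f (q1 l) l) = (\<Sum>l<2 * k + 2. f (q l) (Suc l))"
      unfolding sum.lessThan_Suc_shift using that by (simp add: q1_def)
    then show ?thesis using that q(3) by (simp add: numeral_3_eq_3 numeral_2_eq_2)
  qed
  have S2: "(\<Sum>l<2 * k + 3. f (q2 l) l) = (\<Sum>l<2 * k + 1. f (q l) (Suc (Suc l)))" if "\<And>l. f 0 l = 0" for f :: "real \<Rightarrow> nat \<Rightarrow> 'a::comm_monoid_add"
  proof -
    have "(\<Sum>l<Suc (Suc (2 * k + 1)). f (q2 l) l) = (\<Sum>l<2 * k + 1. f (q l) (Suc (Suc l)))"
      unfolding sum.lessThan_Suc_shift using that by (simp add: q2_def q1_def)
    then show ?thesis by (simp add: numeral_3_eq_3 del: sum.lessThan_Suc)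
  qed
  have k3: "2 * length (\<theta> # \<theta>s) + 1 = 2 * k + 3" by (simp add: k_def)
  show ?case
    unfolding k3
  proof (intro exI[of _ q'] conjI allI impI)
    show "q' 0 = 1" by (simp add: q'_def q1_def q2_def q)
    show "q' l = 0" if "l \<ge> 2 * k + 3" for l
      using that q(3) by (auto simp: q'_def q1_def q2_def split: nat.splits)
    have "(\<Sum>l<2 * k + 3. \<bar>q' l\<bar>) \<le> (\<Sum>l<2 * k + 3. \<bar>q l\<bar> + 2 * \<bar>q1 l\<bar> + \<bar>q2 l\<bar>)"
    proof (rule sum_mono)
      fix l
      have "\<bar>2 * cos \<theta> * q1 l\<bar> \<le> 2 * \<bar>q1 l\<bar>" by (simp add: abs_mult mult_left_le_one_le)
      then show "\<bar>q' l\<bar> \<le> \<bar>q l\<bar> + 2 * \<bar>q1 l\<bar> + \<bar>q2 l\<bar>" unfolding q'_def by linarith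
    qed
    also have "\<dots> = (\<Sum>l<2 * k + 3. \<bar>q l\<bar>) + 2 * (\<Sum>l<2 * k + 3. \<bar>q1 l\<bar>) + (\<Sum>l<2 * k + 3. \<bar>q2 l\<bar>)"
      by (simp only: sum.distrib sum_distrib_left)
    also have "\<dots> = 4 * (\<Sum>l<2 * k + 1. \<bar>q l\<bar>)"
      using S0[of "\<lambda>x l. \<bar>x\<bar>"] S1[of "\<lambda>x l. \<bar>x\<bar>"] S2[of "\<lambda>x l. \<bar>x\<bar>"] by simp
    also have "\<dots> \<le> 4 ^ length (\<theta> # \<theta>s)" using q(2) by (simp add: k_def)
    finally show "(\<Sum>l<2 * k + 3. \<bar>q' l\<bar>) \<le> 4 ^ length (\<theta> # \<theta>s)" .
    fix t
    let ?S = "\<Sum>l<2 * k + 1. of_real (q l) * cis (real l * t)"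
    have "(\<Sum>l<2 * k + 3. of_real (q' l) * cis (real l * t))
      = (\<Sum>l<2 * k + 3. of_real (q l) * cis (real l * t)) - of_real (2 * cos \<theta>) * (\<Sum>l<2 * k + 3. of_real (q1 l) * cis (real l * t))
        + (\<Sum>l<2 * k + 3. of_real (q2 l) * cis (real l * t))"
      unfolding q'_def sum_distrib_left sum.distrib[symmetric] sum_subtractf[symmetric]
      by (intro sum.cong refl) (simp add: algebra_simps)
    also have "(\<Sum>l<2 * k + 3. of_real (q l) * cis (real l * t)) = ?S"
      by (rule S0[of "\<lambda>x l. of_real x * cis (real l * t)"]) simp
    also have "(\<Sum>l<2 * k + 3. of_real (q1 l) * cis (real l * t)) = cis t * ?S"
    proof -
      have "cis (real (Suc l) * t) = cis t * cis (real l * t)" for l by (simp add: cis_mult algebra_simps)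
      then show ?thesis
        by (subst S1[of "\<lambda>x l. of_real x * cis (real l * t)"]) (simp_all add: sum_distrib_left mult_ac del: sum.lessThan_Suc)
    qed
    also have "(\<Sum>l<2 * k + 3. of_real (q2 l) * cis (real l * t)) = cis (2 * t) * ?S"
    proof -
      have "cis (real (Suc (Suc l)) * t) = cis (2 * t) * cis (real l * t)" for l by (simp add: cis_mult algebra_simps)
      then show ?thesis
        by (subst S2[of "\<lambda>x l. of_real x * cis (real l * t)"]) (simp_all add: sum_distrib_left mult_ac del: sum.lessThan_Suc)
    qed
    also have "?S - of_real (2 * cos \<theta>) * (cis t * ?S) + cis (2 * t) * ?S
      = (1 - of_real (2 * cos \<theta>) * cis t + cis (2 * t)) * ?S" by (simp add: algebra_simps)
    also have "1 - of_real (2 * cos \<theta>) * cis t + cis (2 * t) = cis t * of_real (2 * cos t - 2 * cos \<theta>)"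
      by (rule complex_eqI) (simp_all add: cos_double_cos sin_double, simp_all add: algebra_simps power2_eq_square)
    also have "?S = cis (real k * t) * of_real (\<Prod>\<theta>\<leftarrow>\<theta>s. 2 * cos t - 2 * cos \<theta>)" by (rule q(4))
    also have "cis t * of_real (2 * cos t - 2 * cos \<theta>) * (cis (real k * t) * of_real (\<Prod>\<theta>\<leftarrow>\<theta>s. 2 * cos t - 2 * cos \<theta>))
       = cis (real (length (\<theta> # \<theta>s)) * t) * of_real (\<Prod>\<theta>\<leftarrow>\<theta> # \<theta>s. 2 * cos t - 2 * cos \<theta>)"
    proof -
      have "cis (real (length (\<theta> # \<theta>s)) * t) = cis t * cis (real k * t)" by (simp add: cis_mult k_def algebra_simps)
      then show ?thesis by (simp only: list.map prod_list.Cons of_real_mult mult_ac)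
    qed
    finally show "(\<Sum>l<2 * k + 3. of_real (q' l) * cis (real l * t)) =
        cis (real (length (\<theta> # \<theta>s)) * t) * of_real (\<Prod>\<theta>\<leftarrow>\<theta> # \<theta>s. 2 * cos t - 2 * cos \<theta>)" .
  qed
qed

text \<open>The cosine decreases on [0, pi], so each factor 2 cos t - 2 cos \<theta> is a
  nonnegative multiple of \<theta> - t.\<close>

lemma sign_cos_product:
  assumes "set \<theta>s \<subseteq> {0..pi}" "0 < t" "t < pi" "f * (\<Prod>\<theta>\<leftarrow>\<theta>s. \<theta> - t) \<ge> (0::real)"
  shows "f * (\<Prod>\<theta>\<leftarrow>\<theta>s. 2 * cos t - 2 * cos \<theta>) \<ge> 0"
proof -
  have "\<exists>c\<ge>0. (\<Prod>\<theta>\<leftarrow>\<theta>s. 2 * cos t - 2 * cos \<theta>) = c * (\<Prod>\<theta>\<leftarrow>\<theta>s. \<theta> - t)" using assms(1)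
  proof (induction \<theta>s)
    case Nil then show ?case by (intro exI[of _ 1]) auto
  next
    case (Cons \<theta> \<theta>s)
    then obtain c where c: "c \<ge> 0" "(\<Prod>\<theta>\<leftarrow>\<theta>s. 2 * cos t - 2 * cos \<theta>) = c * (\<Prod>\<theta>\<leftarrow>\<theta>s. \<theta> - t)" by auto
    have th: "0 \<le> \<theta>" "\<theta> \<le> pi" using Cons.prems by auto
    \<comment> \<open>At \<theta> = t the quotient is 0 by convention; both sides of the identity
      below vanish there.\<close>
    define d where "d = (2 * cos t - 2 * cos \<theta>) / (\<theta> - t)"
    have d: "2 * cos t - 2 * cos \<theta> = d * (\<theta> - t)" by (cases "\<theta> = t") (auto simp: d_def)
    have "d \<ge> 0"
    proof (cases "\<theta> \<ge> t")
      case True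
      then have "cos \<theta> \<le> cos t" using th assms by (intro cos_monotone_0_pi_le) auto
      then show ?thesis using True unfolding d_def by (intro divide_nonneg_nonneg) auto
    next
      case False
      then have "cos t \<le> cos \<theta>" using th assms by (intro cos_monotone_0_pi_le) auto
      then show ?thesis using False unfolding d_def by (intro divide_nonpos_nonpos) auto
    qed
    then show ?case using c d by (intro exI[of _ "d * c"]) (auto simp: mult_ac)
  qed
  then obtain c where "c \<ge> 0" "(\<Prod>\<theta>\<leftarrow>\<theta>s. 2 * cos t - 2 * cos \<theta>) = c * (\<Prod>\<theta>\<leftarrow>\<theta>s. \<theta> - t)" by blast
  then show ?thesis using assms(4) by (simp add: mult.left_commute)
qed

lemma sum_shift_int:
  fixes f :: "int \<Rightarrow> 'a::comm_monoid_add"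
  assumes "finite W" "(\<lambda>x. x + c) ` {-int n..int n} \<subseteq> W" and f: "\<And>x. x \<in> W \<Longrightarrow> x - c \<notin> {-int n..int n} \<Longrightarrow> f x = 0"
  shows "(\<Sum>x\<in>W. f x) = (\<Sum>x=-int n..int n. f (x + c))"
proof -
  have "(\<Sum>x\<in>W. f x) = (\<Sum>x\<in>(\<lambda>x. x + c) ` {-int n..int n}. f x)"
  proof (rule sum.mono_neutral_right[OF assms(1,2)])
    show "\<forall>x\<in>W - (\<lambda>x. x + c) ` {- int n..int n}. f x = 0"
    proof
      fix x assume x: "x \<in> W - (\<lambda>x. x + c) ` {- int n..int n}"
      then have "x - c \<notin> {-int n..int n}" by (metis DiffD2 diff_add_cancel image_eqI)
      then show "f x = 0" using f x by blast
    qed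
  qed
  also have "\<dots> = (\<Sum>x=-int n..int n. f (x + c))" by (subst sum.reindex) (auto simp: inj_on_def)
  finally show ?thesis .
qed

section \<open>From the polynomial to its cosine polynomial\<close>

text \<open>The Fourier coefficients of T. Extending them by zero to all integers allows shifts
  without boundary conditions.\<close>

definition centred_coeff :: "int poly \<Rightarrow> nat \<Rightarrow> int \<Rightarrow> int" where
  "centred_coeff P n x = (if \<bar>x\<bar> \<le> int n then coeff P (nat (x + int n)) else 0)"

lemma sum_centred_coeff:
  fixes P :: "int poly" and f :: "int \<Rightarrow> 'a::comm_ring_1"
  shows "(\<Sum>x=-int n..int n. of_int (centred_coeff P n x) * f x) = (\<Sum>j\<le>2 * n. of_int (coeff P j) * f (int j - int n))"
  by (rule sum.reindex_bij_witness[where i = "\<lambda>j. int j - int n" and j = "\<lambda>x. nat (x + int n)"])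
     (auto simp: centred_coeff_def)

lemma poly_1_eq_sum_centred:
  assumes "degree P \<le> 2 * n"
  shows "poly P 1 = (\<Sum>x=-int n..int n. centred_coeff P n x)"
proof -
  have "poly P 1 = (\<Sum>j\<le>degree P. coeff P j)" by (simp add: poly_altdef)
  also have "\<dots> = (\<Sum>j\<le>2 * n. coeff P j)"
    by (rule sum.mono_neutral_left) (use assms in \<open>auto simp: coeff_eq_0\<close>)
  also have "\<dots> = (\<Sum>x=-int n..int n. centred_coeff P n x)"
    using sum_centred_coeff[of P n "\<lambda>_. 1 :: int"] by simp
  finally show ?thesis .
qed

text \<open>Conjugation reverses the order of the coefficients, so by symmetry the value is its own
  conjugate and the real part in \<open>assoc_cos_poly\<close> discards nothing.\<close>

lemma assoc_cos_poly_eq: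
  fixes P :: "int poly"
  assumes deg: "degree P \<le> 2 * n" and sym: "\<And>j. j \<le> 2 * n \<Longrightarrow> coeff P j = coeff P (2 * n - j)"
  shows "poly (map_poly of_int P) (cis t) * cis (- (real n * t)) = of_real (assoc_cos_poly P n t)"
    and "of_real (assoc_cos_poly P n t) = (\<Sum>x=-int n..int n. of_int (centred_coeff P n x) * cis (of_int x * t))"
proof -
  define Z where "Z = poly (map_poly of_int P) (cis t) * cis (- (real n * t))"
  have "poly (map_poly of_int P) (cis t) = (\<Sum>j\<le>degree P. of_int (coeff P j) * cis t ^ j)"
    by (simp add: poly_altdef coeff_map_poly degree_map_poly)
  also have "\<dots> = (\<Sum>j\<le>2 * n. of_int (coeff P j) * cis t ^ j)"
    by (rule sum.mono_neutral_left) (use deg in \<open>auto simp: coeff_eq_0\<close>)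
  finally have "Z = (\<Sum>j\<le>2 * n. of_int (coeff P j) * (cis t ^ j * cis (- (real n * t))))"
    by (simp add: Z_def sum_distrib_right mult.assoc)
  also have "\<dots> = (\<Sum>j\<le>2 * n. of_int (coeff P j) * cis (of_int (int j - int n) * t))"
    by (intro sum.cong refl) (simp add: Complex.DeMoivre cis_mult algebra_simps)
  finally have Z1: "Z = (\<Sum>j\<le>2 * n. of_int (coeff P j) * cis (of_int (int j - int n) * t))" .
  have "cnj Z = (\<Sum>j\<le>2 * n. of_int (coeff P j) * cis (of_int (int n - int j) * t))"
    by (simp add: Z1 cis_cnj algebra_simps)
  also have "\<dots> = (\<Sum>j\<le>2 * n. of_int (coeff P (2 * n - j)) * cis (of_int (int n - int (2 * n - j)) * t))"
    by (rule sum.reindex_bij_witness[where i = "\<lambda>j. 2 * n - j" and j = "\<lambda>j. 2 * n - j"]) auto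
  also have "\<dots> = Z"
    unfolding Z1
  proof (rule sum.cong[OF refl])
    fix j assume "j \<in> {..2 * n}"
    then have "coeff P (2 * n - j) = coeff P j" "int n - int (2 * n - j) = int j - int n" using sym[of j] by auto
    then show "of_int (coeff P (2 * n - j)) * cis (of_int (int n - int (2 * n - j)) * t) = of_int (coeff P j) * cis (of_int (int j - int n) * t)"
      by (simp only:)
  qed
  finally have "of_real (Re Z) = Z" by (metis Reals_cnj_iff complex_is_Real_iff of_real_Re)
  then show 1: "Z = of_real (assoc_cos_poly P n t)" by (simp add: assoc_cos_poly_def Z_def)
  then show "of_real (assoc_cos_poly P n t) = (\<Sum>x=-int n..int n. of_int (centred_coeff P n x) * cis (of_int x * t))"
    unfolding sum_centred_coeff Z1[symmetric] by simp
qed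

lemma continuous_on_assoc_cos_poly: "continuous_on A (assoc_cos_poly P n)"
proof -
  have "assoc_cos_poly P n = (\<lambda>t. Re (poly (map_poly of_int P) (cis t) * cis (- (real n * t))))"
    by (rule ext) (rule assoc_cos_poly_def)
  then show ?thesis by (simp only:) (intro continuous_intros)
qed

section \<open>Sign changes and roots on the circle\<close>

text \<open>Between consecutive points lies a zero of T, and zeros within less than one period give
  distinct roots of P on the unit circle. The bound ensures that the supremum in
  \<open>NZ_star\<close> is taken over a bounded set.\<close>

lemma sign_changes_le:
  fixes t :: "nat \<Rightarrow> real"
  assumes deg: "degree P \<le> 2 * n" and sym: "\<And>j. j \<le> 2 * n \<Longrightarrow> coeff P j = coeff P (2 * n - j)" and P: "P \<noteq> 0"
    and t: "\<And>j. j < k \<Longrightarrow> t j < t (Suc j)" "t k < t 0 + 2 * pi"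
      "\<And>j. j < k \<Longrightarrow> assoc_cos_poly P n (t j) * assoc_cos_poly P n (t (Suc j)) < 0"
  shows "k \<le> 2 * n"
proof -
  let ?T = "assoc_cos_poly P n"
  have "\<exists>s. t j < s \<and> s < t (Suc j) \<and> ?T s = 0" if j: "j < k" for j
  proof -
    have cont: "continuous_on {t j..t (Suc j)} ?T" by (rule continuous_on_assoc_cos_poly)
    have "?T (t j) < 0 \<and> 0 < ?T (t (Suc j)) \<or> 0 < ?T (t j) \<and> ?T (t (Suc j)) < 0"
      using t(3)[OF j] by (auto simp: mult_less_0_iff)
    then obtain s where "t j \<le> s" "s \<le> t (Suc j)" "?T s = 0"
      using IVT'[of ?T "t j" 0 "t (Suc j)"] IVT2'[of ?T "t (Suc j)" 0 "t j"] t(1)[OF j] cont by force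
    moreover have "?T (t j) \<noteq> 0" "?T (t (Suc j)) \<noteq> 0" using t(3)[OF j] by auto
    ultimately show ?thesis by (metis order_le_less)
  qed
  then obtain s where s: "\<And>j. j < k \<Longrightarrow> t j < s j \<and> s j < t (Suc j) \<and> ?T (s j) = 0" by metis
  have tm: "t i \<le> t j" if "i \<le> j" "j \<le> k" for i j
    using that
  proof (induction j rule: dec_induct)
    case (step j)
    then show ?case using t(1)[of j] by simp
  qed simp
  have sm: "s i < s j" if "i < j" "j < k" for i j
    using s[of i] s[of j] tm[of "Suc i" j] that by fastforce
  have rng: "t 0 < s j \<and> s j < t 0 + 2 * pi" if "j < k" for j
    using s[OF that] tm[of 0 j] tm[of "Suc j" k] t(2) that by fastforce
  let ?Q = "map_poly of_int P :: complex poly"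
  have Q0: "?Q \<noteq> 0" using P by (simp add: map_poly_eq_0_iff)
  have inj: "inj_on (\<lambda>j. cis (s j)) {..<k}"
  proof (rule linorder_inj_onI)
    fix i j assume "i < j" "i \<in> {..<k}" "j \<in> {..<k}"
    then have "0 < s j - s i" "s j - s i < 2 * pi" using sm[of i j] rng[of i] rng[of j] by auto
    then have u: "0 < s j - s i" "s j - s i < 1 * (2 * pi)" by simp_all
    have "cis (s j - s i) \<noteq> 1"
    proof
      assume "cis (s j - s i) = 1"
      then have "cos (s j - s i) = 1" by (simp add: complex_eq_iff)
      then obtain z :: int where z: "s j - s i = of_int z * (2 * pi)" by (auto simp: cos_one_2pi_int)
      then have "of_int z > (0::real)" "of_int z < (1::real)"
        using u pi_gt_zero by (simp_all add: zero_less_mult_iff)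
      then show False by simp
    qed
    then show "cis (s i) \<noteq> cis (s j)" by (metis cis_divide cis_neq_zero divide_self)
  qed auto
  have "k = card ((\<lambda>j. cis (s j)) ` {..<k})" using card_image[OF inj] by simp
  also have "\<dots> \<le> card {z. poly ?Q z = 0}"
  proof (rule card_mono)
    show "finite {z. poly ?Q z = 0}" using Q0 by (rule poly_roots_finite)
    show "(\<lambda>j. cis (s j)) ` {..<k} \<subseteq> {z. poly ?Q z = 0}"
    proof
      fix z assume "z \<in> (\<lambda>j. cis (s j)) ` {..<k}"
      then obtain j where j: "j < k" "z = cis (s j)" by auto
      have "poly ?Q (cis (s j)) * cis (- (real n * s j)) = 0"
        using assoc_cos_poly_eq(1)[OF deg sym, of "s j"] s[OF j(1)] by simp
      then show "z \<in> {z. poly ?Q z = 0}" using j by simp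
    qed
  qed
  also have "\<dots> \<le> degree ?Q" by (rule card_poly_roots_bound[OF Q0])
  also have "\<dots> \<le> 2 * n" using deg by (simp add: degree_map_poly)
  finally show ?thesis .
qed

lemma NZ_star_ge:
  fixes t :: "nat \<Rightarrow> real"
  assumes deg: "degree P \<le> 2 * n" and sym: "\<And>j. j \<le> 2 * n \<Longrightarrow> coeff P j = coeff P (2 * n - j)" and P: "P \<noteq> 0"
    and t: "\<And>j. j < k \<Longrightarrow> t j < t (Suc j)" "t k < t 0 + 2 * pi"
      "\<And>j. j < k \<Longrightarrow> assoc_cos_poly P n (t j) * assoc_cos_poly P n (t (Suc j)) < 0"
  shows "k \<le> NZ_star (assoc_cos_poly P n)"
  unfolding NZ_star_def
proof (rule cSup_upper)
  show "k \<in> {k. \<exists>t :: nat \<Rightarrow> real. (\<forall>j<k. t j < t (Suc j)) \<and> t k < t 0 + 2 * pi \<and>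
      (\<forall>j<k. assoc_cos_poly P n (t j) * assoc_cos_poly P n (t (Suc j)) < 0)}" using t by blast
  show "bdd_above {k. \<exists>t :: nat \<Rightarrow> real. (\<forall>j<k. t j < t (Suc j)) \<and> t k < t 0 + 2 * pi \<and>
      (\<forall>j<k. assoc_cos_poly P n (t j) * assoc_cos_poly P n (t (Suc j)) < 0)}"
    by (rule bdd_aboveI[of _ "2 * n"]) (use sign_changes_le[OF deg sym P] in blast)
qed

text \<open>\<open>r\<close> points give \<open>r - 1\<close> changes, whence the
  \<open>+ 1\<close>, and points in (0, pi) fit inside one period.\<close>

lemma alternates_le_NZ_star:
  assumes deg: "degree P \<le> 2 * n" and sym: "\<And>j. j \<le> 2 * n \<Longrightarrow> coeff P j = coeff P (2 * n - j)" and P: "P \<noteq> 0"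
    and alt: "alternates (assoc_cos_poly P n) \<sigma> 0 pi r"
  shows "r \<le> NZ_star (assoc_cos_poly P n) + 1"
proof (cases r)
  case (Suc k)
  let ?T = "assoc_cos_poly P n"
  from alt obtain t where t: "\<And>i. i < r \<Longrightarrow> 0 < t i \<and> t i < pi \<and> \<sigma> * (-1) ^ i * ?T (t i) > 0"
     "\<And>i. Suc i < r \<Longrightarrow> t i < t (Suc i)" unfolding alternates_def by blast
  have "k \<le> NZ_star ?T"
  proof (rule NZ_star_ge[OF deg sym P])
    show "t j < t (Suc j)" if "j < k" for j using that t(2) Suc by simp
    have "t k < pi" "0 < t 0" using t(1)[of k] t(1)[of 0] Suc by auto
    then show "t k < t 0 + 2 * pi" using pi_gt_zero by linarith
    fix j assume j: "j < k"
    have "0 < \<sigma> * (-1) ^ j * ?T (t j)" "0 < \<sigma> * (-1) ^ Suc j * ?T (t (Suc j))"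
      using t(1)[of j] t(1)[of "Suc j"] j Suc by simp_all
    then have "0 < (\<sigma> * (-1) ^ j * ?T (t j)) * (\<sigma> * (-1) ^ Suc j * ?T (t (Suc j)))" by (rule mult_pos_pos)
    also have "\<dots> = - ((\<sigma> * (-1) ^ j)\<^sup>2 * (?T (t j) * ?T (t (Suc j))))"
      by (simp add: power2_eq_square algebra_simps)
    finally have "(\<sigma> * (-1) ^ j)\<^sup>2 * (?T (t j) * ?T (t (Suc j))) < 0" by simp
    then show "?T (t j) * ?T (t (Suc j)) < 0"
      by (metis mult_less_0_iff not_less zero_le_power2)
  qed simp_all
  then show ?thesis using Suc by simp
qed simp

text \<open>The symmetry about pi carries nonnegativity to the second half of the period; three
  points are negligible.\<close>

lemma circle_mean_abs_of_nonneg: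
  fixes V :: "real \<Rightarrow> real"
  assumes "continuous_on UNIV V" "\<And>t. 0 < t \<Longrightarrow> t < pi \<Longrightarrow> V t \<ge> 0" "\<And>t. V (2 * pi - t) = V t"
  shows "circle_mean (\<lambda>t. \<bar>V t\<bar>) = circle_mean V"
proof -
  have "integral {0..2*pi} (\<lambda>t. \<bar>V t\<bar>) = integral {0..2*pi} V"
  proof (rule integral_spike[of "{0, pi, 2 * pi}"])
    fix t assume t: "t \<in> {0..2*pi} - {0, pi, 2*pi}"
    have "V t \<ge> 0"
    proof (cases "t < pi")
      case True then show ?thesis using t assms(2) by auto
    next
      case False
      then have "V (2 * pi - t) \<ge> 0" using t by (intro assms(2)) auto
      then show ?thesis using assms(3) by simp
    qed
    then show "V t = \<bar>V t\<bar>" by simp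
  qed auto
  then show ?thesis by (simp add: circle_mean_def)
qed

text \<open>\<open>k\<close> is the number of roots in the sign pattern, \<open>L\<close> the
  distance within which the large coefficients surround the support of the difference sequence,
  \<open>J\<close> the number of blocks that the Littlewood-type inequality allows, and
  \<open>N\<close> the number of frequencies of the resulting sparse sum.\<close>

lemma core_bound:
  fixes P :: "int poly" and M m :: int and n r :: nat
  assumes deg: "degree P \<le> 2 * n" and sym: "\<And>j. j \<le> 2 * n \<Longrightarrow> coeff P j = coeff P (2 * n - j)"
    and M: "M \<ge> 1" "\<And>j. \<bar>coeff P j\<bar> \<le> M" and m: "prime m" "m > 4 * M"
    and alt: "\<not> alternates (assoc_cos_poly P n) (-1) 0 pi (Suc r)"
  shows "\<exists>k\<le>r. \<exists>N J L :: nat. \<bar>real_of_int (poly P 1)\<bar> \<le> 2 * real_of_int M * real N * (512 * (real_of_int M)\<^sup>2 * (real N)\<^sup>2 * (real k + 1)) ^ (N * N + N)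
     \<and> N \<le> (2 * L + 1) * 4 ^ Suc J
     \<and> L = nat ((2 * M + 1) * m ^ (2 * k + 1)) + (2 * k + 1)
     \<and> real J \<le> 1024 * (2 * real_of_int M * 4 ^ k) ^ 6 * (2 * (2 * real L + 1)) * (2 * real (2 * k + 1) * (8 * real (2 * k + 2) * real_of_int M) ^ (2 * k + 1)) ^ 6"
proof -
  let ?T = "assoc_cos_poly P n"
  obtain \<theta>s where \<theta>s: "length \<theta>s \<le> r" "set \<theta>s \<subseteq> {0..pi}"
    "\<And>t. 0 < t \<Longrightarrow> t < pi \<Longrightarrow> ?T t * (\<Prod>\<theta>\<leftarrow>\<theta>s. \<theta> - t) \<ge> 0"
    using sign_pattern[of ?T 1 0 pi r] alt by auto
  define k where "k = length \<theta>s"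
  define d where "d = 2 * k + 1"
  obtain q :: "nat \<Rightarrow> real" where q: "q 0 = 1" "(\<Sum>l<d. \<bar>q l\<bar>) \<le> 4 ^ k"
    "\<And>t. (\<Sum>l<d. of_real (q l) * cis (real l * t)) = cis (real k * t) * of_real (\<Prod>\<theta>\<leftarrow>\<theta>s. 2 * cos t - 2 * cos \<theta>)"
    using cosine_product_coefficients[of \<theta>s] unfolding k_def d_def by blast
  \<comment> \<open>The leading 2 makes the product required to be below 1 equal to 1/2 for \<delta>
    = 1/W.\<close>
  define W where "W = 2 * real d * (8 * real (Suc d) * real_of_int M) ^ d"
  have W: "W > 0" unfolding W_def d_def using M by (intro mult_pos_pos zero_less_power) auto
  define \<delta> where "\<delta> = 1 / W"
  have \<delta>: "\<delta> > 0" "real d * (8 * real (Suc d) * real_of_int M) ^ d * \<delta> < 1"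
  proof -
    show "\<delta> > 0" using W by (simp add: \<delta>_def)
    have "real d * (8 * real (Suc d) * real_of_int M) ^ d * \<delta> = (W / 2) * (1 / W)" by (simp add: \<delta>_def W_def)
    also have "\<dots> < 1" using W by simp
    finally show "real d * (8 * real (Suc d) * real_of_int M) ^ d * \<delta> < 1" .
  qed
  obtain p where p: "1 \<le> p" "p \<le> m ^ d" and per: "\<And>a :: int \<Rightarrow> int. \<And>x. (\<forall>x. \<bar>a x\<bar> \<le> M) \<Longrightarrow> a (x - p) \<noteq> a x \<Longrightarrow>
      \<exists>j. \<bar>j - x\<bar> \<le> (2 * M + 1) * m ^ d \<and> \<bar>\<Sum>l<d. q l * of_int (a (j - int l - p) - a (j - int l))\<bar> \<ge> \<delta>"
    using uniform_period[OF m M(1) _ _ \<delta>(2,1), of q] q(1) by (auto simp: d_def)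
  define a where "a = centred_coeff P n"
  have aM: "\<forall>x. \<bar>a x\<bar> \<le> M" using M by (auto simp: a_def centred_coeff_def)
  have a0: "a x = 0" if "x \<notin> {-int n..int n}" for x using that by (auto simp: a_def centred_coeff_def)
  define A where "A y = a (y - p) - a y" for y
  define \<beta> where "\<beta> j = (\<Sum>l<d. q l * of_int (A (j - int l)))" for j
  have Tc: "of_real (?T t) = (\<Sum>x=-int n..int n. of_int (a x) * cis (of_int x * t))" for t
    unfolding a_def by (rule assoc_cos_poly_eq(2)[OF deg sym])
  define K where "K = int n + p + int d"
  define U where "U = {-K..K}"
  have finU: "finite U" by (simp add: U_def)
  have Ashift: "(\<Sum>y\<in>U. of_int (A (y - int l)) * f y) = (\<Sum>x=-int n..int n. of_int (a x) * (f (x + p + int l) - f (x + int l)))"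
    if l: "l \<le> d" for l and f :: "int \<Rightarrow> 'b::comm_ring_1"
  proof -
    have "(\<Sum>y\<in>U. of_int (a (y - int l - p)) * f y) = (\<Sum>x=-int n..int n. of_int (a (x + (p + int l) - int l - p)) * f (x + (p + int l)))"
    proof (rule sum_shift_int[OF finU])
      show "(\<lambda>x. x + (p + int l)) ` {- int n..int n} \<subseteq> U" using l p by (auto simp: U_def K_def)
      fix x assume "x - (p + int l) \<notin> {- int n..int n}"
      then have "a (x - int l - p) = 0" by (intro a0) (simp add: algebra_simps)
      then show "of_int (a (x - int l - p)) * f x = 0" by simp
    qed
    moreover have "(\<Sum>y\<in>U. of_int (a (y - int l)) * f y) = (\<Sum>x=-int n..int n. of_int (a (x + int l - int l)) * f (x + int l))"
    proof (rule sum_shift_int[OF finU])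
      show "(\<lambda>x. x + int l) ` {- int n..int n} \<subseteq> U" using l p by (auto simp: U_def K_def)
      fix x assume "x - int l \<notin> {- int n..int n}"
      then have "a (x - int l) = 0" by (rule a0)
      then show "of_int (a (x - int l)) * f x = 0" by simp
    qed
    ultimately show ?thesis
      by (simp add: A_def left_diff_distrib right_diff_distrib sum_subtractf add.assoc)
  qed
  have A_supp: "y \<in> {-int n..int n} \<or> y - p \<in> {-int n..int n}" if "A y \<noteq> 0" for y
    using that a0[of y] a0[of "y - p"] unfolding A_def by (metis diff_self)
  have A_U: "y \<in> U" if "A y \<noteq> 0" for y
    using A_supp[OF that] p by (auto simp: U_def K_def)
  have \<beta>_supp: "\<exists>l<d. A (j - int l) \<noteq> 0" if "\<beta> j \<noteq> 0" for j
  proof (rule ccontr)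
    assume "\<not> ?thesis"
    then have "\<beta> j = 0" unfolding \<beta>_def by (intro sum.neutral) auto
    with that show False by simp
  qed
  have \<beta>_U: "j \<in> U" if jb: "\<beta> j \<noteq> 0" for j
  proof -
    obtain l where l: "l < d" "A (j - int l) \<noteq> 0" using \<beta>_supp[OF jb] by blast
    then show ?thesis using A_supp[OF l(2)] p by (auto simp: U_def K_def)
  qed
  define \<Lambda> where "\<Lambda> = {j. \<beta> j \<noteq> 0}"
  have \<Lambda>U: "\<Lambda> \<subseteq> U" using \<beta>_U by (auto simp: \<Lambda>_def)
  have fin\<Lambda>: "finite \<Lambda>" using \<Lambda>U finU finite_subset by blast
  define Pr where "Pr t = (\<Prod>\<theta>\<leftarrow>\<theta>s. 2 * cos t - 2 * cos \<theta>)" for t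
  \<comment> \<open>\<open>\<beta>\<close> convolves the coefficients of the root product with those
    of (e^(ipt) - 1) T, so it belongs to the product of the two functions.\<close>
  have Geq: "(\<Sum>x\<in>\<Lambda>. of_real (\<beta> x) * cis (of_int x * t)) = cis (real k * t) * of_real (Pr t) * (cis (of_int p * t) - 1) * of_real (?T t)" for t
  proof -
    have "(\<Sum>x\<in>\<Lambda>. of_real (\<beta> x) * cis (of_int x * t)) = (\<Sum>x\<in>U. of_real (\<beta> x) * cis (of_int x * t))"
      by (rule sum.mono_neutral_left[OF finU \<Lambda>U]) (auto simp: \<Lambda>_def)
    also have "\<dots> = (\<Sum>l<d. of_real (q l) * (\<Sum>x\<in>U. of_int (A (x - int l)) * cis (of_int x * t)))"
      unfolding \<beta>_def by (simp add: sum_distrib_right sum_distrib_left mult.assoc) (rule sum.swap)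
    also have "\<dots> = (\<Sum>l<d. of_real (q l) * (cis (real l * t) * ((cis (of_int p * t) - 1) * of_real (?T t))))"
    proof (intro sum.cong refl arg_cong2[where f = "(*)"])
      fix l assume "l \<in> {..<d}"
      then have "(\<Sum>x\<in>U. of_int (A (x - int l)) * cis (of_int x * t))
        = (\<Sum>x=-int n..int n. of_int (a x) * (cis (of_int (x + p + int l) * t) - cis (of_int (x + int l) * t)))"
        using Ashift[of l "\<lambda>x. cis (of_int x * t)"] by simp
      also have "\<dots> = (\<Sum>x=-int n..int n. cis (real l * t) * ((cis (of_int p * t) - 1) * (of_int (a x) * cis (of_int x * t))))"
      proof (rule sum.cong[OF refl])
        fix x
        have "cis (of_int (x + p + int l) * t) = cis (real l * t) * cis (of_int p * t) * cis (of_int x * t)"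
          "cis (of_int (x + int l) * t) = cis (real l * t) * cis (of_int x * t)"
          by (simp_all add: cis_mult algebra_simps)
        then show "of_int (a x) * (cis (of_int (x + p + int l) * t) - cis (of_int (x + int l) * t))
          = cis (real l * t) * ((cis (of_int p * t) - 1) * (of_int (a x) * cis (of_int x * t)))"
          by (simp only:) (simp add: algebra_simps)
      qed
      finally show "(\<Sum>x\<in>U. of_int (A (x - int l)) * cis (of_int x * t)) = cis (real l * t) * ((cis (of_int p * t) - 1) * of_real (?T t))"
        unfolding Tc sum_distrib_left .
    qed
    also have "\<dots> = (\<Sum>l<d. of_real (q l) * cis (real l * t)) * ((cis (of_int p * t) - 1) * of_real (?T t))"
      by (simp add: sum_distrib_right mult.assoc)
    finally show ?thesis unfolding q(3) Pr_def by (simp add: mult.assoc)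
  qed
  define V where "V t = ?T t * Pr t" for t
  have cV: "continuous_on UNIV V"
  proof -
    have "continuous_on UNIV Pr" unfolding Pr_def
      by (induction \<theta>s) (auto intro!: continuous_intros)
    then show ?thesis unfolding V_def by (intro continuous_intros continuous_on_assoc_cos_poly)
  qed
  have Tsym: "?T (2 * pi - t) = ?T t" for t
  proof -
    have "cis (of_int x * (2 * pi - t)) = cnj (cis (of_int x * t))" for x
    proof -
      have "cis (of_int x * (2 * pi - t)) = cis (2 * pi * of_int x) * cis (- (of_int x * t))"
        by (simp add: cis_mult algebra_simps)
      also have "cis (2 * pi * of_int x) = 1" by (rule cis_multiple_2pi) simp
      finally show ?thesis by (simp add: cis_cnj)
    qed
    then have "of_real (?T (2 * pi - t)) = cnj (of_real (?T t))" unfolding Tc by simp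
    then show ?thesis by simp
  qed
  have Vsym: "V (2 * pi - t) = V t" for t
    unfolding V_def Pr_def Tsym by simp
  have Vpos: "V t \<ge> 0" if "0 < t" "t < pi" for t
    unfolding V_def Pr_def by (rule sign_cos_product[OF \<theta>s(2) that \<theta>s(3)[OF that]])
  \<comment> \<open>The mean is the Fourier coefficient at frequency 0: for each index
    \<open>l\<close> of \<open>q\<close> only the coefficient of T at \<open>k - l\<close>
    survives.\<close>
  have meanV: "circle_mean V \<le> real_of_int M * 4 ^ k"
  proof -
    have Vc: "of_real (V t) = (\<Sum>l<d. \<Sum>x=-int n..int n. of_real (q l * of_int (a x)) * cis (of_int (int l - int k + x) * t))" for t
    proof -
      have "(\<Sum>l<d. of_real (q l) * cis (real l * t)) * of_real (?T t) * cis (- (real k * t)) = of_real (V t)"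
        unfolding q(3) V_def Pr_def by (simp add: cis_mult mult_ac)
      moreover have "(\<Sum>l<d. of_real (q l) * cis (real l * t)) * of_real (?T t) * cis (- (real k * t))
        = (\<Sum>l<d. \<Sum>x=-int n..int n. of_real (q l * of_int (a x)) * cis (of_int (int l - int k + x) * t))"
        unfolding Tc sum_product unfolding sum_distrib_right
      proof (intro sum.cong refl)
        fix l x
        have "cis (of_int (int l - int k + x) * t) = cis (real l * t) * cis (of_int x * t) * cis (- (real k * t))"
          by (simp add: cis_mult algebra_simps)
        then show "of_real (q l) * cis (real l * t) * (of_int (a x) * cis (of_int x * t)) * cis (- (real k * t))
          = of_real (q l * of_int (a x)) * cis (of_int (int l - int k + x) * t)" by simp
      qed
      ultimately show ?thesis by simp
    qed
    have "complex_of_real (circle_mean V) = circle_mean (\<lambda>t. complex_of_real (V t))"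
      by (rule circle_mean_linear[symmetric, OF bounded_linear_of_real cV])
    also have "\<dots> = (\<Sum>l<d. circle_mean (\<lambda>t. \<Sum>x=-int n..int n. of_real (q l * of_int (a x)) * cis (of_int (int l - int k + x) * t)))"
      unfolding Vc by (intro circle_mean_sum continuous_intros) auto
    also have "\<dots> = (\<Sum>l<d. \<Sum>x=-int n..int n. circle_mean (\<lambda>t. of_real (q l * of_int (a x)) * cis (of_int (int l - int k + x) * t)))"
      by (intro sum.cong refl circle_mean_sum continuous_intros) auto
    also have "\<dots> = (\<Sum>l<d. \<Sum>x=-int n..int n. of_real (q l * of_int (a x)) * (if int l - int k + x = 0 then 1 else 0))"
      by (intro sum.cong refl, subst circle_mean_cmult) (auto intro!: continuous_intros simp only: circle_mean_cis_int)
    also have "\<dots> = (\<Sum>l<d. of_real (q l * of_int (a (int k - int l))))"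
    proof (rule sum.cong[OF refl])
      fix l
      have "(\<Sum>x=-int n..int n. of_real (q l * of_int (a x)) * (if int l - int k + x = 0 then 1 else 0))
        = (\<Sum>x=-int n..int n. if x = int k - int l then complex_of_real (q l * of_int (a x)) else 0)"
        by (intro sum.cong) auto
      also have "\<dots> = of_real (q l * of_int (a (int k - int l)))"
        using a0[of "int k - int l"] by simp
      finally show "(\<Sum>x=-int n..int n. of_real (q l * of_int (a x)) * (if int l - int k + x = 0 then 1 else 0)) = complex_of_real (q l * of_int (a (int k - int l)))" .
    qed
    finally have "complex_of_real (circle_mean V) = of_real (\<Sum>l<d. q l * of_int (a (int k - int l)))" by simp
    then have "circle_mean V = (\<Sum>l<d. q l * of_int (a (int k - int l)))" by (simp only: of_real_eq_iff)
    also have "\<dots> \<le> (\<Sum>l<d. \<bar>q l\<bar> * M)"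
    proof (rule sum_mono)
      fix l
      have "\<bar>real_of_int (a (int k - int l))\<bar> \<le> M" using aM by (metis of_int_abs of_int_le_iff)
      then have "\<bar>q l * of_int (a (int k - int l))\<bar> \<le> \<bar>q l\<bar> * M" unfolding abs_mult by (intro mult_left_mono) auto
      then show "q l * of_int (a (int k - int l)) \<le> \<bar>q l\<bar> * M" by linarith
    qed
    also have "\<dots> \<le> 4 ^ k * real_of_int M" unfolding sum_distrib_right[symmetric] using q(2) M by (intro mult_right_mono) auto
    finally show ?thesis by (simp add: mult.commute)
  qed
  define B where "B = 2 * real_of_int M * 4 ^ k"
  have B: "circle_mean (\<lambda>t. norm (\<Sum>x\<in>\<Lambda>. of_real (\<beta> x) * cis (of_int x * t))) \<le> B"
  proof -
    have "circle_mean (\<lambda>t. norm (\<Sum>x\<in>\<Lambda>. of_real (\<beta> x) * cis (of_int x * t))) \<le> circle_mean (\<lambda>t. 2 * \<bar>V t\<bar>)"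
    proof (intro circle_mean_mono continuous_intros cV)
      fix t
      have "norm (cis (of_int p * t) - 1) \<le> 2" using norm_triangle_ineq4[of "cis (of_int p * t)" 1] by simp
      then have "\<bar>Pr t\<bar> * norm (cis (of_int p * t) - 1) * \<bar>?T t\<bar> \<le> \<bar>Pr t\<bar> * 2 * \<bar>?T t\<bar>"
        by (intro mult_right_mono mult_left_mono) auto
      then show "norm (\<Sum>x\<in>\<Lambda>. of_real (\<beta> x) * cis (of_int x * t)) \<le> 2 * \<bar>V t\<bar>"
        unfolding Geq V_def by (simp add: norm_mult abs_mult mult_ac)
    qed
    also have "\<dots> = 2 * circle_mean (\<lambda>t. \<bar>V t\<bar>)" by (intro circle_mean_cmult continuous_intros cV)
    also have "circle_mean (\<lambda>t. \<bar>V t\<bar>) = circle_mean V" by (rule circle_mean_abs_of_nonneg[OF cV Vpos Vsym])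
    also have "2 * circle_mean V \<le> B" using meanV by (simp add: B_def)
    finally show ?thesis by simp
  qed
  define Y where "Y = {j \<in> \<Lambda>. \<bar>\<beta> j\<bar> \<ge> \<delta>}"
  \<comment> \<open>The summand \<open>d\<close> covers the width of a window, since a frequency in
    \<open>\<Lambda>\<close> may lie up to \<open>d - 1\<close> to the right of the support of
    \<open>A\<close>.\<close>
  define L where "L = nat ((2 * M + 1) * m ^ d) + d"
  have m0: "m > 0" using m M by simp
  have L: "int L = (2 * M + 1) * m ^ d + int d" unfolding L_def using M m0 by simp
  have near: "\<exists>j\<in>Y. \<bar>j - y\<bar> \<le> (2 * M + 1) * m ^ d" if "A y \<noteq> 0" for y
  proof -
    have "a (y - p) \<noteq> a y" using that by (simp add: A_def)
    from per[OF aM this] obtain j where j: "\<bar>j - y\<bar> \<le> (2 * M + 1) * m ^ d" "\<bar>\<beta> j\<bar> \<ge> \<delta>"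
      unfolding \<beta>_def A_def by auto
    then have "j \<in> Y" using \<delta> by (auto simp: Y_def \<Lambda>_def)
    then show ?thesis using j by blast
  qed
  have dense: "\<exists>y\<in>Y. \<bar>x - y\<bar> \<le> int L" if x: "x \<in> \<Lambda>" for x
  proof -
    obtain l where l: "l < d" "A (x - int l) \<noteq> 0" using \<beta>_supp[of x] x by (auto simp: \<Lambda>_def)
    obtain j where "j \<in> Y" "\<bar>j - (x - int l)\<bar> \<le> (2 * M + 1) * m ^ d" using near[OF l(2)] by blast
    then show ?thesis using L l by (intro bexI[of _ j]) auto
  qed
  define J0 where "J0 = 1024 * B ^ 6 * (2 * (2 * L + 1)) / \<delta> ^ 6"
  have LC: "real J \<le> J0" if "4 ^ J \<le> card Y" for J
    unfolding J0_def
  proof (rule large_coefficients_bound[where \<Lambda> = \<Lambda> and \<beta> = \<beta> and Y = Y and L = L, OF fin\<Lambda> _ \<delta>(1) _ _ B that])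
    show "Y \<subseteq> \<Lambda>" by (auto simp: Y_def)
    show "\<delta> \<le> \<bar>\<beta> y\<bar>" if "y \<in> Y" for y using that by (simp add: Y_def)
    show "\<exists>y\<in>Y. \<bar>x - y\<bar> \<le> int L" if "x \<in> \<Lambda>" for x by (rule dense[OF that])
  qed
  have J0nn: "J0 \<ge> 0" unfolding J0_def B_def using M \<delta> by auto
  define J where "J = nat \<lfloor>J0\<rfloor>"
  have J: "real J \<le> J0" "J0 < real (Suc J)" using J0nn by (auto simp: J_def) linarith
  have cardY: "card Y \<le> 4 ^ Suc J"
  proof (rule ccontr)
    assume "\<not> card Y \<le> 4 ^ Suc J"
    then have "real (Suc J) \<le> J0" by (intro LC) simp
    then show False using J by simp
  qed
  define S where "S = {y. A y \<noteq> 0}"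
  have finS: "finite S" by (rule finite_subset[OF _ finU]) (use A_U in \<open>auto simp: S_def\<close>)
  have finY: "finite Y" using fin\<Lambda> by (simp add: Y_def)
  have cardS: "card S \<le> (2 * L + 1) * 4 ^ Suc J"
  proof -
    have "S \<subseteq> (\<Union>y\<in>Y. {y - int L..y + int L})"
    proof
      fix x assume "x \<in> S"
      then obtain j where "j \<in> Y" "\<bar>j - x\<bar> \<le> (2 * M + 1) * m ^ d" using near by (auto simp: S_def)
      then show "x \<in> (\<Union>y\<in>Y. {y - int L..y + int L})" using L by (intro UN_I[of j]) auto
    qed
    then have "card S \<le> card (\<Union>y\<in>Y. {y - int L..y + int L})" using finY by (intro card_mono) auto
    also have "\<dots> \<le> (\<Sum>y\<in>Y. card {y - int L..y + int L})" by (rule card_UN_le[OF finY])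
    also have "\<dots> = card Y * (2 * L + 1)"
    proof -
      have "nat (2 * int L + 1) = 2 * L + 1" by linarith
      then show ?thesis by simp
    qed
    also have "\<dots> \<le> 4 ^ Suc J * (2 * L + 1)" using cardY by (intro mult_right_mono) auto
    finally show ?thesis by (simp add: mult.commute)
  qed
  \<comment> \<open>Each \<open>a x\<close> enters \<open>A\<close> positively at
    \<open>x + p\<close> and negatively at \<open>x\<close>, so its positions differ by
    \<open>p\<close>. The centre p/2 cancels and is the one for which the exponential sum is purely
    imaginary.\<close>
  have P1: "real_of_int p * real_of_int (poly P 1) = (\<Sum>y\<in>S. of_int (A y) * (of_int y - of_int p / 2))"
  proof -
    have "(\<Sum>y\<in>S. of_int (A y) * (of_int y - of_int p / 2 :: real)) = (\<Sum>y\<in>U. of_int (A y) * (of_int y - of_int p / 2))"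
      by (rule sum.mono_neutral_left[OF finU]) (use A_U in \<open>auto simp: S_def\<close>)
    also have "\<dots> = (\<Sum>x=-int n..int n. of_int (a x) * of_int p)"
      using Ashift[of 0 "\<lambda>y. of_int y - of_int p / 2 :: real"] by simp
    also have "\<dots> = of_int p * of_int (poly P 1)"
      unfolding poly_1_eq_sum_centred[OF deg] a_def by (simp add: sum_distrib_left mult.commute)
    finally show ?thesis by simp
  qed
  define N where "N = card S"
  have main: "\<bar>real_of_int (poly P 1)\<bar> \<le> 2 * real_of_int M * real N * (512 * (real_of_int M)\<^sup>2 * (real N)\<^sup>2 * (real k + 1)) ^ (N * N + N)"
  proof (cases "S = {}")
    case True
    then show ?thesis using P1 p by (simp add: N_def)
  next
    case False
    \<comment> \<open>Multiplying e^(ipt) - 1 by e^(-ipt/2) gives 2 i sin(pt/2); the sine is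
      positive on (0, 1/p), so \<open>G\<close> inherits the sign pattern of T.\<close>
    define G where "G t = 2 * sin (of_int p * t / 2) * ?T t" for t
    have bound: "\<bar>\<Sum>y\<in>S. of_int (A y) * (of_int y - real_of_int p / 2)\<bar>
       \<le> (2 * real_of_int M) * real N * real_of_int p * (128 * (2 * real_of_int M)\<^sup>2 * (real N)\<^sup>2 * real (k + 1)) ^ (card S * card S + card S)"
    proof (rule sparse_sine_sum_bound[where G = G and \<theta>s = \<theta>s and \<sigma> = 1 and r = k, OF finS False])
      fix y
      have "\<bar>a (y - p)\<bar> \<le> M" "\<bar>a y\<bar> \<le> M" using aM by blast+
      then have "\<bar>A y\<bar> \<le> 2 * M" unfolding A_def by linarith
      then show "\<bar>real_of_int (A y)\<bar> \<le> 2 * real_of_int M" by linarith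
    next
      fix t
      have "(\<Sum>y\<in>S. of_int (A y) * cis ((of_int y - of_int p / 2) * t)) = (\<Sum>y\<in>U. of_int (A y) * cis ((of_int y - of_int p / 2) * t))"
        by (rule sum.mono_neutral_left[OF finU]) (use A_U in \<open>auto simp: S_def\<close>)
      also have "\<dots> = (\<Sum>x=-int n..int n. of_int (a x) * (cis ((of_int (x + p) - of_int p / 2) * t) - cis ((of_int x - of_int p / 2) * t)))"
        using Ashift[of 0 "\<lambda>y. cis ((of_int y - of_int p / 2) * t)"] by simp
      also have "\<dots> = (\<Sum>x=-int n..int n. (cis (of_int p * t / 2) - cis (- (of_int p * t / 2))) * (of_int (a x) * cis (of_int x * t)))"
      proof (rule sum.cong[OF refl])
        fix x
        have "cis ((of_int (x + p) - of_int p / 2) * t) = cis (of_int p * t / 2) * cis (of_int x * t)"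
          "cis ((of_int x - of_int p / 2) * t) = cis (- (of_int p * t / 2)) * cis (of_int x * t)"
          by (simp_all add: cis_mult algebra_simps)
        then show "of_int (a x) * (cis ((of_int (x + p) - of_int p / 2) * t) - cis ((of_int x - of_int p / 2) * t))
          = (cis (of_int p * t / 2) - cis (- (of_int p * t / 2))) * (of_int (a x) * cis (of_int x * t))"
          by (simp only:) (simp add: algebra_simps)
      qed
      also have "\<dots> = (cis (of_int p * t / 2) - cis (- (of_int p * t / 2))) * of_real (?T t)"
        unfolding Tc sum_distrib_left ..
      also have "cis (of_int p * t / 2) - cis (- (of_int p * t / 2)) = \<i> * of_real (2 * sin (of_int p * t / 2))"
        by (simp add: complex_eq_iff)
      finally show "(\<Sum>y\<in>S. of_int (A y) * cis ((of_int y - of_int p / 2) * t)) = \<i> * of_real (G t)"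
        by (simp add: G_def mult.assoc)
    next
      fix t :: real assume t: "0 < t" "t < 1 / of_int p"
      have "of_int p * t < 1" using t p by (simp add: field_simps)
      moreover have "1 * t \<le> of_int p * t" using t p by (intro mult_right_mono) auto
      ultimately have "t < pi" "of_int p * t / 2 < pi" using pi_gt3 by linarith+
      then have "sin (of_int p * t / 2) > 0" using t p by (intro sin_gt_zero) auto
      then have 1: "2 * sin (of_int p * t / 2) \<ge> 0" by simp
      have "0 \<le> (2 * sin (of_int p * t / 2)) * (?T t * (\<Prod>\<theta>\<leftarrow>\<theta>s. \<theta> - t))"
        by (rule mult_nonneg_nonneg[OF 1 \<theta>s(3)[OF t(1) \<open>t < pi\<close>]])
      then show "0 \<le> 1 * G t * (\<Prod>\<theta>\<leftarrow>\<theta>s. \<theta> - t)" by (simp add: G_def mult_ac)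
    qed (use M p in \<open>auto simp: k_def N_def\<close>)
    have "of_int p * \<bar>real_of_int (poly P 1)\<bar> = \<bar>of_int p * real_of_int (poly P 1)\<bar>" using p by (simp add: abs_mult)
    also have "\<dots> \<le> of_int p * (2 * real_of_int M * real N * (512 * (real_of_int M)\<^sup>2 * (real N)\<^sup>2 * (real k + 1)) ^ (N * N + N))"
      unfolding P1 using bound by (simp add: N_def power_mult_distrib mult_ac add.commute)
    finally show ?thesis using p by (simp add: mult_le_cancel_left_pos)
  qed
  show ?thesis
  proof (rule exI[of _ k], rule conjI, goal_cases)
    case 2
    show ?case
    proof (rule exI[of _ N], rule exI[of _ J], rule exI[of _ L], intro conjI)
      show "N \<le> (2 * L + 1) * 4 ^ Suc J" using cardS by (simp add: N_def)
      show "L = nat ((2 * M + 1) * m ^ (2 * k + 1)) + (2 * k + 1)" by (simp add: L_def d_def)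
      have "J0 = 1024 * (2 * real_of_int M * 4 ^ k) ^ 6 * (2 * (2 * real L + 1)) * W ^ 6"
        unfolding J0_def B_def \<delta>_def using W by (simp add: power_divide)
      moreover have "Suc d = 2 * k + 2" by (simp add: d_def)
      ultimately show "real J \<le> 1024 * (2 * real_of_int M * 4 ^ k) ^ 6 * (2 * (2 * real L + 1)) * (2 * real (2 * k + 1) * (8 * real (2 * k + 2) * real_of_int M) ^ (2 * k + 1)) ^ 6"
        using J(1) unfolding W_def d_def by simp
    qed (rule main)
  qed (use \<theta>s in \<open>simp add: k_def\<close>)
qed

section \<open>The triple logarithm\<close>

text \<open>First N is at most exp(v^30), since the number of blocks is at most v^28. Then ln Q is
  at most of order N^2 times a polynomial in v, hence at most exp(v^31), and two more logarithms
  leave 31 ln v.\<close>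

lemma triple_log_le:
  fixes v Q M :: real and k J N :: nat
  assumes v: "v \<ge> 80" and J: "real J \<le> v ^ 28" and N: "real N \<le> 5 * v * 4 ^ Suc J"
    and M: "M \<ge> 1" "2 * M \<le> v" "512 * M\<^sup>2 * (real k + 1) \<le> v ^ 5"
    and Q: "Q \<le> 2 * M * real N * (512 * M\<^sup>2 * (real N)\<^sup>2 * (real k + 1)) ^ (N * N + N)" "Q > exp (exp 1)"
  shows "ln (ln (ln Q)) \<le> 31 * ln v"
proof -
  define X where "X = exp (v ^ 30)"
  have pw: "v ^ i * 80 \<le> v ^ Suc i" for i
    using v by (simp add: mult.commute[of "v ^ i"] mult_right_mono)
  have pm: "v ^ i \<le> v ^ j" if "i \<le> j" for i j using v that by (intro power_increasing) auto
  have NX: "real N \<le> X"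
  proof -
    have "exp 1 \<ge> (2::real)" using exp_ge_add_one_self[of 1] by simp
    then have "(2::real)\<^sup>2 \<le> (exp 1)\<^sup>2" by (intro power_mono) auto
    then have "(4::real) \<le> exp 2" by (simp flip: exp_of_nat_mult)
    then have "(4::real) ^ Suc J \<le> exp 2 ^ Suc J" by (intro power_mono) auto
    also have "\<dots> = exp (2 * real (Suc J))" by (simp only: exp_of_nat_mult[symmetric] mult.commute)
    finally have 4: "(4::real) ^ Suc J \<le> exp (2 * real (Suc J))" .
    have "5 * v \<le> exp (5 * v)" using exp_ge_add_one_self[of "5 * v"] by linarith
    then have "5 * v * 4 ^ Suc J \<le> exp (5 * v) * exp (2 * real (Suc J))"
      using 4 v by (intro mult_mono) auto
    also have "\<dots> = exp (5 * v + 2 * real J + 2)" by (simp add: exp_add[symmetric] algebra_simps)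
    also have "\<dots> \<le> X"
    proof -
      have "v \<le> v ^ 28" using pm[of 1 28] by simp
      moreover have "2 \<le> v ^ 28" using v calculation by linarith
      moreover have "v ^ 28 * 80 \<le> v ^ 29" "v ^ 29 \<le> v ^ 30" using pw[of 28] pm[of 29 30] by simp_all
      ultimately have "5 * v + 2 * real J + 2 \<le> v ^ 30" using J by linarith
      then show ?thesis by (simp add: X_def)
    qed
    finally show ?thesis using N by linarith
  qed
  have Q0: "Q > 1" using Q(2) one_less_exp_iff[of "exp 1"] by (smt (verit) exp_gt_zero)
  have N1: "N \<ge> 1"
  proof (rule ccontr)
    assume "\<not> N \<ge> 1"
    then have "N = 0" by simp
    then show False using Q(1) Q0 by simp
  qed
  have X1: "X \<ge> 1" using v by (simp add: X_def)
  define E where "E = v + v ^ 30 + real (N * N + N) * (5 * v + 2 * v ^ 30)"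
  have "Q \<le> exp E"
  proof -
    have vexp: "v \<le> exp v" using exp_ge_add_one_self[of v] by linarith
    have "512 * M\<^sup>2 * (real N)\<^sup>2 * (real k + 1) = (512 * M\<^sup>2 * (real k + 1)) * (real N)\<^sup>2" by simp
    also have "\<dots> \<le> v ^ 5 * X\<^sup>2" using M NX v by (intro mult_mono power_mono) auto
    also have "\<dots> \<le> exp v ^ 5 * X\<^sup>2" using vexp v by (intro mult_right_mono power_mono) auto
    also have "\<dots> = exp (5 * v + 2 * v ^ 30)" by (simp add: X_def exp_add flip: exp_of_nat_mult)
    finally have "(512 * M\<^sup>2 * (real N)\<^sup>2 * (real k + 1)) ^ (N * N + N) \<le> exp (5 * v + 2 * v ^ 30) ^ (N * N + N)"
      by (intro power_mono) auto
    also have "\<dots> = exp (real (N * N + N) * (5 * v + 2 * v ^ 30))" by (rule exp_of_nat_mult[symmetric])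
    finally have 1: "(512 * M\<^sup>2 * (real N)\<^sup>2 * (real k + 1)) ^ (N * N + N) \<le> exp (real (N * N + N) * (5 * v + 2 * v ^ 30))" .
    have "2 * M * real N \<le> exp v * X" using M NX vexp by (intro mult_mono) auto
    from mult_mono[OF this 1] have "2 * M * real N * (512 * M\<^sup>2 * (real N)\<^sup>2 * (real k + 1)) ^ (N * N + N) \<le> (exp v * X) * exp (real (N * N + N) * (5 * v + 2 * v ^ 30))"
      using M X1 by simp
    also have "\<dots> = exp E" by (simp add: X_def E_def exp_add)
    finally show ?thesis using Q(1) by linarith
  qed
  then have "ln Q \<le> ln (exp E)" using Q0 by (subst ln_le_cancel_iff) auto
  then have "ln Q \<le> E" by simp
  also have "E \<le> exp (v ^ 31)"
  proof -
    have NN: "real (N * N + N) \<le> 2 * X\<^sup>2"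
    proof -
      have "real N * real N \<le> X * X" using NX by (intro mult_mono) auto
      moreover have "real N * 1 \<le> X * X" using NX X1 by (intro mult_mono) auto
      ultimately show ?thesis by (simp add: power2_eq_square)
    qed
    have v30: "v \<le> v ^ 30" "v ^ 30 * 80 \<le> v ^ 31" using pm[of 1 30] pw[of 30] by simp_all
    have "5 * v + 2 * v ^ 30 \<le> v ^ 31" "v + v ^ 30 \<le> v ^ 31" using v30 v by linarith+
    then have "E \<le> v ^ 31 + 2 * X\<^sup>2 * v ^ 31"
      unfolding E_def using NN v by (intro add_mono mult_mono) auto
    also have "\<dots> \<le> 3 * X\<^sup>2 * v ^ 31"
    proof -
      have "1 * v ^ 31 \<le> X\<^sup>2 * v ^ 31" using X1 v by (intro mult_right_mono one_le_power) auto
      then show ?thesis by linarith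
    qed
    also have "\<dots> \<le> exp v * X\<^sup>2 * exp v ^ 31"
    proof -
      have "3 \<le> exp v" "v \<le> exp v" using exp_ge_add_one_self[of v] v by linarith+
      then show ?thesis using v X1 by (intro mult_mono power_mono) auto
    qed
    also have "\<dots> = exp (32 * v + 2 * v ^ 30)" by (simp add: X_def exp_add[symmetric] flip: exp_of_nat_mult)
    also have "\<dots> \<le> exp (v ^ 31)" using v30 v by simp
    finally show ?thesis .
  qed
  finally have 1: "ln Q \<le> exp (v ^ 31)" .
  have "ln (exp (exp 1)) < ln Q" using Q(2) Q0 by (subst ln_less_cancel_iff) auto
  then have lnQ: "ln Q > exp 1" by simp
  then have lnQ0: "ln Q > 1" using one_less_exp_iff[of 1] by linarith
  have "ln (ln Q) \<le> v ^ 31" using 1 lnQ0 by (metis ln_exp ln_le_cancel_iff exp_gt_zero less_trans zero_less_one)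
  moreover have "ln (ln Q) > 0" using lnQ0 by simp
  ultimately have "ln (ln (ln Q)) \<le> ln (v ^ 31)" using v by simp
  also have "\<dots> = 31 * ln v" using v by (simp add: ln_realpow)
  finally show ?thesis .
qed

text \<open>The base of \<open>v\<close> is the product of \<open>m\<close> and the base occurring
  in 1/\<delta>, so that \<open>v\<close> dominates both powers with exponent 2k + 1. The 28 is 2 +
  6 + 2 + 18, one summand for each factor in the bound on \<open>J\<close>.\<close>

lemma core_parameters:
  fixes M m :: int and k J L N :: nat
  assumes M: "M \<ge> 1" and m: "m > 4 * M"
    and L: "L = nat ((2 * M + 1) * m ^ (2 * k + 1)) + (2 * k + 1)"
    and J: "real J \<le> 1024 * (2 * real_of_int M * 4 ^ k) ^ 6 * (2 * (2 * real L + 1)) * (2 * real (2 * k + 1) * (8 * real (2 * k + 2) * real_of_int M) ^ (2 * k + 1)) ^ 6"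
    and N: "N \<le> (2 * L + 1) * 4 ^ Suc J"
  defines "v \<equiv> (8 * real (2 * k + 2) * real_of_int M * real_of_int m) ^ (2 * k + 1)"
  shows "v \<ge> 80" "real J \<le> v ^ 28" "real N \<le> 5 * v * 4 ^ Suc J" "2 * real_of_int M \<le> v" "512 * (real_of_int M)\<^sup>2 * (real k + 1) \<le> v ^ 5"
proof -
  define d where "d = 2 * k + 1"
  define M' m' b where "M' = real_of_int M" and "m' = real_of_int m" and "b = 8 * real (2 * k + 2)"
  have M1: "M' \<ge> 1" and m5: "m' \<ge> 5" using M m by (auto simp: M'_def m'_def)
  have b: "b \<ge> 16" by (simp add: b_def)
  have d1: "d \<ge> 1" by (simp add: d_def)
  have v: "v = (b * M' * m') ^ d" by (simp add: v_def d_def M'_def m'_def b_def)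
  have bM: "b * M' \<ge> 16" using mult_mono[of 16 b 1 M'] b M1 by simp
  have self: "x \<le> x ^ d" if "x \<ge> 1" for x :: real using that d1 by (intro self_le_power) auto
  have bMv: "(b * M') ^ d * m' ^ d = v" by (simp add: v power_mult_distrib)
  have bMd1: "(b * M') ^ d \<ge> 16" using self[of "b * M'"] bM by linarith
  have md5: "m' ^ d \<ge> 5" using self[of m'] m5 by linarith
  show v80: "v \<ge> 80" using mult_mono[OF bMd1 md5] bMv bMd1 by simp
  have bMdv: "(b * M') ^ d \<le> v" using mult_left_mono[of 1 "m' ^ d" "(b * M') ^ d"] md5 bMd1 bMv by simp
  have dv: "real d \<le> v"
  proof -
    have "real d \<le> 2 ^ d" using of_nat_less_two_power[of d, where 'a = real] by linarith
    also have "\<dots> \<le> (b * M') ^ d" using bM by (intro power_mono) auto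
    finally show ?thesis using bMdv by linarith
  qed
  have Mb: "3 * M' \<le> (b * M') ^ d"
  proof -
    have "3 * M' \<le> b * M'" using b M1 by (intro mult_right_mono) auto
    then show ?thesis using self[of "b * M'"] bM by linarith
  qed
  have m0: "m > 0" using m M by simp
  have Lr: "real L = (2 * M' + 1) * m' ^ d + real d"
  proof -
    have "0 \<le> (2 * M + 1) * m ^ d" using M m0 by simp
    then have "real (nat ((2 * M + 1) * m ^ d)) = real_of_int ((2 * M + 1) * m ^ d)" by (rule of_nat_nat)
    then show ?thesis unfolding L by (simp add: d_def M'_def m'_def)
  qed
  have "(2 * M' + 1) * m' ^ d \<le> (b * M') ^ d * m' ^ d"
    using Mb M1 md5 by (intro mult_right_mono) auto
  then have L2: "real L \<le> 2 * v" using Lr dv bMv by linarith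
  have B: "2 * M' * 4 ^ k \<le> v"
  proof -
    have "(4::real) ^ k \<le> (b * M') ^ k" using bM by (intro power_mono) auto
    also have "\<dots> \<le> (b * M') ^ (2 * k)" using bM by (intro power_increasing) auto
    finally have "(2 * M') * 4 ^ k \<le> (b * M') * (b * M') ^ (2 * k)" using b M1 by (intro mult_mono) auto
    also have "\<dots> = (b * M') ^ d" by (simp add: d_def)
    finally show ?thesis using bMdv by linarith
  qed
  have W: "2 * real d * (b * M') ^ d \<le> v ^ 3"
  proof -
    have "2 * real d * (b * M') ^ d \<le> (v * v) * v" using dv v80 bMdv bMd1 by (intro mult_mono) auto
    then show ?thesis by (simp add: power3_eq_cube)
  qed
  have "real J \<le> 1024 * (2 * M' * 4 ^ k) ^ 6 * (2 * (2 * real L + 1)) * (2 * real d * (b * M') ^ d) ^ 6"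
    using J by (simp add: M'_def d_def b_def)
  also have "\<dots> \<le> v\<^sup>2 * v ^ 6 * v\<^sup>2 * (v ^ 3) ^ 6"
  proof (intro mult_mono power_mono B W)
    have vv: "80 * 80 \<le> v * v" "80 * v \<le> v * v" using v80 by (intro mult_mono; simp)+
    show "1024 \<le> v\<^sup>2" using vv unfolding power2_eq_square by linarith
    have "2 * (2 * real L + 1) \<le> 80 * v" using L2 v80 by argo
    also have "\<dots> \<le> v\<^sup>2" using vv(2) by (simp only: power2_eq_square)
    finally show "2 * (2 * real L + 1) \<le> v\<^sup>2" .
  qed (use M1 v80 bMd1 in auto)
  also have "\<dots> = v ^ 28" by (simp flip: power_mult power_add)
  finally show "real J \<le> v ^ 28" .
  have "real N \<le> real ((2 * L + 1) * 4 ^ Suc J)" using N by (simp only: of_nat_le_iff)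
  also have "\<dots> = (2 * real L + 1) * 4 ^ Suc J" by (simp add: algebra_simps)
  also have "\<dots> \<le> 5 * v * 4 ^ Suc J" using L2 v80 by (intro mult_right_mono) auto
  finally show "real N \<le> 5 * v * 4 ^ Suc J" .
  have Mv: "3 * M' \<le> v" using Mb bMdv by linarith
  then show "2 * real_of_int M \<le> v" using M1 by (simp add: M'_def)
  have kv: "real k + 1 \<le> v"
    using dv v80 by (simp add: d_def)
  have "80 * 80 \<le> v * v" using v80 by (intro mult_mono) auto
  then have "512 * M'\<^sup>2 * (real k + 1) \<le> v\<^sup>2 * v\<^sup>2 * v"
    using kv M1 Mv v80 by (intro mult_mono power_mono) (auto simp: power2_eq_square)
  then show "512 * (real_of_int M)\<^sup>2 * (real k + 1) \<le> v ^ 5"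
    unfolding M'_def by (simp flip: power_add power_Suc2)
qed

text \<open>A logarithm is absorbed by ln y \<le> y^\<eta> / \<eta>, which raises the exponent of x
  to 1 + \<eta>; the choice of \<eta> makes (1 + \<eta>)(1 - \<epsilon>) = 1.\<close>

lemma powr_bound_of_linear_log:
  fixes \<epsilon> E x z :: real
  assumes "0 < \<epsilon>" "\<epsilon> < 1" "E \<ge> 1" "x \<ge> 1" "z \<ge> 0" "z \<le> 62 * x * ln (E * x)"
  defines "\<eta> \<equiv> \<epsilon> / (1 - \<epsilon>)"
  shows "z powr (1 - \<epsilon>) \<le> (62 / \<eta> * E powr \<eta>) powr (1 - \<epsilon>) * x"
proof -
  have \<eta>: "\<eta> > 0" "(1 + \<eta>) * (1 - \<epsilon>) = 1" using assms by (auto simp: \<eta>_def field_simps)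
  have Ex: "1 \<le> E * x" using assms mult_mono[of 1 E 1 x] by simp
  have "z \<le> 62 * x * ln (E * x)" by fact
  also have "\<dots> \<le> 62 * x * ((E * x) powr \<eta> / \<eta>)"
    using assms Ex \<eta> by (intro mult_left_mono ln_powr_bound) auto
  also have "\<dots> = (62 / \<eta> * E powr \<eta>) * x powr (1 + \<eta>)"
    using assms by (simp add: powr_mult powr_add)
  finally have "z powr (1 - \<epsilon>) \<le> ((62 / \<eta> * E powr \<eta>) * x powr (1 + \<eta>)) powr (1 - \<epsilon>)"
    using assms by (intro powr_mono2) auto
  also have "\<dots> = (62 / \<eta> * E powr \<eta>) powr (1 - \<epsilon>) * (x powr (1 + \<eta>)) powr (1 - \<epsilon>)"
    by (rule powr_mult)
  also have "(x powr (1 + \<eta>)) powr (1 - \<epsilon>) = x powr ((1 + \<eta>) * (1 - \<epsilon>))" by (rule powr_powr)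
  also have "\<dots> = x" unfolding \<eta>(2) using \<open>x \<ge> 1\<close> by simp
  finally show ?thesis .
qed

theorem theorem2p1:
  fixes \<epsilon> :: real and M :: int
  assumes "0 < \<epsilon>" and "\<epsilon> < 1"
  shows "\<exists>c > 0. \<forall>(S :: int set) (n :: nat) (P :: int poly).
           finite S \<and> S \<noteq> {} \<and> Max (abs ` S) = M \<and>
           self_reciprocal_in S (2 * n) P \<and>
           \<bar>real_of_int (poly P 1)\<bar> > exp (exp 1) \<longrightarrow>
           real (NZ_star (assoc_cos_poly P n))
             \<ge> c * (ln (ln (ln \<bar>real_of_int (poly P 1)\<bar>))) powr (1 - \<epsilon>) - 1"
proof -
  \<comment> \<open>The prime is fixed before \<open>S\<close>, \<open>n\<close> and
    \<open>P\<close> appear, so the constant depends on \<epsilon> and \<open>M\<close>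
    only.\<close>
  obtain m :: int where m: "prime m" "m > 4 * M"
  proof -
    obtain m :: nat where "prime m" "m > nat (4 * M)" using bigger_prime by blast
    then show ?thesis using that[of "int m"] by (auto simp: nat_less_iff)
  qed
  define \<eta> where "\<eta> = \<epsilon> / (1 - \<epsilon>)"
  \<comment> \<open>The 16 comes from 8 (2k + 2) = 16 (k + 1). The maximum keeps \<open>E\<close> at
    least 1 while nothing is known about \<open>M\<close>.\<close>
  define E where "E = max 1 (16 * real_of_int M * real_of_int m)"
  define C where "C = (62 / \<eta> * E powr \<eta>) powr (1 - \<epsilon>)"
  have \<eta>: "\<eta> > 0" using assms by (simp add: \<eta>_def)
  have "E \<ge> 1" by (simp add: E_def)
  then have C: "C > 0" using \<eta> by (simp add: C_def)
  show ?thesis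
  proof (rule exI[of _ "1 / (2 * C)"], intro conjI allI impI)
    show "1 / (2 * C) > 0" using C by simp
    fix S :: "int set" and n :: nat and P :: "int poly"
    assume "finite S \<and> S \<noteq> {} \<and> Max (abs ` S) = M \<and> self_reciprocal_in S (2 * n) P \<and> \<bar>real_of_int (poly P 1)\<bar> > exp (exp 1)"
    then have S: "finite S" "S \<noteq> {}" "Max (abs ` S) = M" and rec: "self_reciprocal_in S (2 * n) P"
      and big: "\<bar>real_of_int (poly P 1)\<bar> > exp (exp 1)" by auto
    define T where "T = assoc_cos_poly P n"
    have deg: "degree P \<le> 2 * n" and sym: "\<And>j. j \<le> 2 * n \<Longrightarrow> coeff P j = coeff P (2 * n - j)"
      and co: "\<And>j. j \<le> 2 * n \<Longrightarrow> coeff P j \<in> S" using rec unfolding self_reciprocal_in_def by blast+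
    have MS: "\<bar>x\<bar> \<le> M" if "x \<in> S" for x
      unfolding S(3)[symmetric] by (rule Max_ge) (use S that in auto)
    have M0: "M \<ge> 0"
    proof -
      obtain x where "x \<in> S" using S(2) by blast
      from MS[OF this] show ?thesis by linarith
    qed
    have coM: "\<bar>coeff P j\<bar> \<le> M" for j
      by (cases "j \<le> 2 * n") (use MS co M0 deg in \<open>auto simp: coeff_eq_0\<close>)
    have P0: "P \<noteq> 0"
    proof
      assume "P = 0"
      then show False using big exp_gt_zero[of "exp 1 :: real"] by simp
    qed
    have M1: "M \<ge> 1"
    proof (rule ccontr)
      assume "\<not> M \<ge> 1"
      then have "coeff P j = 0" for j using coM[of j] M0 by simp
      then show False using P0 by (simp add: poly_eq_iff)
    qed
    have ex: "\<exists>r. \<not> alternates T (-1) 0 pi (Suc r)"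
    proof
      show "\<not> alternates T (-1) 0 pi (Suc (NZ_star T + 1))"
        using alternates_le_NZ_star[OF deg sym P0, of "-1" "Suc (NZ_star T + 1)"] by (auto simp: T_def)
    qed
    define r where "r = (LEAST r. \<not> alternates T (-1) 0 pi (Suc r))"
    have r: "\<not> alternates T (-1) 0 pi (Suc r)" unfolding r_def by (rule LeastI_ex[OF ex])
    have rNZ: "r \<le> NZ_star T + 1"
    proof (cases r)
      case (Suc r')
      then have "alternates T (-1) 0 pi r" using not_less_Least[of r' "\<lambda>r. \<not> alternates T (-1) 0 pi (Suc r)"] unfolding r_def by auto
      then show ?thesis using alternates_le_NZ_star[OF deg sym P0, of "-1" r] by (simp add: T_def)
    qed simp
    define Q where "Q = \<bar>real_of_int (poly P 1)\<bar>"
    obtain k N J L :: nat where k: "k \<le> r" and Q: "Q \<le> 2 * real_of_int M * real N * (512 * (real_of_int M)\<^sup>2 * (real N)\<^sup>2 * (real k + 1)) ^ (N * N + N)"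
      and N: "N \<le> (2 * L + 1) * 4 ^ Suc J" and L: "L = nat ((2 * M + 1) * m ^ (2 * k + 1)) + (2 * k + 1)"
      and J: "real J \<le> 1024 * (2 * real_of_int M * 4 ^ k) ^ 6 * (2 * (2 * real L + 1)) * (2 * real (2 * k + 1) * (8 * real (2 * k + 2) * real_of_int M) ^ (2 * k + 1)) ^ 6"
      using core_bound[OF deg sym M1 coM m r[unfolded T_def]] unfolding Q_def by blast
    define z where "z = ln (ln (ln Q))"
    define x where "x = real k + 1"
    define w where "w = 8 * real (2 * k + 2) * real_of_int M * real_of_int m"
    note par = core_parameters[OF M1 m(2) L J N]
    have "z \<le> 31 * ln (w ^ (2 * k + 1))"
      unfolding z_def w_def
      by (rule triple_log_le[OF par(1,2,3) _ par(4,5) Q]) (use M1 big in \<open>auto simp: Q_def\<close>)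
    also have "\<dots> = 31 * (real (2 * k + 1) * ln w)"
    proof -
      have "w > 0" unfolding w_def using M1 m by auto
      then show ?thesis by (simp only: ln_realpow)
    qed
    also have "w = E * x"
    proof -
      have "1 \<le> 16 * M * m" using M1 m mult_mono[of 1 M 1 m] by simp
      then have "1 \<le> real_of_int (16 * M * m)" by linarith
      then show ?thesis by (simp add: w_def E_def x_def algebra_simps)
    qed
    also have "31 * (real (2 * k + 1) * ln (E * x)) \<le> 31 * ((2 * x) * ln (E * x))"
      using \<open>E \<ge> 1\<close> mult_mono[of 1 E 1 x] by (intro mult_left_mono mult_right_mono) (auto simp: x_def)
    finally have zx: "z \<le> 62 * x * ln (E * x)" by simp
    have z0: "z \<ge> 0"
    proof -
      have "exp 1 < ln Q" using big unfolding Q_def by (metis exp_gt_zero ln_exp ln_less_cancel_iff less_trans)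
      then have "1 < ln (ln Q)" by (metis exp_gt_zero ln_exp ln_less_cancel_iff less_trans)
      then show ?thesis by (simp add: z_def)
    qed
    have "z powr (1 - \<epsilon>) \<le> C * x"
      unfolding C_def \<eta>_def by (rule powr_bound_of_linear_log) (use assms zx z0 \<open>E \<ge> 1\<close> in \<open>auto simp: x_def\<close>)
    then have "1 / (2 * C) * z powr (1 - \<epsilon>) \<le> x / 2" using C by (simp add: field_simps)
    \<comment> \<open>Here x = k + 1 is at most \<open>NZ_star T + 2\<close>; the halving built into
      the constant reduces the loss from 2 to the 1 that is subtracted in the claim.\<close>
    also have "x / 2 \<le> real (NZ_star T) + 1" using k rNZ by (simp add: x_def)
    finally show "real (NZ_star (assoc_cos_poly P n)) \<ge> 1 / (2 * C) * (ln (ln (ln \<bar>real_of_int (poly P 1)\<bar>))) powr (1 - \<epsilon>) - 1"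
      by (simp add: z_def Q_def T_def)
  qed
qed

end
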